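(* Let $1\le m\le n-1$ be integers, let $p>1$ and let $q$ be the conjugate exponent, $\frac1p+\frac1q=1$. Let $U\subset\mathbb{R}^{n-m}$ and $V\subset\mathbb{R}^m$ be domains, and let $f:U\times V\to\Omega$ be a $C^1$-smooth diffeomorphism onto a domain $\Omega\subset\mathbb{R}^n$. For $x\in U$ let $\sigma_x=f(\{x\}\times V)$, and let $\Sigma=\{\sigma_x\}_{x\in U}$ be the resulting family of $m$-dimensional surfaces. Put $$l(x)=\int_V\left(\frac{|J^y_f(x,y)|}{|J_f(x,y)|}\right)^{q}|J_f(x,y)|\,dy,\qquad x\in U.$$ Then the extremal function for the $p$-modulus of $\Sigma$ is the function $f_\Sigma$ on $\Omega$ given by $$f_\Sigma(z)=\frac{1}{l(x)}\left(\frac{|J^y_f(x,y)|}{|J_f(x,y)|}\right)^{q-1},\qquad z=f(x,y),\ (x,y)\in U\times V,$$ and the $p$-modulus of $\Sigma$ equals $$\mathrm{mod}_p(\Sigma)=\int_U l(x)^{1-p}\,dx.$$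
   Context: Jacobians. $J_f=\det Df$ is the Jacobian determinant of $f$, and $|J_f|$ its absolute value. For $(x,y)\in U\times V$, $|J^y_f(x,y)|$ is the Jacobian at $y$ of the map $V\ni y\mapsto f(x,y)\in\mathbb{R}^n$ with $x$ fixed. It is the square root of the sum of the squares of all $m\times m$ minors of the $n\times m$ matrix $D_yf(x,y)$, equivalently $\sqrt{\det\big((D_yf)^\top D_yf\big)}$. $p$-modulus. Each surface $\sigma_x$ is identified with the measure $H^m_{\sigma_x}$, the $m$-dimensional Hausdorff measure restricted to $\sigma_x$, regarded as a Borel measure. The reference measure on $\Omega$ is $n$-dimensional Lebesgue measure $dz$. For a subfamily $\Sigma'\subset\Sigma$, a non-negative Borel function $g:\Omega\to[0,\infty]$ is admissible for $\Sigma'$, written $g\in\mathrm{adm}(\Sigma')$, if $\int_{\sigma_x} g\,dH^m_{\sigma_x}\ge 1$ for every $\sigma_x\in\Sigma'$. The $p$-modulus is $$\mathrm{mod}_p(\Sigma')=\inf_{g\in\mathrm{adm}(\Sigma')}\int_\Omega g^p\,dz,$$ with $\mathrm{mod}_p(\Sigma')=\infty$ if $\mathrm{adm}(\Sigma')=\emptyset$. Extremal function. An admissible function $g$ is extremal for the $p$-modulus of $\Sigma$ if $\int_\Omega g^p\,dz=\mathrm{mod}_p(\Sigma)$. Extremality is understood up to a subfamily of $p$-modulus zero: it suffices that there is a subfamily $\Sigma_1\subset\Sigma$ with $\mathrm{mod}_p(\Sigma_1)=0$ such that $g$ is admissible for $\Sigma\setminus\Sigma_1$ and $\int_\Omega g^p\,dz=\mathrm{mod}_p(\Sigma)$.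 Conventions: $1/\infty=0$ and $\infty^{1-p}=0$ if $l(x)=\infty$. *)

theory Defs
  imports "HOL-Analysis.Analysis"
begin

definition is_domain :: "'a::topological_space set \<Rightarrow> bool" where
  "is_domain S \<longleftrightarrow> open S \<and> connected S \<and> S \<noteq> {}"

definition C1_on :: "'a::real_normed_vector set \<Rightarrow> ('a \<Rightarrow> 'b::real_normed_vector) \<Rightarrow> bool" where
  "C1_on S f \<longleftrightarrow>
    (\<exists>f' :: 'a \<Rightarrow> 'a \<Rightarrow>\<^sub>L 'b.
      (\<forall>z\<in>S. (f has_derivative blinfun_apply (f' z)) (at z)) \<and> continuous_on S f')"

definition C1_diffeomorphism ::
  "'a::real_normed_vector set \<Rightarrow> 'b::real_normed_vector set \<Rightarrow> ('a \<Rightarrow> 'b) \<Rightarrow> bool" where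
  "C1_diffeomorphism S T f \<longleftrightarrow>
    bij_betw f S T \<and> C1_on S f \<and> C1_on T (the_inv_into S f)"

text \<open>
  Real powers of extended non-negative reals, with \<open>\<infinity> powr a = 0\<close> and \<open>0 powr a = \<infinity>\<close> for
  \<open>a < 0\<close>, and \<open>x powr 0 = 1\<close> for every \<open>x\<close>.
\<close>

definition ennreal_powr :: "ennreal \<Rightarrow> real \<Rightarrow> ennreal" where
  "ennreal_powr x a =
    (if a = 0 then 1
     else if x = 0 then (if a < 0 then \<infinity> else 0)
     else if x = \<infinity> then (if a < 0 then 0 else \<infinity>)
     else ennreal (enn2real x powr a))"

text \<open>
  The \<open>m\<close>-dimensional Hausdorff measure in its standard normalisation: the factor
  \<open>unit_ball_vol m / 2 ^ m\<close> makes a set of diameter \<open>d\<close> weigh as much as an \<open>m\<close>-dimensional ball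
  of diameter \<open>d\<close>, so that in \<open>m\<close>-dimensional Euclidean space one obtains Lebesgue measure.
  Boundedness is required because \<open>diameter\<close> is unspecified on unbounded sets; the case split on
  the empty set matters only for \<open>m = 0\<close>.
\<close>

definition hausdorff_pre :: "nat \<Rightarrow> real \<Rightarrow> 'a::metric_space set \<Rightarrow> ennreal" where
  "hausdorff_pre m \<delta> A =
    (INF E \<in> {E :: nat \<Rightarrow> 'a set. A \<subseteq> (\<Union>i. E i) \<and> (\<forall>i. bounded (E i) \<and> diameter (E i) \<le> \<delta>)}.
      \<Sum>i. if E i = {} then 0
          else ennreal (unit_ball_vol (real m) / 2 ^ m * diameter (E i) ^ m))"

definition hausdorff_outer :: "nat \<Rightarrow> 'a::metric_space set \<Rightarrow> ennreal" where
  "hausdorff_outer m A = (SUP \<delta> \<in> {0<..}. hausdorff_pre m \<delta> A)"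

definition hausdorff_measure :: "nat \<Rightarrow> 'a::metric_space measure" where
  "hausdorff_measure m = measure_of UNIV (sets borel) (hausdorff_outer m)"

text \<open>
  Functions on \<open>\<Omega>\<close> are total functions of which only the values on \<open>\<Omega>\<close> are used. The infimum over
  the empty set is \<open>\<infinity>\<close>, as required for families without admissible functions.
\<close>

definition adm :: "nat \<Rightarrow> 'a::euclidean_space set \<Rightarrow> 'a set set \<Rightarrow> ('a \<Rightarrow> ennreal) set" where
  "adm m \<Omega> \<Sigma> =
    {g \<in> borel_measurable (restrict_space borel \<Omega>).
      \<forall>\<sigma>\<in>\<Sigma>. (\<integral>\<^sup>+z\<in>\<sigma>. g z \<partial>hausdorff_measure m) \<ge> 1}"

definition p_energy :: "real \<Rightarrow> 'a::euclidean_space set \<Rightarrow> ('a \<Rightarrow> ennreal) \<Rightarrow> ennreal" where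
  "p_energy p \<Omega> g = (\<integral>\<^sup>+z\<in>\<Omega>. ennreal_powr (g z) p \<partial>lborel)"

definition p_modulus :: "nat \<Rightarrow> real \<Rightarrow> 'a::euclidean_space set \<Rightarrow> 'a set set \<Rightarrow> ennreal" where
  "p_modulus m p \<Omega> \<Sigma> = (INF g \<in> adm m \<Omega> \<Sigma>. p_energy p \<Omega> g)"

definition extremal ::
  "nat \<Rightarrow> real \<Rightarrow> 'a::euclidean_space set \<Rightarrow> 'a set set \<Rightarrow> ('a \<Rightarrow> ennreal) \<Rightarrow> bool" where
  "extremal m p \<Omega> \<Sigma> g \<longleftrightarrow>
    (\<exists>\<Sigma>1\<subseteq>\<Sigma>. p_modulus m p \<Omega> \<Sigma>1 = 0 \<and> g \<in> adm m \<Omega> (\<Sigma> - \<Sigma>1)) \<and>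
    p_energy p \<Omega> g = p_modulus m p \<Omega> \<Sigma>"

text \<open>
  The target space of dimension \<open>n = (n - m) + m\<close> has its coordinates indexed by the disjoint sum
  \<open>'k + 'm\<close> of the index types of the two factors; the same sum indexes the columns of the
  derivative, \<open>Inl\<close> for the partial derivatives in \<open>x\<close> and \<open>Inr\<close> for those in \<open>y\<close>.
\<close>

definition jac ::
  "((real^'k::finite) \<times> (real^'m::finite) \<Rightarrow> real^('k + 'm)) \<Rightarrow> real^'k \<Rightarrow> real^'m \<Rightarrow> real" where
  "jac f x y =
    det ((\<chi> i j. frechet_derivative f (at (x, y))
            (case j of Inl a \<Rightarrow> (axis a 1, 0) | Inr b \<Rightarrow> (0, axis b 1)) $ i)
         :: real^('k + 'm)^('k + 'm))"

definition jac_y ::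
  "((real^'k::finite) \<times> (real^'m::finite) \<Rightarrow> real^('k + 'm)) \<Rightarrow> real^'k \<Rightarrow> real^'m \<Rightarrow> real" where
  "jac_y f x y =
    (let D = matrix (frechet_derivative (\<lambda>v. f (x, v)) (at y))
     in sqrt (det (transpose D ** D)))"

definition surface :: "('x \<times> 'y \<Rightarrow> 'z) \<Rightarrow> 'y set \<Rightarrow> 'x \<Rightarrow> 'z set" where
  "surface f V x = f ` ({x} \<times> V)"

definition surface_family :: "('x \<times> 'y \<Rightarrow> 'z) \<Rightarrow> 'x set \<Rightarrow> 'y set \<Rightarrow> 'z set set" where
  "surface_family f U V = surface f V ` U"

definition l_fun ::
  "real \<Rightarrow> ((real^'k::finite) \<times> (real^'m::finite) \<Rightarrow> real^('k + 'm)) \<Rightarrow> (real^'m) set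
    \<Rightarrow> real^'k \<Rightarrow> ennreal" where
  "l_fun q f V x =
    (\<integral>\<^sup>+y\<in>V. ennreal ((jac_y f x y / \<bar>jac f x y\<bar>) powr q * \<bar>jac f x y\<bar>) \<partial>lborel)"

definition f_Sigma ::
  "real \<Rightarrow> ((real^'k::finite) \<times> (real^'m::finite) \<Rightarrow> real^('k + 'm)) \<Rightarrow> (real^'k) set
    \<Rightarrow> (real^'m) set \<Rightarrow> real^('k + 'm) \<Rightarrow> ennreal" where
  "f_Sigma q f U V z =
    (let (x, y) = the_inv_into (U \<times> V) f z
     in 1 / l_fun q f V x * ennreal ((jac_y f x y / \<bar>jac f x y\<bar>) powr (q - 1)))"

end

theory Submission
  imports Defs
begin

text \<open>
  Write \<open>J\<close> for the absolute Jacobian of \<open>f\<close>, \<open>Jy\<close> for the Jacobian of \<open>y \<mapsto> f (x, y)\<close>, and \<open>w = Jy / J\<close>. Two changes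
  of variables turn the theorem into a family of problems on \<open>V\<close>, one for each \<open>x\<close>: the integral of \<open>g\<close> over
  a surface is \<open>\<integral> g(f(x,y)) Jy dy\<close> (\<open>surface_integral\<close>), and the energy of \<open>g\<close> is the integral over \<open>x\<close> of
  \<open>\<integral> g(f(x,y))^p J dy\<close> (\<open>volume_integral\<close>). For fixed \<open>x\<close> one has to minimise \<open>\<integral> s^p J dy\<close> subject to
  \<open>\<integral> s Jy dy \<ge> 1\<close>. A Lagrange multiplier suggests that \<open>s^(p-1)\<close> is proportional to \<open>w\<close>, which after normalisation
  is \<open>t = w^(q-1) / l(x)\<close>, of energy \<open>l(x)^(1-p)\<close>. It is the minimiser because \<open>s^p\<close> is convex: the tangent
  inequality \<open>p t^(p-1) s \<le> s^p + (p-1) t^p\<close>, multiplied by \<open>J\<close>, has a left-hand side proportional to \<open>s Jy\<close>, so it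
  integrates to the desired bound (\<open>surface_energy_lower_bound\<close>). The tangent touches the power at one
  point only, which gives uniqueness almost everywhere (\<open>extremal_unique\<close>).

  If \<open>l(x)\<close> is infinite, the proposed function vanishes on the surface and is not admissible there. But then
  truncating the weight produces admissible functions of arbitrarily small energy, so these surfaces
  form a family of modulus zero (\<open>infinite_surfaces_cheap\<close>), in agreement with \<open>\<infinity>^(1-p) = 0\<close>.

  The changes of variables are two cases of one area formula: for an injective \<open>C^1\<close> immersion \<open>g\<close> of an open
  set of dimension \<open>m\<close>, the \<open>m\<close>-dimensional Hausdorff measure of an image is the integral of the Jacobian
  (\<open>area_formula\<close>). Near each point \<open>g\<close> is, up to a bi-Lipschitz factor close to \<open>1\<close>, a linear map followed by an
  isometry, and for linear maps the formula is the determinant formula for Lebesgue measure, provided that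
  \<open>m\<close>-dimensional Hausdorff measure is Lebesgue measure in dimension \<open>m\<close> (\<open>hausdorff_outer_eq_lborel\<close>). The exact
  normalisation matters here, since another constant would change the modulus. One inequality follows
  from Vitali's covering theorem for balls; the other is the isodiametric inequality, that no set has more volume than
  a ball of the same diameter, which is deduced from the Prekopa--Leindler inequality (\<open>isodiametric\<close>).
\<close>

section \<open>The isodiametric inequality\<close>

lemma emeasure_lborel_translate:
  fixes c :: "'a::euclidean_space"
  assumes "A \<in> sets borel"
  shows "emeasure lborel ((\<lambda>x. c + x) -` A) = emeasure lborel A"
proof -
  have "emeasure lborel A = emeasure (distr lborel borel ((+) c)) A"
    by (simp add: lborel_distr_plus)
  also have "\<dots> = emeasure lborel ((\<lambda>x. c + x) -` A)"
    using assms by (subst emeasure_distr) auto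
  finally show ?thesis by simp
qed

text \<open>
  In one dimension \<open>A + B\<close> contains a translate of \<open>A\<close> by a point of \<open>B\<close> near \<open>Inf B\<close> and a
  translate of \<open>B\<close> by a point of \<open>A\<close> near \<open>Sup A\<close>. These two sets overlap in an interval as short as
  one likes, so their measures add up.
\<close>

lemma brunn_minkowski_real_bounded:
  fixes A B C :: "real set"
  assumes A: "A \<in> sets borel" "A \<noteq> {}" "bdd_above A"
    and B: "B \<in> sets borel" "B \<noteq> {}" "bdd_below B"
    and C: "C \<in> sets borel" "\<And>a b. a \<in> A \<Longrightarrow> b \<in> B \<Longrightarrow> a + b \<in> C"
  shows "emeasure lborel A + emeasure lborel B \<le> emeasure lborel C"
proof (rule ennreal_le_epsilon)
  fix e :: real assume e: "0 < e"
  obtain a where a: "a \<in> A" "Sup A - e / 2 < a"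
    using less_cSupE[of "Sup A - e / 2" A] A e by auto
  obtain b where b: "b \<in> B" "b < Inf B + e / 2"
    using cInf_lessD[of B "Inf B + e / 2"] B e by auto
  define X where "X = (\<lambda>x. - b + x) -` A"
  define Y where "Y = (\<lambda>x. - a + x) -` B"
  have m [measurable]: "X \<in> sets borel" "Y \<in> sets borel"
    unfolding X_def Y_def using A B by (auto intro!: measurable_sets_borel[where M=borel])
  have "X \<inter> Y \<subseteq> {a + Inf B .. Sup A + b}"
  proof
    fix x assume x: "x \<in> X \<inter> Y"
    then have "- b + x \<le> Sup A" "Inf B \<le> - a + x"
      using A B by (auto simp: X_def Y_def intro: cSup_upper cInf_lower)
    then show "x \<in> {a + Inf B .. Sup A + b}" by auto
  qed
  then have "emeasure lborel (X \<inter> Y) \<le> emeasure lborel {a + Inf B .. Sup A + b}"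
    by (intro emeasure_mono) auto
  also have "\<dots> \<le> ennreal e"
    using a b by (simp add: emeasure_lborel_Icc_eq)
  finally have i: "emeasure lborel (X \<inter> Y) \<le> ennreal e" .
  have sub: "X \<union> Y \<subseteq> C"
  proof
    fix x assume "x \<in> X \<union> Y"
    then show "x \<in> C"
      using C(2)[of "- b + x" b] C(2)[of a "- a + x"] a b by (auto simp: X_def Y_def)
  qed
  have "emeasure lborel A + emeasure lborel B = emeasure lborel X + emeasure lborel Y"
    using A B by (simp only: X_def Y_def emeasure_lborel_translate)
  also have "emeasure lborel X = emeasure lborel (X - Y) + emeasure lborel (X \<inter> Y)"
    using m by (subst plus_emeasure) (auto intro!: arg_cong[where f="emeasure lborel"])
  also have "\<dots> + emeasure lborel Y = emeasure lborel (X \<union> Y) + emeasure lborel (X \<inter> Y)"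
  proof -
    have "emeasure lborel (X - Y) + emeasure lborel Y = emeasure lborel (X \<union> Y)"
      using m by (subst plus_emeasure) (auto intro!: arg_cong[where f="emeasure lborel"])
    then show ?thesis by (metis add.assoc add.commute)
  qed
  also have "\<dots> \<le> emeasure lborel C + ennreal e"
    using sub C i by (intro add_mono emeasure_mono) auto
  finally show "emeasure lborel A + emeasure lborel B \<le> emeasure lborel C + ennreal e" .
qed

lemma brunn_minkowski_real:
  fixes A B C :: "real set"
  assumes A: "A \<in> sets borel" "A \<noteq> {}"
    and B: "B \<in> sets borel" "B \<noteq> {}"
    and C: "C \<in> sets borel" "\<And>a b. a \<in> A \<Longrightarrow> b \<in> B \<Longrightarrow> a + b \<in> C"
  shows "emeasure lborel A + emeasure lborel B \<le> emeasure lborel C"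
proof -
  have lim: "(\<lambda>n. emeasure lborel (X \<inter> {- real n..real n})) \<longlonglongrightarrow> emeasure lborel X"
    if "X \<in> sets borel" for X :: "real set"
  proof -
    have "(\<Union>n. X \<inter> {- real n..real n}) = X"
    proof safe
      fix x assume "x \<in> X"
      obtain n where "\<bar>x\<bar> \<le> real n" using real_arch_simple by blast
      with \<open>x \<in> X\<close> show "x \<in> (\<Union>n. X \<inter> {- real n..real n})" by (auto intro!: exI[of _ n])
    qed
    then show ?thesis
      using that Lim_emeasure_incseq[of "\<lambda>n. X \<inter> {- real n..real n}" lborel]
      by (force simp: incseq_def)
  qed
  obtain a b where ab: "a \<in> A" "b \<in> B" using A B by auto
  obtain n0 :: nat where n0: "max \<bar>a\<bar> \<bar>b\<bar> \<le> real n0" using real_arch_simple by blast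
  have "emeasure lborel (A \<inter> {- real n..real n}) + emeasure lborel (B \<inter> {- real n..real n})
      \<le> emeasure lborel C" if "n \<ge> n0" for n
  proof (rule brunn_minkowski_real_bounded)
    have "max \<bar>a\<bar> \<bar>b\<bar> \<le> real n" using n0 that by linarith
    then have "a \<in> A \<inter> {- real n..real n}" "b \<in> B \<inter> {- real n..real n}"
      using ab by (auto simp: abs_le_iff)
    then show "A \<inter> {- real n..real n} \<noteq> {}" "B \<inter> {- real n..real n} \<noteq> {}"
      by blast+
  qed (use A B C in auto)
  then show ?thesis
    using tendsto_add[OF lim[OF A(1)] lim[OF B(1)]]
    by (intro LIMSEQ_le_const2) auto
qed

lemma nn_integral_layer_cake:
  fixes f :: "'a \<Rightarrow> ennreal"
  assumes [measurable]: "f \<in> borel_measurable M" and "sigma_finite_measure M"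
  shows "(\<integral>\<^sup>+x. f x \<partial>M) = (\<integral>\<^sup>+t. indicator {0<..} t * emeasure M {x\<in>space M. ennreal t < f x} \<partial>lborel)"
proof -
  interpret sigma_finite_measure M by fact
  interpret pair_sigma_finite M "lborel :: real measure" ..
  have *: "f x = (\<integral>\<^sup>+t. indicator {0<..} t * indicator {t. ennreal t < f x} t \<partial>lborel)" for x
  proof (cases "f x")
    case (real r)
    have "(\<integral>\<^sup>+t. indicator {0<..} t * indicator {t. ennreal t < f x} t \<partial>lborel) = (\<integral>\<^sup>+t. indicator {0<..<r} t \<partial>lborel)"
      using real by (intro nn_integral_cong) (auto simp: indicator_def ennreal_less_iff split: if_splits)
    then show ?thesis using real by simp
  next
    case top
    have "(\<integral>\<^sup>+t. indicator {0<..} t * indicator {t. ennreal t < f x} t \<partial>lborel) = (\<integral>\<^sup>+t. indicator {0<..} (t::real) \<partial>lborel)"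
      using top by (intro nn_integral_cong) (auto simp: indicator_def)
    also have "\<dots> = top"
    proof -
      have "of_nat n \<le> emeasure lborel {0::real<..}" for n
      proof -
        have "of_nat n = emeasure lborel {0<..<real n}"
          by (simp add: ennreal_of_nat_eq_real_of_nat)
        also have "\<dots> \<le> emeasure lborel {0::real<..}" by (intro emeasure_mono) auto
        finally show ?thesis .
      qed
      then have "(SUP n. of_nat n) \<le> emeasure lborel {0::real<..}"
        by (intro SUP_least)
      then show ?thesis
        by (simp add: ennreal_SUP_of_nat_eq_top top_unique)
    qed
    finally show ?thesis using top by simp
  qed
  have "(\<integral>\<^sup>+x. f x \<partial>M) = (\<integral>\<^sup>+x. \<integral>\<^sup>+t. indicator {0<..} t * indicator {t. ennreal t < f x} t \<partial>lborel \<partial>M)"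
    using * by (intro nn_integral_cong)
  also have "\<dots> = (\<integral>\<^sup>+t. \<integral>\<^sup>+x. indicator {0<..} t * indicator {t. ennreal t < f x} t \<partial>M \<partial>lborel)"
    by (rule Fubini'[symmetric]) (simp add: indicator_def, measurable)
  also have "\<dots> = (\<integral>\<^sup>+t. indicator {0<..} t * (\<integral>\<^sup>+x. indicator {x\<in>space M. ennreal t < f x} x \<partial>M) \<partial>lborel)"
    by (intro nn_integral_cong, subst nn_integral_cmult[symmetric])
       (auto intro!: nn_integral_cong simp: indicator_def)
  finally show ?thesis by simp
qed

text \<open>
  The form in which the doubling of length enters the inequality for midpoints \<open>(x + y) / 2\<close>.
\<close>

lemma emeasure_lborel_vimage_half:
  fixes C :: "real set"
  assumes [measurable]: "C \<in> sets borel"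
  shows "emeasure lborel ((\<lambda>x. x / 2) -` C) = 2 * emeasure lborel C"
proof -
  have m [measurable]: "(\<lambda>x. x / 2) -` C \<in> sets (borel :: real measure)"
    by (auto intro!: measurable_sets_borel[where M=borel])
  have "emeasure lborel ((\<lambda>x. x / 2) -` C) = (\<integral>\<^sup>+x. indicator ((\<lambda>x. x / 2) -` C) x \<partial>lborel)"
    by simp
  also have "\<dots> = ennreal \<bar>2\<bar> * (\<integral>\<^sup>+x. indicator ((\<lambda>x. x / 2) -` C) (0 + 2 * x) \<partial>lborel)"
    by (rule nn_integral_real_affine) auto
  also have "(\<integral>\<^sup>+x. indicator ((\<lambda>x. x / 2) -` C) (0 + 2 * x) \<partial>lborel) = (\<integral>\<^sup>+x. indicator C x \<partial>lborel)"
    by (intro nn_integral_cong) (simp add: indicator_def)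
  finally show ?thesis by simp
qed

lemma ennreal_four_mult_le_square_add: "4 * (a * b) \<le> (a + b)\<^sup>2" for a b :: ennreal
proof (cases "a = \<infinity> \<or> b = \<infinity>")
  case True
  then show ?thesis by (auto simp: power2_eq_square ennreal_top_mult)
next
  case False
  then obtain r s where rs: "a = ennreal r" "b = ennreal s" "0 \<le> r" "0 \<le> s"
    by (metis ennreal_cases infinity_ennreal_def)
  have "4 * (r * s) \<le> (r + s)\<^sup>2"
    using zero_le_power2[of "r - s"] by (simp add: power2_eq_square algebra_simps)
  then have "ennreal (4 * (r * s)) \<le> ennreal ((r + s)\<^sup>2)" by (rule ennreal_leI)
  then show ?thesis using rs
    by (simp add: ennreal_mult ennreal_power[symmetric])
qed

text \<open>
  With both suprema equal to \<open>1\<close>, the level sets of \<open>f\<close> and \<open>g\<close> at a height \<open>0 < t < 1\<close> are non-empty,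
  and their midpoints lie in the level set of \<open>h\<close> at the same height. Integrating the
  one-dimensional Brunn--Minkowski inequality over \<open>t\<close> gives \<open>\<integral>f + \<integral>g \<le> 2 \<integral>h\<close>, and the
  arithmetic-geometric mean inequality finishes the proof. Squares replace the usual square root so
  that everything can be said in \<^typ>\<open>ennreal\<close>.
\<close>

lemma prekopa_leindler_real_normalised:
  fixes f g h :: "real \<Rightarrow> ennreal"
  assumes [measurable]: "f \<in> borel_measurable borel" "g \<in> borel_measurable borel" "h \<in> borel_measurable borel"
    and f: "(SUP x. f x) = 1" and g: "(SUP x. g x) = 1"
    and h: "\<And>x y. f x * g y \<le> (h ((x + y) / 2))\<^sup>2"
  shows "integral\<^sup>N lborel f * integral\<^sup>N lborel g \<le> (integral\<^sup>N lborel h)\<^sup>2"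
proof -
  have le1: "f x \<le> 1" "g x \<le> 1" for x
    using SUP_upper[of x UNIV f] SUP_upper[of x UNIV g] f g by auto
  have level: "indicator {0<..} t * emeasure lborel {x\<in>space lborel. ennreal t < f x}
      + indicator {0<..} t * emeasure lborel {x\<in>space lborel. ennreal t < g x}
      \<le> 2 * (indicator {0<..} t * emeasure lborel {x\<in>space lborel. ennreal t < h x})" for t :: real
  proof (cases "0 < t \<and> t < 1")
    case True
    have ne: "{x. ennreal t < f x} \<noteq> {}" "{x. ennreal t < g x} \<noteq> {}"
      using f g True less_SUP_iff[of "ennreal t" f UNIV] less_SUP_iff[of "ennreal t" g UNIV]
      by (auto simp: ennreal_less_iff)
    have "emeasure lborel {x. ennreal t < f x} + emeasure lborel {x. ennreal t < g x}
        \<le> emeasure lborel ((\<lambda>x. x / 2) -` {x. ennreal t < h x})"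
    proof (rule brunn_minkowski_real[OF _ ne(1) _ ne(2)])
      fix x y assume "x \<in> {x. ennreal t < f x}" "y \<in> {x. ennreal t < g x}"
      then have xy: "ennreal t < f x" "ennreal t < g y" by auto
      obtain r where r: "f x = ennreal r" "0 \<le> r" using le1(1)[of x] by (cases "f x") (auto simp: top_unique)
      obtain s where s: "g y = ennreal s" "0 \<le> s" using le1(2)[of y] by (cases "g y") (auto simp: top_unique)
      have "t * t < r * s"
        using xy r s True by (intro mult_strict_mono) (auto simp: ennreal_less_iff)
      then have *: "(ennreal t)\<^sup>2 < f x * g y"
        using r s True by (simp add: power2_eq_square ennreal_mult[symmetric] ennreal_less_iff)
      have "ennreal t < h ((x + y) / 2)"
      proof (rule ccontr)
        assume "\<not> ennreal t < h ((x + y) / 2)"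
        then have "(h ((x + y) / 2))\<^sup>2 \<le> (ennreal t)\<^sup>2"
          by (intro power_mono) auto
        with * h[of x y] show False by auto
      qed
      then show "x + y \<in> (\<lambda>x. x / 2) -` {x. ennreal t < h x}" by simp
    qed (auto intro!: measurable_sets_borel[where M=borel])
    also have "\<dots> = 2 * emeasure lborel {x. ennreal t < h x}"
      by (rule emeasure_lborel_vimage_half) measurable
    finally show ?thesis using True by simp
  next
    case False
    have "{x. ennreal t < f x} = {}" "{x. ennreal t < g x} = {}" if "t \<ge> 1"
      using that le1 by (auto simp: not_less intro: order_trans[of _ 1])
    with False show ?thesis by (cases "t > 0") auto
  qed
  have "integral\<^sup>N lborel f + integral\<^sup>N lborel g =
     (\<integral>\<^sup>+t. indicator {0<..} t * emeasure lborel {x\<in>space lborel. ennreal t < f x}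
      + indicator {0<..} t * emeasure lborel {x\<in>space lborel. ennreal t < g x} \<partial>lborel)"
    by (subst (1 2) nn_integral_layer_cake) (auto intro!: nn_integral_add[symmetric] lborel.sigma_finite_measure_axioms)
  also have "\<dots> \<le> (\<integral>\<^sup>+t. 2 * (indicator {0<..} t * emeasure lborel {x\<in>space lborel. ennreal t < h x}) \<partial>lborel)"
    by (intro nn_integral_mono level)
  also have "\<dots> = 2 * integral\<^sup>N lborel h"
    by (subst nn_integral_layer_cake[of h]) (auto intro!: nn_integral_cmult lborel.sigma_finite_measure_axioms)
  finally have s: "integral\<^sup>N lborel f + integral\<^sup>N lborel g \<le> 2 * integral\<^sup>N lborel h" .
  have "4 * (integral\<^sup>N lborel f * integral\<^sup>N lborel g) \<le> (2 * integral\<^sup>N lborel h)\<^sup>2"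
    using ennreal_four_mult_le_square_add power_mono[OF s, of 2] by (rule order_trans) simp
  also have "\<dots> = 4 * (integral\<^sup>N lborel h)\<^sup>2"
    by (simp add: power_mult_distrib)
  finally show ?thesis by (simp add: ennreal_mult_le_mult_iff)
qed

lemma prekopa_leindler_real_bounded:
  fixes f g h :: "real \<Rightarrow> ennreal"
  assumes [measurable]: "f \<in> borel_measurable borel" "g \<in> borel_measurable borel" "h \<in> borel_measurable borel"
    and f: "(SUP x. f x) < \<infinity>" and g: "(SUP x. g x) < \<infinity>"
    and h: "\<And>x y. f x * g y \<le> (h ((x + y) / 2))\<^sup>2"
  shows "integral\<^sup>N lborel f * integral\<^sup>N lborel g \<le> (integral\<^sup>N lborel h)\<^sup>2"
proof (cases "(SUP x. f x) = 0 \<or> (SUP x. g x) = 0")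
  case True
  then have "f = (\<lambda>x. 0) \<or> g = (\<lambda>x. 0)"
    by (metis SUP_upper UNIV_I le_zero_eq)
  then show ?thesis by auto
next
  case False
  obtain a where a: "(SUP x. f x) = ennreal a" "a > 0"
    using f False by (cases "SUP x. f x") (auto simp: less_le)
  obtain b where b: "(SUP x. g x) = ennreal b" "b > 0"
    using g False by (cases "SUP x. g x") (auto simp: less_le)
  let ?F = "\<lambda>x. ennreal (1 / a) * f x" and ?G = "\<lambda>x. ennreal (1 / b) * g x"
  let ?H = "\<lambda>x. ennreal (1 / sqrt (a * b)) * h x"
  have sq: "(ennreal (1 / sqrt (a * b)))\<^sup>2 = ennreal (1 / a) * ennreal (1 / b)"
    using a b by (subst ennreal_power) (auto simp: ennreal_mult[symmetric] power_divide)
  have "(\<integral>\<^sup>+x. ?F x \<partial>lborel) * (\<integral>\<^sup>+x. ?G x \<partial>lborel) \<le> (\<integral>\<^sup>+x. ?H x \<partial>lborel)\<^sup>2"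
  proof (rule prekopa_leindler_real_normalised)
    show "(SUP x. ?F x) = 1"
      using a by (simp add: SUP_mult_left_ennreal[symmetric] ennreal_mult[symmetric])
    show "(SUP x. ?G x) = 1"
      using b by (simp add: SUP_mult_left_ennreal[symmetric] ennreal_mult[symmetric])
    fix x y
    have "?F x * ?G y = ennreal (1 / a) * ennreal (1 / b) * (f x * g y)"
      by (simp add: mult_ac)
    also have "\<dots> \<le> ennreal (1 / a) * ennreal (1 / b) * (h ((x + y) / 2))\<^sup>2"
      by (intro mult_left_mono h) auto
    finally show "?F x * ?G y \<le> (?H ((x + y) / 2))\<^sup>2"
      by (simp add: power_mult_distrib sq)
  qed measurable
  then have "ennreal (1 / a) * ennreal (1 / b) * (integral\<^sup>N lborel f * integral\<^sup>N lborel g)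
      \<le> ennreal (1 / a) * ennreal (1 / b) * (integral\<^sup>N lborel h)\<^sup>2"
    by (subst (asm) (1 2 3) nn_integral_cmult) (simp_all add: power_mult_distrib sq mult_ac)
  then show ?thesis
    using a b by (simp add: ennreal_mult[symmetric] ennreal_mult_le_mult_iff)
qed

lemma prekopa_leindler_real:
  fixes f g h :: "real \<Rightarrow> ennreal"
  assumes [measurable]: "f \<in> borel_measurable borel" "g \<in> borel_measurable borel" "h \<in> borel_measurable borel"
    and h: "\<And>x y. f x * g y \<le> (h ((x + y) / 2))\<^sup>2"
  shows "integral\<^sup>N lborel f * integral\<^sup>N lborel g \<le> (integral\<^sup>N lborel h)\<^sup>2"
proof -
  have S: "(\<integral>\<^sup>+x. u x \<partial>lborel) = (SUP n::nat. \<integral>\<^sup>+x. min (u x) (of_nat n) \<partial>lborel)"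
    if [measurable]: "u \<in> borel_measurable borel" for u :: "real \<Rightarrow> ennreal"
  proof -
    have "u x = (SUP n::nat. min (u x) (of_nat n))" for x
      by (simp only: inf_min[symmetric] inf_SUP[symmetric] ennreal_SUP_of_nat_eq_top inf_top_right)
    then have "(\<integral>\<^sup>+x. u x \<partial>lborel) = (\<integral>\<^sup>+x. (SUP n::nat. min (u x) (of_nat n)) \<partial>lborel)"
      by simp
    also have "\<dots> = (SUP n::nat. \<integral>\<^sup>+x. min (u x) (of_nat n) \<partial>lborel)"
      by (rule nn_integral_monotone_convergence_SUP) (auto simp: incseq_def le_fun_def min_le_iff_disj intro: min.mono)
    finally show ?thesis .
  qed
  have "(\<integral>\<^sup>+x. min (f x) (of_nat m) \<partial>lborel) * (\<integral>\<^sup>+x. min (g x) (of_nat n) \<partial>lborel)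
      \<le> (integral\<^sup>N lborel h)\<^sup>2" for m n :: nat
  proof (rule prekopa_leindler_real_bounded)
    have "(SUP x. min (f x) (of_nat m)) \<le> (of_nat m :: ennreal)" by (auto intro: SUP_least)
    then show "(SUP x. min (f x) (of_nat m)) < \<infinity>" using of_nat_less_top[of m] by (auto intro: order_le_less_trans simp: ennreal_of_nat_eq_real_of_nat)
    have "(SUP x. min (g x) (of_nat n)) \<le> (of_nat n :: ennreal)" by (auto intro: SUP_least)
    then show "(SUP x. min (g x) (of_nat n)) < \<infinity>" using of_nat_less_top[of n] by (auto intro: order_le_less_trans simp: ennreal_of_nat_eq_real_of_nat)
    show "min (f x) (of_nat m) * min (g y) (of_nat n) \<le> (h ((x + y) / 2))\<^sup>2" for x y
      using h[of x y] by (rule order_trans[rotated]) (intro mult_mono, auto)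
  qed auto
  then show ?thesis
    by (subst (1 2) S) (auto simp: SUP_mult_right_ennreal SUP_mult_left_ennreal intro!: SUP_least)
qed

text \<open>
  Induction on the number of coordinates: by the induction hypothesis, the partial integrals of
  \<open>f\<close>, \<open>g\<close>, \<open>h\<close> over the old coordinates satisfy the hypothesis of the one-dimensional inequality
  as functions of the new coordinate. This is why three different functions are needed although
  only a set and its reflection matter below.
\<close>

lemma prekopa_leindler_PiM:
  fixes f g h :: "('i \<Rightarrow> real) \<Rightarrow> ennreal"
  assumes "finite I"
    and "f \<in> borel_measurable (\<Pi>\<^sub>M i\<in>I. lborel)" "g \<in> borel_measurable (\<Pi>\<^sub>M i\<in>I. lborel)"
      "h \<in> borel_measurable (\<Pi>\<^sub>M i\<in>I. lborel)"
    and "\<And>x y. x \<in> space (\<Pi>\<^sub>M i\<in>I. lborel) \<Longrightarrow> y \<in> space (\<Pi>\<^sub>M i\<in>I. lborel) \<Longrightarrow>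
      f x * g y \<le> (h (\<lambda>i\<in>I. (x i + y i) / 2))\<^sup>2"
  shows "(\<integral>\<^sup>+x. f x \<partial>(\<Pi>\<^sub>M i\<in>I. lborel)) * (\<integral>\<^sup>+x. g x \<partial>(\<Pi>\<^sub>M i\<in>I. lborel))
    \<le> (\<integral>\<^sup>+x. h x \<partial>(\<Pi>\<^sub>M i\<in>I. lborel))\<^sup>2"
  using assms
proof (induction I arbitrary: f g h rule: finite_induct)
  case empty
  interpret product_sigma_finite "\<lambda>_::'i. lborel :: real measure" ..
  show ?case
    using empty.prems(4)[of "\<lambda>_. undefined" "\<lambda>_. undefined"]
    by (simp add: nn_integral_empty space_PiM restrict_def)
next
  case (insert i I)
  interpret product_sigma_finite "\<lambda>_::'i. lborel :: real measure" ..
  interpret I: finite_product_sigma_finite "\<lambda>_::'i. lborel :: real measure" I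
    by standard fact
  note insert.prems(1-3)[measurable]
  have slice: "(\<lambda>y. \<integral>\<^sup>+x. u (x(i := y)) \<partial>(\<Pi>\<^sub>M i\<in>I. lborel)) \<in> borel_measurable borel"
    if [measurable]: "u \<in> borel_measurable (\<Pi>\<^sub>M i\<in>insert i I. lborel)" for u :: "('i \<Rightarrow> real) \<Rightarrow> ennreal"
  proof -
    have "(\<lambda>y. \<integral>\<^sup>+x. u (x(i := y)) \<partial>(\<Pi>\<^sub>M i\<in>I. lborel)) \<in> borel_measurable lborel"
      by measurable
    then show ?thesis by simp
  qed
  have "(\<integral>\<^sup>+y. \<integral>\<^sup>+x. f (x(i := y)) \<partial>(\<Pi>\<^sub>M i\<in>I. lborel) \<partial>lborel) *
        (\<integral>\<^sup>+y. \<integral>\<^sup>+x. g (x(i := y)) \<partial>(\<Pi>\<^sub>M i\<in>I. lborel) \<partial>lborel)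
      \<le> (\<integral>\<^sup>+y. \<integral>\<^sup>+x. h (x(i := y)) \<partial>(\<Pi>\<^sub>M i\<in>I. lborel) \<partial>lborel)\<^sup>2"
  proof (rule prekopa_leindler_real)
    fix y z :: real
    show "(\<integral>\<^sup>+x. f (x(i := y)) \<partial>(\<Pi>\<^sub>M i\<in>I. lborel)) * (\<integral>\<^sup>+x. g (x(i := z)) \<partial>(\<Pi>\<^sub>M i\<in>I. lborel))
      \<le> (\<integral>\<^sup>+x. h (x(i := (y + z) / 2)) \<partial>(\<Pi>\<^sub>M i\<in>I. lborel))\<^sup>2"
    proof (rule insert.IH)
      fix u v assume uv: "u \<in> space (\<Pi>\<^sub>M i\<in>I. (lborel :: real measure))" "v \<in> space (\<Pi>\<^sub>M i\<in>I. (lborel :: real measure))"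
      have "f (u(i := y)) * g (v(i := z)) \<le> (h (\<lambda>j\<in>insert i I. ((u(i := y)) j + (v(i := z)) j) / 2))\<^sup>2"
        using uv by (intro insert.prems(4)) (auto simp: space_PiM PiE_def extensional_def)
      also have "(\<lambda>j\<in>insert i I. ((u(i := y)) j + (v(i := z)) j) / 2) = (\<lambda>j\<in>I. (u j + v j) / 2)(i := (y + z) / 2)"
        using insert.hyps by (auto simp: fun_eq_iff)
      finally show "f (u(i := y)) * g (v(i := z)) \<le> (h ((\<lambda>j\<in>I. (u j + v j) / 2)(i := (y + z) / 2)))\<^sup>2" .
    qed (measurable)
  qed (intro slice insert.prems)+
  then show ?case
    using insert.hyps by (simp add: product_nn_integral_insert_rev)
qed

lemma emeasure_lborel_reflect:
  fixes A :: "'a::euclidean_space set"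
  assumes "A \<in> sets borel"
  shows "emeasure lborel (uminus -` A) = emeasure lborel A"
proof -
  have "emeasure lborel A = emeasure (distr lborel borel (\<lambda>x::'a. 0 + (-1) *\<^sub>R x)) A"
    using lborel_affine[of "-1" "0::'a"] by (simp add: density_1)
  also have "\<dots> = emeasure lborel (uminus -` A)"
    using assms by (subst emeasure_distr) (auto intro!: arg_cong[where f="emeasure lborel"])
  finally show ?thesis by simp
qed

text \<open>
  The midpoints of \<open>A\<close> and \<open>-A\<close> are the points \<open>(a - b) / 2\<close> with \<open>a, b \<in> A\<close>; they lie in the ball
  of radius \<open>diameter A / 2\<close> about \<open>0\<close>. The Prekopa--Leindler inequality for the three indicator
  functions therefore bounds the square of the volume of \<open>A\<close> by the square of that of the ball.
\<close>

theorem isodiametric: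
  fixes A :: "'a::euclidean_space set"
  assumes A [measurable]: "A \<in> sets borel" and "bounded A"
  shows "emeasure lborel A \<le> ennreal (unit_ball_vol (real DIM('a)) / 2 ^ DIM('a) * diameter A ^ DIM('a))"
proof -
  let ?P = "\<Pi>\<^sub>M b\<in>Basis. (lborel :: real measure)" and ?B = "cball (0::'a) (diameter A / 2)"
  \<comment> \<open>The identification with a coordinate space under which Lebesgue measure is a product measure.\<close>
  define \<Phi> :: "('a \<Rightarrow> real) \<Rightarrow> 'a" where "\<Phi> x = (\<Sum>b\<in>Basis. x b *\<^sub>R b)" for x
  have [measurable]: "\<Phi> \<in> measurable ?P borel"
    unfolding \<Phi>_def by measurable
  have [measurable]: "?B \<in> sets borel" by simp
  have [measurable]: "uminus -` A \<in> sets borel"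
    by (auto intro!: measurable_sets_borel[where M=borel])
  have lb: "lborel = distr ?P borel \<Phi>"
    unfolding \<Phi>_def by (rule lborel_eq)
  have em: "emeasure lborel X = (\<integral>\<^sup>+x. indicator X (\<Phi> x) \<partial>?P)" if [measurable]: "X \<in> sets borel" for X
    by (subst lb) (simp add: nn_integral_distr flip: nn_integral_indicator)
  have "emeasure lborel A * emeasure lborel (uminus -` A) \<le> (emeasure lborel ?B)\<^sup>2"
    unfolding em[OF A] em[OF \<open>uminus -` A \<in> sets borel\<close>] em[of ?B, simplified]
  proof (rule prekopa_leindler_PiM)
    fix x y :: "'a \<Rightarrow> real"
    have avg: "\<Phi> (\<lambda>b\<in>Basis. (x b + y b) / 2) = (1 / 2) *\<^sub>R (\<Phi> x + \<Phi> y)"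
      unfolding \<Phi>_def by (simp add: scaleR_sum_right sum.distrib[symmetric] scaleR_add_left[symmetric] add_divide_distrib)
    have "norm ((1 / 2) *\<^sub>R (\<Phi> x + \<Phi> y)) \<le> diameter A / 2" if "\<Phi> x \<in> A" "- \<Phi> y \<in> A"
      using diameter_bounded_bound[OF \<open>bounded A\<close> that] by (simp add: dist_norm)
    then show "indicator A (\<Phi> x) * indicator (uminus -` A) (\<Phi> y)
        \<le> (indicator ?B (\<Phi> (\<lambda>b\<in>Basis. (x b + y b) / 2)) :: ennreal)\<^sup>2"
      unfolding avg by (auto simp: indicator_def)
  qed (auto, measurable)
  then have le: "(emeasure lborel A)\<^sup>2 \<le> (emeasure lborel ?B)\<^sup>2"
    by (simp add: emeasure_lborel_reflect power2_eq_square)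
  have d: "diameter A \<ge> 0" using \<open>bounded A\<close> by (rule diameter_ge_0)
  have Beq: "emeasure lborel ?B = ennreal (unit_ball_vol (real DIM('a)) * (diameter A / 2) ^ DIM('a))"
    using d by (intro emeasure_cball) auto
  have "emeasure lborel A \<le> emeasure lborel ?B"
  proof (rule ccontr)
    assume "\<not> ?thesis"
    then have lt: "emeasure lborel ?B < emeasure lborel A" by simp
    obtain r where r: "emeasure lborel A = ennreal r" "0 \<le> r"
      using emeasure_bounded_finite[OF \<open>bounded A\<close>] by (cases "emeasure lborel A") auto
    from lt le r d show False
      unfolding Beq by (simp add: ennreal_power ennreal_less_iff power_mono_iff)
  qed
  then show ?thesis
    unfolding Beq by (simp add: power_divide mult.commute)
qed

section \<open>Hausdorff measure as a Borel measure\<close>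

abbreviation hausdorff_cost :: "nat \<Rightarrow> 'a::metric_space set \<Rightarrow> ennreal" where
  "hausdorff_cost m E \<equiv>
    (if E = {} then 0 else ennreal (unit_ball_vol (real m) / 2 ^ m * diameter E ^ m))"

lemma hausdorff_pre_le:
  assumes "A \<subseteq> (\<Union>i. E i)" "\<And>i. bounded (E i)" "\<And>i. diameter (E i) \<le> \<delta>"
  shows "hausdorff_pre m \<delta> A \<le> (\<Sum>i. hausdorff_cost m (E i))"
  unfolding hausdorff_pre_def using assms by (intro INF_lower) auto

lemma hausdorff_pre_coverE:
  assumes "hausdorff_pre m \<delta> A < c"
  obtains E :: "nat \<Rightarrow> 'a::metric_space set"
  where "A \<subseteq> (\<Union>i. E i)" "\<And>i. bounded (E i)" "\<And>i. diameter (E i) \<le> \<delta>"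
    "(\<Sum>i. hausdorff_cost m (E i)) < c"
  using assms unfolding hausdorff_pre_def INF_less_iff by auto

lemma hausdorff_pre_mono: "A \<subseteq> B \<Longrightarrow> hausdorff_pre m \<delta> A \<le> hausdorff_pre m \<delta> B"
  unfolding hausdorff_pre_def by (intro INF_superset_mono) auto

lemma hausdorff_pre_antimono: "\<delta> \<le> \<delta>' \<Longrightarrow> hausdorff_pre m \<delta>' A \<le> hausdorff_pre m \<delta> A"
  unfolding hausdorff_pre_def by (intro INF_superset_mono) (auto intro: order_trans)

lemma hausdorff_pre_empty: "0 \<le> \<delta> \<Longrightarrow> hausdorff_pre m \<delta> {} = 0"
  using hausdorff_pre_le[of "{}" "\<lambda>_. {}" \<delta> m] by simp

lemma hausdorff_pre_bounded_set:
  assumes "bounded A" "diameter A \<le> \<delta>"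
  shows "hausdorff_pre m \<delta> A \<le> ennreal (unit_ball_vol (real m) / 2 ^ m * diameter A ^ m)"
proof -
  have "0 \<le> \<delta>" using assms diameter_ge_0 by fastforce
  have "hausdorff_pre m \<delta> A \<le> (\<Sum>i. hausdorff_cost m (if i = (0::nat) then A else {}))"
    using assms \<open>0 \<le> \<delta>\<close> by (intro hausdorff_pre_le) auto
  also have "\<dots> = (\<Sum>i\<in>{0}. hausdorff_cost m (if i = (0::nat) then A else {}))"
    by (rule suminf_finite) auto
  also have "\<dots> \<le> ennreal (unit_ball_vol (real m) / 2 ^ m * diameter A ^ m)"
    by simp
  finally show ?thesis .
qed

lemma hausdorff_pre_UN_le:
  "hausdorff_pre m \<delta> (\<Union>n. A n) \<le> (\<Sum>n::nat. hausdorff_pre m \<delta> (A n))"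
proof (rule ennreal_le_epsilon)
  fix e :: real assume e: "0 < e" and fin: "(\<Sum>n. hausdorff_pre m \<delta> (A n)) < top"
  have lt: "hausdorff_pre m \<delta> (A n) < hausdorff_pre m \<delta> (A n) + e * (1/2)^Suc n" for n
    using e fin by (auto simp: less_top dest!: ennreal_suminf_lessD)
  have "\<forall>n. \<exists>E. A n \<subseteq> (\<Union>i. E i) \<and> (\<forall>i. bounded (E i) \<and> diameter (E i) \<le> \<delta>) \<and>
      (\<Sum>i. hausdorff_cost m (E i)) < hausdorff_pre m \<delta> (A n) + e * (1/2)^Suc n"
    by (intro allI, rule hausdorff_pre_coverE[OF lt]) blast
  note choice[OF this]
  then obtain E where E: "\<And>n. A n \<subseteq> (\<Union>i. E n i)" "\<And>n i. bounded (E n i) \<and> diameter (E n i) \<le> \<delta>"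
      "\<And>n. (\<Sum>i. hausdorff_cost m (E n i)) < hausdorff_pre m \<delta> (A n) + e * (1/2)^Suc n"
    by blast
  define C where "C = case_prod E \<circ> prod_decode"
  have "(\<Union>n. A n) \<subseteq> (\<Union>i. C i)"
    using E(1) by (auto simp: C_def subset_eq) (metis prod.case prod_encode_inverse)
  then have "hausdorff_pre m \<delta> (\<Union>n. A n) \<le> (\<Sum>i. hausdorff_cost m (C i))"
    using E(2) by (intro hausdorff_pre_le) (auto simp: C_def split_beta)
  also have "\<dots> = (\<Sum>i. (\<lambda>p. hausdorff_cost m (case_prod E p)) (prod_decode i))"
    unfolding C_def comp_def by (rule refl)
  also have "\<dots> = (\<Sum>n. \<Sum>i. hausdorff_cost m (E n i))"
    by (intro suminf_ennreal_2dimen) auto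
  also have "\<dots> \<le> (\<Sum>n. hausdorff_pre m \<delta> (A n) + e * (1/2) ^ Suc n)"
    using E(3) by (intro suminf_le less_imp_le) auto
  also have "\<dots> = (\<Sum>n. hausdorff_pre m \<delta> (A n)) + (\<Sum>n. ennreal e * ennreal ((1/2) ^ Suc n))"
    using \<open>0 < e\<close> by (subst suminf_add[symmetric])
       (auto simp del: ennreal_suminf_cmult simp add: ennreal_mult[symmetric])
  also have "\<dots> = (\<Sum>n. hausdorff_pre m \<delta> (A n)) + e"
    unfolding ennreal_suminf_cmult
    by (subst suminf_ennreal_eq[OF zero_le_power power_half_series]) auto
  finally show "hausdorff_pre m \<delta> (\<Union>n. A n) \<le> (\<Sum>n. hausdorff_pre m \<delta> (A n)) + e" .
qed

lemma hausdorff_pre_Un_le: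
  assumes "0 \<le> \<delta>"
  shows "hausdorff_pre m \<delta> (A \<union> B) \<le> hausdorff_pre m \<delta> A + hausdorff_pre m \<delta> B"
proof -
  let ?F = "\<lambda>n::nat. if n = 0 then A else if n = 1 then B else {}"
  have "hausdorff_pre m \<delta> (A \<union> B) = hausdorff_pre m \<delta> (\<Union>n. ?F n)"
    by (intro arg_cong[where f="hausdorff_pre m \<delta>"]) (auto split: if_splits)
  also have "\<dots> \<le> (\<Sum>n. hausdorff_pre m \<delta> (?F n))"
    by (rule hausdorff_pre_UN_le)
  also have "\<dots> = (\<Sum>n\<in>{0,1}. hausdorff_pre m \<delta> (?F n))"
    using assms by (intro suminf_finite) (auto simp: hausdorff_pre_empty)
  finally show ?thesis by simp
qed

text \<open>
  A covering set of diameter at most \<open>\<delta>\<close> cannot meet two sets that are further apart than \<open>\<delta>\<close>, so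
  every cover of the union splits into a cover of \<open>A\<close> and one of \<open>B\<close>.
\<close>

lemma hausdorff_pre_separated:
  fixes A B :: "'a::metric_space set"
  assumes sep: "\<And>a b. a \<in> A \<Longrightarrow> b \<in> B \<Longrightarrow> \<delta> < dist a b" and "0 \<le> \<delta>"
  shows "hausdorff_pre m \<delta> A + hausdorff_pre m \<delta> B \<le> hausdorff_pre m \<delta> (A \<union> B)"
  unfolding hausdorff_pre_def[of m \<delta> "A \<union> B"]
proof (rule INF_greatest, clarify)
  fix E :: "nat \<Rightarrow> 'a set"
  assume E: "A \<union> B \<subseteq> (\<Union>i. E i)" "\<forall>i. bounded (E i) \<and> diameter (E i) \<le> \<delta>"
  define F where "F X i = (if E i \<inter> X = {} then {} else E i)" for X i
  have "hausdorff_pre m \<delta> A + hausdorff_pre m \<delta> B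
      \<le> (\<Sum>i. hausdorff_cost m (F A i)) + (\<Sum>i. hausdorff_cost m (F B i))"
    using E \<open>0 \<le> \<delta>\<close> by (intro add_mono hausdorff_pre_le) (auto simp: F_def subset_eq split: if_splits, blast+)
  also have "\<dots> = (\<Sum>i. hausdorff_cost m (F A i) + hausdorff_cost m (F B i))"
    by (rule suminf_add) auto
  also have "\<dots> \<le> (\<Sum>i. hausdorff_cost m (E i))"
  proof (intro suminf_le)
    fix i
    have "E i \<inter> A = {} \<or> E i \<inter> B = {}"
    proof (rule ccontr)
      assume "\<not> ?thesis"
      then obtain a b where "a \<in> E i" "a \<in> A" "b \<in> E i" "b \<in> B" by auto
      then show False
        using sep[of a b] diameter_bounded_bound[of "E i" a b] E(2) by (metis leD order_trans)
    qed
    then show "hausdorff_cost m (F A i) + hausdorff_cost m (F B i) \<le> hausdorff_cost m (E i)"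
      by (auto simp: F_def)
  qed auto
  finally show "hausdorff_pre m \<delta> A + hausdorff_pre m \<delta> B \<le> (\<Sum>i. hausdorff_cost m (E i))" .
qed

lemma hausdorff_pre_le_outer: "0 < \<delta> \<Longrightarrow> hausdorff_pre m \<delta> A \<le> hausdorff_outer m A"
  unfolding hausdorff_outer_def by (intro SUP_upper) auto

lemma hausdorff_outer_mono: "A \<subseteq> B \<Longrightarrow> hausdorff_outer m A \<le> hausdorff_outer m B"
  unfolding hausdorff_outer_def by (intro SUP_mono') (auto intro: hausdorff_pre_mono)

lemma hausdorff_outer_empty [simp]: "hausdorff_outer m {} = 0"
  unfolding hausdorff_outer_def by (auto simp: hausdorff_pre_empty intro!: antisym SUP_least)

lemma hausdorff_outer_UN_le: "hausdorff_outer m (\<Union>n. A n) \<le> (\<Sum>n::nat. hausdorff_outer m (A n))"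
  unfolding hausdorff_outer_def[of m "\<Union>n. A n"]
proof (rule SUP_least)
  fix \<delta> :: real assume "\<delta> \<in> {0<..}"
  then show "hausdorff_pre m \<delta> (\<Union>n. A n) \<le> (\<Sum>n. hausdorff_outer m (A n))"
    by (intro order_trans[OF hausdorff_pre_UN_le] suminf_le hausdorff_pre_le_outer) auto
qed

lemma hausdorff_outer_Un_le: "hausdorff_outer m (A \<union> B) \<le> hausdorff_outer m A + hausdorff_outer m B"
  unfolding hausdorff_outer_def[of m "A \<union> B"]
  by (intro SUP_least order_trans[OF hausdorff_pre_Un_le] add_mono hausdorff_pre_le_outer) auto

lemma hausdorff_outer_separated:
  fixes A B :: "'a::metric_space set"
  assumes sep: "\<And>a b. a \<in> A \<Longrightarrow> b \<in> B \<Longrightarrow> d \<le> dist a b" and "0 < d"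
  shows "hausdorff_outer m A + hausdorff_outer m B \<le> hausdorff_outer m (A \<union> B)"
proof -
  have "hausdorff_outer m A + hausdorff_outer m B
      \<le> (SUP \<delta>\<in>{0<..}. hausdorff_pre m \<delta> A + hausdorff_pre m \<delta> B)"
    unfolding hausdorff_outer_def
  proof (rule SUP_add_directed_ennreal[symmetric, THEN eq_refl])
    fix i j :: real assume "i \<in> {0<..}" "j \<in> {0<..}"
    then show "\<exists>k\<in>{0<..}. hausdorff_pre m i A + hausdorff_pre m j B \<le> hausdorff_pre m k A + hausdorff_pre m k B"
      by (intro bexI[of _ "min i j"] add_mono hausdorff_pre_antimono) auto
  qed
  also have "\<dots> \<le> hausdorff_outer m (A \<union> B)"
  proof (rule SUP_least)
    fix \<delta> :: real assume "\<delta> \<in> {0<..}"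
    then have pos: "0 < min \<delta> (d / 2)" using \<open>0 < d\<close> by auto
    have "hausdorff_pre m \<delta> A + hausdorff_pre m \<delta> B
        \<le> hausdorff_pre m (min \<delta> (d / 2)) A + hausdorff_pre m (min \<delta> (d / 2)) B"
      by (intro add_mono hausdorff_pre_antimono) auto
    also have "\<dots> \<le> hausdorff_pre m (min \<delta> (d / 2)) (A \<union> B)"
      using sep \<open>0 < d\<close> pos by (intro hausdorff_pre_separated) (force simp: min_less_iff_disj)+
    also have "\<dots> \<le> hausdorff_outer m (A \<union> B)"
      using pos by (rule hausdorff_pre_le_outer)
    finally show "hausdorff_pre m \<delta> A + hausdorff_pre m \<delta> B \<le> hausdorff_outer m (A \<union> B)" .
  qed
  finally show ?thesis .
qed

lemma outer_measure_space_hausdorff: "outer_measure_space UNIV (hausdorff_outer m)"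
  by (auto simp: outer_measure_space_def positive_def increasing_def countably_subadditive_def
      intro: hausdorff_outer_mono hausdorff_outer_UN_le)

lemma ennreal_suminf_tail_small:
  fixes a :: "nat \<Rightarrow> ennreal"
  assumes "(\<Sum>k. a k) < \<infinity>" "0 < e"
  shows "\<exists>n. (\<Sum>k. a (k + n)) \<le> ennreal e"
proof -
  have fin: "a k < top" for k using assms(1) ennreal_suminf_lessD by auto
  define r where "r k = enn2real (a k)" for k
  have r: "a k = ennreal (r k)" "0 \<le> r k" for k
    using fin[of k] by (simp_all add: r_def)
  have s: "summable r"
    using assms(1) r by (intro summable_suminf_not_top) (auto simp: less_top)
  obtain n where n: "norm (\<Sum>k. r (k + n)) < e"
    using suminf_exist_split[OF \<open>0 < e\<close> s] by blast
  have "(\<Sum>k. a (k + n)) = ennreal (\<Sum>k. r (k + n))"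
    using r s by (simp add: suminf_ennreal2 summable_ignore_initial_segment)
  with n show ?thesis by (auto intro!: exI[of _ n] ennreal_leI)
qed

text \<open>
  Rings that are pairwise at a positive distance have additive outer measure; only the distance of
  each ring to the earlier ones is required, so it may tend to \<open>0\<close>.
\<close>

lemma hausdorff_outer_separated_rings:
  fixes R :: "nat \<Rightarrow> 'a::metric_space set"
  assumes sep: "\<And>N. \<exists>d>0. \<forall>j<N. \<forall>x\<in>R j. \<forall>y\<in>R N. d \<le> dist x y"
    and sub: "\<And>k. R k \<subseteq> A"
  shows "(\<Sum>k<N. hausdorff_outer m (R k)) \<le> hausdorff_outer m A"
proof -
  have "(\<Sum>k<N. hausdorff_outer m (R k)) \<le> hausdorff_outer m (\<Union>k<N. R k)"
  proof (induction N)
    case (Suc N)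
    obtain d where "d > 0" "\<forall>j<N. \<forall>x\<in>R j. \<forall>y\<in>R N. d \<le> dist x y" using sep by blast
    then have "hausdorff_outer m (\<Union>k<N. R k) + hausdorff_outer m (R N) \<le> hausdorff_outer m ((\<Union>k<N. R k) \<union> R N)"
      by (intro hausdorff_outer_separated) auto
    also have "(\<Union>k<N. R k) \<union> R N = (\<Union>k<Suc N. R k)" by (auto simp: lessThan_Suc)
    finally show ?case
      unfolding sum.lessThan_Suc by (rule order_trans[OF add_right_mono[OF Suc]])
  qed simp
  also have "\<dots> \<le> hausdorff_outer m A" using sub by (intro hausdorff_outer_mono) auto
  finally show ?thesis .
qed

text \<open>
  Caratheodory's criterion for an outer measure that is additive on separated sets. The part \<open>S n\<close> of
  \<open>A\<close> at distance at least \<open>1 / (n + 1)\<close> from \<open>C\<close> is separated from \<open>A \<inter> C\<close>, and \<open>A - C\<close> exceeds \<open>S n\<close>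
  by the rings \<open>R k\<close> with \<open>k \<ge> n\<close>. The rings of even index are separated from each other, and so are
  those of odd index; hence the sum of all ring measures is at most twice the measure of \<open>A\<close>, and
  its tails tend to \<open>0\<close>.
\<close>

lemma closed_in_hausdorff_lambda_system:
  fixes C :: "'a::metric_space set"
  assumes "closed C"
  shows "C \<in> lambda_system UNIV UNIV (hausdorff_outer m)"
proof (cases "C = {}")
  case True
  then show ?thesis by (simp add: lambda_system_def)
next
  case False
  let ?H = "hausdorff_outer m :: 'a set \<Rightarrow> ennreal"
  have "?H (C \<inter> A) + ?H ((UNIV - C) \<inter> A) \<le> ?H A" for A
  proof (cases "?H A = \<infinity>")
    case fin: False
    define S where "S n = {x\<in>A. 1 / real (n + 1) \<le> infdist x C}" for n
    define R where "R n = {x\<in>A. 1 / real (n + 2) \<le> infdist x C \<and> infdist x C < 1 / real (n + 1)}" for n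
    have lip: "infdist x C - infdist y C \<le> dist x y" for x y
      using infdist_triangle[of x C y] by simp
    \<comment> \<open>Consecutive rings touch, but rings whose indices differ by at least two are separated.\<close>
    have even_odd: "(\<Sum>k<N. ?H (R (2 * k + i))) \<le> ?H A" for N i
    proof (rule hausdorff_outer_separated_rings)
      fix N
      let ?d = "1 / real (2 * N + i) - 1 / real (2 * N + i + 1)"
      have *: "?d \<le> dist x y" if "j < N" "x \<in> R (2 * j + i)" "y \<in> R (2 * N + i)" for j x y
      proof -
        have "1 / real (2 * N + i) \<le> 1 / real (2 * j + i + 2)"
          using that(1) by (intro divide_left_mono) auto
        then show ?thesis using that lip[of x y] by (auto simp: R_def)
      qed
      have **: "?d > 0" if "N \<noteq> 0"
        using that divide_strict_left_mono[of "real (2 * N + i)" "real (2 * N + i + 1)" 1] by simp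
      show "\<exists>d>0. \<forall>j<N. \<forall>x\<in>R (2 * j + i). \<forall>y\<in>R (2 * N + i). d \<le> dist x y"
      proof (cases "N = 0")
        case True
        then show ?thesis by (intro exI[of _ 1]) auto
      next
        case False
        then show ?thesis using * ** by (intro exI[of _ ?d]) blast
      qed
    qed (auto simp: R_def)
    have part: "(\<Sum>k<N. ?H (R k)) \<le> 2 * ?H A" for N
    proof -
      have "(\<Sum>k<N. ?H (R k)) \<le> (\<Sum>k<2*N. ?H (R k))" by (rule sum_mono2) auto
      also have "\<dots> = (\<Sum>k<N. ?H (R (2 * k))) + (\<Sum>k<N. ?H (R (2 * k + 1)))"
        by (induction N) (auto simp: algebra_simps)
      also have "\<dots> \<le> 2 * ?H A"
        using add_mono[OF even_odd[of 0 N] even_odd[of 1 N]] by (simp add: mult_2)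
      finally show ?thesis .
    qed
    have "(\<Sum>k. ?H (R k)) \<le> 2 * ?H A"
      unfolding suminf_eq_SUP by (rule SUP_least) (rule part)
    also have "\<dots> < \<infinity>" using fin by (simp add: ennreal_mult_less_top less_top)
    finally have Rfin: "(\<Sum>k. ?H (R k)) < \<infinity>" .
    show ?thesis
    proof (rule ennreal_le_epsilon)
      fix e :: real assume "0 < e"
      obtain n where n: "(\<Sum>k. ?H (R (k + n))) \<le> ennreal e"
        using ennreal_suminf_tail_small[OF Rfin \<open>0 < e\<close>] by blast
      have "(UNIV - C) \<inter> A \<subseteq> S n \<union> (\<Union>k. R (k + n))"
      proof
        fix x assume x: "x \<in> (UNIV - C) \<inter> A"
        then have pos: "infdist x C > 0"
          using assms False in_closed_iff_infdist_zero[of C x] infdist_nonneg[of x C] by force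
        show "x \<in> S n \<union> (\<Union>k. R (k + n))"
        proof (cases "x \<in> S n")
          case not: False
          have ex: "\<exists>j. 1 / real (j + 1) \<le> infdist x C"
            using reals_Archimedean[OF pos] by (auto simp: inverse_eq_divide intro: less_imp_le)
          \<comment> \<open>The first index with \<open>x \<in> S j\<close>; then \<open>x\<close> lies in the ring just before it.\<close>
          define j where "j = (LEAST j. 1 / real (j + 1) \<le> infdist x C)"
          have j: "1 / real (j + 1) \<le> infdist x C" unfolding j_def using ex by (rule LeastI_ex)
          have "n < j"
          proof (rule ccontr)
            assume "\<not> n < j"
            then have "1 / real (n + 1) \<le> 1 / real (j + 1)" by (intro divide_left_mono) auto
            with j not x show False by (auto simp: S_def)
          qed
          then obtain i where i: "j = Suc i" "n \<le> i" by (cases j) auto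
          have "\<not> 1 / real (i + 1) \<le> infdist x C"
            using not_less_Least[of i "\<lambda>j. 1 / real (j + 1) \<le> infdist x C"] i unfolding j_def by simp
          then have "x \<in> R i" using j i x by (auto simp: R_def add.commute)
          then show ?thesis using i by (auto intro!: exI[of _ "i - n"])
        qed auto
      qed
      then have "?H ((UNIV - C) \<inter> A) \<le> ?H (S n \<union> (\<Union>k. R (k + n)))" by (rule hausdorff_outer_mono)
      also have "\<dots> \<le> ?H (S n) + ?H (\<Union>k. R (k + n))" by (rule hausdorff_outer_Un_le)
      also have "\<dots> \<le> ?H (S n) + ennreal e"
        using hausdorff_outer_UN_le[of m "\<lambda>k. R (k + n)"] n by (intro add_left_mono) (rule order_trans)
      finally have "?H (C \<inter> A) + ?H ((UNIV - C) \<inter> A) \<le> ?H (C \<inter> A) + ?H (S n) + ennreal e"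
        by (simp add: add.assoc add_left_mono)
      also have "?H (C \<inter> A) + ?H (S n) \<le> ?H (C \<inter> A \<union> S n)"
      proof (rule hausdorff_outer_separated)
        fix a b assume "a \<in> C \<inter> A" "b \<in> S n"
        then show "1 / real (n + 1) \<le> dist a b"
          using infdist_le[of a C b] by (auto simp: S_def dist_commute)
      qed auto
      also have "\<dots> \<le> ?H A" by (rule hausdorff_outer_mono) (auto simp: S_def)
      finally show "?H (C \<inter> A) + ?H ((UNIV - C) \<inter> A) \<le> ?H A + ennreal e"
        by (simp add: add_right_mono)
    qed
  qed simp
  moreover have "?H A \<le> ?H (C \<inter> A) + ?H ((UNIV - C) \<inter> A)" for A
  proof -
    have "A = (C \<inter> A) \<union> ((UNIV - C) \<inter> A)" by auto
    then show ?thesis using hausdorff_outer_Un_le by metis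
  qed
  ultimately show ?thesis by (auto simp: lambda_system_def intro: antisym)
qed

lemma sets_hausdorff_measure [simp, measurable_cong]: "sets (hausdorff_measure m) = sets borel"
  unfolding hausdorff_measure_def using sets.sets_measure_of_eq[of borel] by simp

lemma space_hausdorff_measure [simp]: "space (hausdorff_measure m) = UNIV"
  unfolding hausdorff_measure_def by simp

lemma emeasure_hausdorff_measure:
  fixes A :: "'a::metric_space set"
  assumes "A \<in> sets borel"
  shows "emeasure (hausdorff_measure m) A = hausdorff_outer m A"
proof -
  interpret P: sigma_algebra "UNIV :: 'a set" UNIV
    using sigma_algebra_Pow[of "UNIV :: 'a set"] by simp
  let ?L = "lambda_system UNIV UNIV (hausdorff_outer m) :: 'a set set"
  have ms: "measure_space UNIV ?L (hausdorff_outer m)"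
    by (rule P.caratheodory_lemma[OF outer_measure_space_hausdorff])
  then interpret L: sigma_algebra UNIV ?L by (simp add: measure_space_def)
  have sub: "sets borel \<subseteq> ?L"
    unfolding borel_eq_closed
    by (subst sets_measure_of) (auto intro!: L.sigma_sets_subset closed_in_hausdorff_lambda_system)
  show ?thesis
  proof (rule emeasure_measure_of[OF hausdorff_measure_def])
    show "positive (sets (hausdorff_measure m :: 'a measure)) (hausdorff_outer m)"
      by (simp add: positive_def)
    have ca: "countably_additive ?L (hausdorff_outer m)" using ms by (simp add: measure_space_def)
    show "countably_additive (sets (hausdorff_measure m :: 'a measure)) (hausdorff_outer m)"
    proof (rule countably_additiveI)
      fix X :: "nat \<Rightarrow> 'a set"
      assume X: "range X \<subseteq> sets (hausdorff_measure m :: 'a measure)" "disjoint_family X" "(\<Union>i. X i) \<in> sets (hausdorff_measure m :: 'a measure)"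
      show "(\<Sum>i. hausdorff_outer m (X i)) = hausdorff_outer m (\<Union>i. X i)"
      proof (rule ca[unfolded countably_additive_def, rule_format])
        show "range X \<subseteq> ?L" using X(1) sub unfolding sets_hausdorff_measure by (rule order_trans)
        show "disjoint_family X" by fact
        show "(\<Union>i. X i) \<in> ?L" using X(3) sub unfolding sets_hausdorff_measure by (rule subsetD[rotated])
      qed
    qed
  qed (use assms in auto)
qed

lemma hausdorff_outer_lipschitz_image:
  fixes g :: "'a::metric_space \<Rightarrow> 'b::metric_space"
  assumes lip: "\<And>x y. x \<in> S \<Longrightarrow> y \<in> S \<Longrightarrow> dist (g x) (g y) \<le> L * dist x y" and "0 < L"
  shows "hausdorff_outer m (g ` S) \<le> ennreal (L ^ m) * hausdorff_outer m S"
  unfolding hausdorff_outer_def[of m "g ` S"]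
proof (rule SUP_least)
  fix \<delta> :: real assume "\<delta> \<in> {0<..}"
  then have "0 < \<delta> / L" using \<open>0 < L\<close> by auto
  let ?c = "unit_ball_vol (real m) / 2 ^ m"
  have inv: "ennreal (L ^ m) * ennreal ((1 / L) ^ m) = 1"
    using \<open>0 < L\<close> by (simp add: ennreal_mult[symmetric] power_mult_distrib[symmetric])
  have "ennreal ((1 / L) ^ m) * hausdorff_pre m \<delta> (g ` S) \<le> hausdorff_pre m (\<delta> / L) S"
    unfolding hausdorff_pre_def[of m "\<delta> / L"]
  proof (rule INF_greatest, clarify)
    fix E :: "nat \<Rightarrow> 'a set"
    assume E: "S \<subseteq> (\<Union>i. E i)" "\<forall>i. bounded (E i) \<and> diameter (E i) \<le> \<delta> / L"
    have dist: "dist (g x) (g y) \<le> L * diameter (E i)" if "x \<in> E i \<inter> S" "y \<in> E i \<inter> S" for i x y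
    proof -
      have "dist x y \<le> diameter (E i)"
        using diameter_bounded_bound[of "E i" x y] that E(2) by auto
      then have "L * dist x y \<le> L * diameter (E i)"
        using \<open>0 < L\<close> by (intro mult_left_mono) auto
      moreover have "dist (g x) (g y) \<le> L * dist x y" using lip that by auto
      ultimately show ?thesis by (rule order_trans[rotated])
    qed
    have bd: "bounded (g ` (E i \<inter> S))" for i
      unfolding bounded_two_points using dist by auto
    have dia: "diameter (g ` (E i \<inter> S)) \<le> L * diameter (E i)" for i
      using dist[of _ i] E(2) \<open>0 < L\<close> diameter_ge_0[of "E i"]
      by (auto simp: diameter_def[of "g ` _"] intro!: cSUP_least)
    have "hausdorff_pre m \<delta> (g ` S) \<le> (\<Sum>i. hausdorff_cost m (g ` (E i \<inter> S)))"
    proof (rule hausdorff_pre_le)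
      fix i show "diameter (g ` (E i \<inter> S)) \<le> \<delta>"
        using dia[of i] E(2)[rule_format, of i] \<open>0 < L\<close> by (simp add: pos_le_divide_eq mult.commute)
      show "g ` S \<subseteq> (\<Union>i. g ` (E i \<inter> S))" using E(1) by blast
    qed (rule bd)
    also have "\<dots> \<le> (\<Sum>i. ennreal (L ^ m) * hausdorff_cost m (E i))"
    proof (rule suminf_le)
      fix i
      have "?c * diameter (g ` (E i \<inter> S)) ^ m \<le> ?c * (L * diameter (E i)) ^ m"
        using dia[of i] bd[of i] by (intro mult_left_mono power_mono) (auto intro: diameter_ge_0)
      also have "\<dots> = L ^ m * (?c * diameter (E i) ^ m)" by (simp add: power_mult_distrib)
      finally have "ennreal (?c * diameter (g ` (E i \<inter> S)) ^ m) \<le> ennreal (L ^ m) * ennreal (?c * diameter (E i) ^ m)"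
        using E(2) \<open>0 < L\<close> by (subst ennreal_mult[symmetric]) (auto intro!: ennreal_leI divide_nonneg_nonneg mult_nonneg_nonneg diameter_ge_0 zero_le_power)
      then show "hausdorff_cost m (g ` (E i \<inter> S)) \<le> ennreal (L ^ m) * hausdorff_cost m (E i)"
        by auto
    qed auto
    also have "\<dots> = ennreal (L ^ m) * (\<Sum>i. hausdorff_cost m (E i))"
      by (rule ennreal_suminf_cmult)
    finally have "ennreal ((1 / L) ^ m) * hausdorff_pre m \<delta> (g ` S)
        \<le> ennreal ((1 / L) ^ m) * (ennreal (L ^ m) * (\<Sum>i. hausdorff_cost m (E i)))"
      by (rule mult_left_mono) auto
    then show "ennreal ((1 / L) ^ m) * hausdorff_pre m \<delta> (g ` S) \<le> (\<Sum>i. hausdorff_cost m (E i))"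
      using inv by (simp add: mult.assoc[symmetric] mult.commute[of "ennreal ((1 / L) ^ m)"])
  qed
  then have "ennreal (L ^ m) * (ennreal ((1 / L) ^ m) * hausdorff_pre m \<delta> (g ` S)) \<le> ennreal (L ^ m) * hausdorff_pre m (\<delta> / L) S"
    by (rule mult_left_mono) auto
  then have "hausdorff_pre m \<delta> (g ` S) \<le> ennreal (L ^ m) * hausdorff_pre m (\<delta> / L) S"
    using inv by (simp add: mult.assoc[symmetric])
  also have "\<dots> \<le> ennreal (L ^ m) * hausdorff_outer m S"
    using \<open>0 < \<delta> / L\<close> by (intro mult_left_mono hausdorff_pre_le_outer) auto
  finally show "hausdorff_pre m \<delta> (g ` S) \<le> ennreal (L ^ m) * hausdorff_outer m S" .
qed

section \<open>Hausdorff measure in full dimension\<close>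

text \<open>
  The constant \<^term>\<open>unit_ball_vol (real m) / 2 ^ m\<close> is exactly the one in the isodiametric inequality,
  so no covering set can have more volume than it costs.
\<close>

lemma lborel_le_hausdorff_outer:
  fixes A :: "'a::euclidean_space set"
  assumes "A \<in> sets borel"
  shows "emeasure lborel A \<le> hausdorff_outer DIM('a) A"
proof -
  have "emeasure lborel A \<le> hausdorff_pre DIM('a) 1 A"
    unfolding hausdorff_pre_def
  proof (rule INF_greatest, clarify)
    fix E :: "nat \<Rightarrow> 'a set"
    assume E: "A \<subseteq> (\<Union>i. E i)" "\<forall>i. bounded (E i) \<and> diameter (E i) \<le> 1"
    have "(\<Union>i. E i) \<subseteq> (\<Union>i. closure (E i))"
      by (intro UN_mono closure_subset) auto
    then have "emeasure lborel A \<le> emeasure lborel (\<Union>i. closure (E i))"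
      using E(1) by (intro emeasure_mono) auto
    also have "\<dots> \<le> (\<Sum>i. emeasure lborel (closure (E i)))"
      by (intro emeasure_subadditive_countably) auto
    also have "\<dots> \<le> (\<Sum>i. hausdorff_cost DIM('a) (E i))"
    proof (intro suminf_le)
      fix i
      show "emeasure lborel (closure (E i)) \<le> hausdorff_cost DIM('a) (E i)"
        using isodiametric[of "closure (E i)"] E(2) by (auto simp: diameter_closure)
    qed auto
    finally show "emeasure lborel A \<le> (\<Sum>i. hausdorff_cost DIM('a) (E i))" .
  qed
  also have "\<dots> \<le> hausdorff_outer DIM('a) A"
    by (rule hausdorff_pre_le_outer) simp
  finally show ?thesis .
qed

text \<open>
  Covering sets \<open>X i\<close> may overlap as long as each of them is charged to its own part \<open>Y i\<close> of a disjoint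
  family: the balls of a Vitali cover themselves, or the interiors of dyadic cubes.
\<close>

lemma hausdorff_pre_UN_le_measure:
  assumes "countable I" "0 \<le> \<delta>"
    and le: "\<And>i. i \<in> I \<Longrightarrow> hausdorff_pre m \<delta> (X i) \<le> c * emeasure M (Y i)"
    and sets: "\<And>i. i \<in> I \<Longrightarrow> Y i \<in> sets M" and disj: "disjoint_family_on Y I"
  shows "hausdorff_pre m \<delta> (\<Union>i\<in>I. X i) \<le> c * emeasure M (\<Union>i\<in>I. Y i)"
proof -
  let ?N = "to_nat_on I ` I"
  define X' where "X' n = (if n \<in> ?N then X (from_nat_into I n) else {})" for n
  define Y' where "Y' n = (if n \<in> ?N then Y (from_nat_into I n) else {})" for n
  have eq: "(\<Union>i\<in>I. X i) = (\<Union>n. X' n)" "(\<Union>i\<in>I. Y i) = (\<Union>n. Y' n)"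
    using \<open>countable I\<close> by (force simp: X'_def Y'_def split: if_splits)+
  have "hausdorff_pre m \<delta> (\<Union>n. X' n) \<le> (\<Sum>n. hausdorff_pre m \<delta> (X' n))"
    by (rule hausdorff_pre_UN_le)
  also have "\<dots> \<le> (\<Sum>n. c * emeasure M (Y' n))"
    using \<open>countable I\<close> \<open>0 \<le> \<delta>\<close> le
    by (intro suminf_le) (auto simp: X'_def Y'_def hausdorff_pre_empty)
  also have "\<dots> = c * (\<Sum>n. emeasure M (Y' n))"
    by (rule ennreal_suminf_cmult)
  also have "(\<Sum>n. emeasure M (Y' n)) = emeasure M (\<Union>n. Y' n)"
  proof (rule suminf_emeasure)
    show "range Y' \<subseteq> sets M" using sets \<open>countable I\<close> by (auto simp: Y'_def)
    show "disjoint_family Y'"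
      using disj \<open>countable I\<close> unfolding disjoint_family_on_def Y'_def by (auto split: if_splits; blast)
  qed
  finally show ?thesis unfolding eq .
qed

lemma hausdorff_pre_cube_le:
  fixes u v :: "'a::euclidean_space"
  assumes side: "\<And>b. b \<in> Basis \<Longrightarrow> v \<bullet> b - u \<bullet> b = s" and "0 \<le> s"
    and "diameter (cbox u v) \<le> \<delta>"
  shows "hausdorff_pre DIM('a) \<delta> (cbox u v)
    \<le> ennreal (unit_ball_vol (real DIM('a)) / 2 ^ DIM('a) * real DIM('a) ^ DIM('a)) * emeasure lborel (box u v)"
proof -
  have le: "u \<bullet> b \<le> v \<bullet> b" if "b \<in> Basis" for b
    using side[OF that] \<open>0 \<le> s\<close> by simp
  have d: "diameter (cbox u v) \<le> real DIM('a) * s"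
  proof (rule diameter_le)
    fix x y assume xy: "x \<in> cbox u v" "y \<in> cbox u v"
    have "norm (x - y) \<le> (\<Sum>b\<in>Basis. \<bar>(x - y) \<bullet> b\<bar>)" by (rule norm_le_l1)
    also have "\<dots> \<le> (\<Sum>b\<in>(Basis::'a set). s)"
    proof (rule sum_mono)
      fix b :: 'a assume b: "b \<in> Basis"
      then have "u \<bullet> b \<le> x \<bullet> b" "x \<bullet> b \<le> v \<bullet> b" "u \<bullet> b \<le> y \<bullet> b" "y \<bullet> b \<le> v \<bullet> b"
        using xy by (auto simp: mem_box)
      then show "\<bar>(x - y) \<bullet> b\<bar> \<le> s"
        using side[OF b] unfolding inner_diff_left by linarith
    qed
    finally show "norm (x - y) \<le> real DIM('a) * s" by simp
  qed (use \<open>0 \<le> s\<close> in auto)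
  have em: "emeasure lborel (box u v) = ennreal (s ^ DIM('a))"
    using le side by (subst emeasure_lborel_box) (auto simp: inner_diff_left)
  have "hausdorff_pre DIM('a) \<delta> (cbox u v) \<le> ennreal (unit_ball_vol (real DIM('a)) / 2 ^ DIM('a) * diameter (cbox u v) ^ DIM('a))"
    using assms by (intro hausdorff_pre_bounded_set) auto
  also have "\<dots> \<le> ennreal (unit_ball_vol (real DIM('a)) / 2 ^ DIM('a) * (real DIM('a) * s) ^ DIM('a))"
    using d by (intro ennreal_leI mult_left_mono power_mono) (auto intro: diameter_ge_0)
  also have "\<dots> = ennreal (unit_ball_vol (real DIM('a)) / 2 ^ DIM('a) * real DIM('a) ^ DIM('a)) * emeasure lborel (box u v)"
    using \<open>0 \<le> s\<close> unfolding em by (subst ennreal_mult[symmetric]) (auto simp: power_mult_distrib mult_ac)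
  finally show ?thesis .
qed

text \<open>
  A null set is covered by dyadic cubes inside an open set of small measure. Cubes cost more than their
  volume, but only by a factor that depends on the dimension, which is harmless for a null set.
\<close>

lemma hausdorff_pre_bounded_negligible:
  fixes N :: "'a::euclidean_space set"
  assumes "negligible N" and N: "N \<subseteq> cbox (- R *\<^sub>R One) (R *\<^sub>R One)" and "0 < R" and "0 < \<delta>"
  shows "hausdorff_pre DIM('a) \<delta> N = 0"
proof -
  define C where "C = unit_ball_vol (real DIM('a)) / 2 ^ DIM('a) * real DIM('a) ^ DIM('a)"
  have Cpos: "C > 0" unfolding C_def by simp
  have "hausdorff_pre DIM('a) \<delta> N \<le> 0 + ennreal e" if "0 < e" for e
  proof -
    have "0 < e / C" using that Cpos by (rule divide_pos_pos)
    obtain W where W: "open W" "N \<subseteq> W" "emeasure lebesgue (W - N) < ennreal (e / C)"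
      using sets_lebesgue_outer_open[OF negligible_imp_sets[OF \<open>negligible N\<close>] \<open>0 < e / C\<close>] by metis
    have "emeasure lborel W = emeasure lebesgue W" using W(1) by simp
    also have "\<dots> \<le> emeasure lebesgue ((W - N) \<union> N)"
      using W \<open>negligible N\<close> by (intro emeasure_mono) (auto simp: negligible_imp_sets)
    also have "\<dots> = emeasure lebesgue (W - N)"
      using W(1) \<open>negligible N\<close> by (intro emeasure_Un_null_set) (auto simp: negligible_iff_null_sets negligible_imp_sets)
    finally have Wle: "emeasure lborel W \<le> ennreal (e / C)" using W(3) by simp
    define g where "g x = (if x \<in> W then W \<inter> ball x (\<delta> / 2) else ball x 1)" for x
    have "gauge g" using W(1) \<open>0 < \<delta>\<close> by (auto simp: gauge_def g_def)
    have ne: "box (- R *\<^sub>R One) (R *\<^sub>R One :: 'a) \<noteq> {}"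
      using \<open>0 < R\<close> by (auto simp: box_ne_empty)
    obtain \<D> where D: "countable \<D>" "\<Union>\<D> \<subseteq> cbox (- R *\<^sub>R One) (R *\<^sub>R One)"
        "\<And>K. K \<in> \<D> \<Longrightarrow> interior K \<noteq> {} \<and> (\<exists>c d. K = cbox c d)"
        "pairwise (\<lambda>A B. interior A \<inter> interior B = {}) \<D>"
        "\<And>K. K \<in> \<D> \<Longrightarrow> \<exists>x \<in> N \<inter> K. K \<subseteq> g x"
        "\<And>u v. cbox u v \<in> \<D> \<Longrightarrow> \<exists>n. \<forall>i \<in> Basis. v \<bullet> i - u \<bullet> i = (R *\<^sub>R One \<bullet> i - - R *\<^sub>R One \<bullet> i) / 2^n"
        "N \<subseteq> \<Union>\<D>"
      using covering_lemma[OF N ne \<open>gauge g\<close>] by blast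
    have sub: "K \<subseteq> W" "diameter K \<le> \<delta>" if K: "K \<in> \<D>" for K
    proof -
      obtain x where x0: "x \<in> N" "K \<subseteq> g x"
        using D(5)[OF K] by blast
      then have x: "K \<subseteq> W \<inter> ball x (\<delta> / 2)"
        using subsetD[OF W(2) x0(1)] by (simp add: g_def)
      then show "K \<subseteq> W" by auto
      have "diameter K \<le> diameter (ball x (\<delta> / 2))" using x by (intro diameter_subset) auto
      then show "diameter K \<le> \<delta>" using \<open>0 < \<delta>\<close> by simp
    qed
    have "hausdorff_pre DIM('a) \<delta> N \<le> hausdorff_pre DIM('a) \<delta> (\<Union>K\<in>\<D>. K)"
      using D(7) by (intro hausdorff_pre_mono) auto
    also have "\<dots> \<le> ennreal C * emeasure lborel (\<Union>K\<in>\<D>. interior K)"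
    proof (rule hausdorff_pre_UN_le_measure)
      fix K assume K: "K \<in> \<D>"
      obtain u v where uv: "K = cbox u v" using D(3)[OF K] by blast
      then obtain n where n: "\<forall>i\<in>Basis. v \<bullet> i - u \<bullet> i = (R *\<^sub>R One \<bullet> i - - R *\<^sub>R One \<bullet> i) / 2^n"
        using D(6) K by blast
      have "hausdorff_pre DIM('a) \<delta> (cbox u v) \<le> ennreal C * emeasure lborel (box u v)"
        using n sub(2)[OF K] \<open>0 < R\<close> unfolding uv C_def
        by (intro hausdorff_pre_cube_le[where s="2 * R / 2 ^ n"]) (auto simp: inner_simps)
      then show "hausdorff_pre DIM('a) \<delta> K \<le> ennreal C * emeasure lborel (interior K)"
        by (simp add: uv interior_cbox)
    next
      show "disjoint_family_on interior \<D>"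
        using D(4) by (auto simp: disjoint_family_on_def pairwise_def)
    qed (use D(1) \<open>0 < \<delta>\<close> in auto)
    also have "\<dots> \<le> ennreal C * emeasure lborel W"
    proof (intro mult_left_mono emeasure_mono)
      show "(\<Union>K\<in>\<D>. interior K) \<subseteq> W" using sub(1) interior_subset by blast
    qed (use W(1) in auto)
    also have "\<dots> \<le> ennreal C * ennreal (e / C)"
      using Wle by (rule mult_left_mono) simp
    also have "\<dots> = ennreal e"
      using Cpos that by (simp add: ennreal_mult[symmetric])
    finally show ?thesis by simp
  qed
  then have "hausdorff_pre DIM('a) \<delta> N \<le> 0" by (rule ennreal_le_epsilon)
  then show ?thesis by simp
qed

lemma hausdorff_pre_negligible:
  fixes N :: "'a::euclidean_space set"
  assumes "negligible N" and "0 < \<delta>"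
  shows "hausdorff_pre DIM('a) \<delta> N = 0"
proof -
  define N' where "N' n = N \<inter> cbox (- real (Suc n) *\<^sub>R One) (real (Suc n) *\<^sub>R One)" for n
  have N': "N \<subseteq> (\<Union>n. N' n)"
  proof
    fix x assume "x \<in> N"
    obtain n where "norm x \<le> real n" using real_arch_simple by blast
    then have "\<bar>x \<bullet> b\<bar> \<le> real (Suc n)" if "b \<in> Basis" for b
      using Basis_le_norm[OF that, of x] by simp
    then have "x \<in> cbox (- real (Suc n) *\<^sub>R One) (real (Suc n) *\<^sub>R One)"
      unfolding mem_box abs_le_iff by (intro ballI) (fastforce simp: inner_simps)
    then show "x \<in> (\<Union>n. N' n)" using \<open>x \<in> N\<close> unfolding N'_def by blast
  qed
  have "hausdorff_pre DIM('a) \<delta> (N' n) = 0" for n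
    unfolding N'_def using assms
    by (intro hausdorff_pre_bounded_negligible[where R="real (Suc n)"]) (auto intro: negligible_subset)
  then have "hausdorff_pre DIM('a) \<delta> N \<le> 0"
    using order_trans[OF hausdorff_pre_mono[OF N'] hausdorff_pre_UN_le, of "DIM('a)" \<delta>] by simp
  then show ?thesis by simp
qed

text \<open>
  For balls the cost equals the volume. By Vitali's theorem an open set around \<open>A\<close> with almost the same
  volume is, up to a null set, a disjoint union of small balls.
\<close>

lemma hausdorff_outer_le_lborel:
  fixes A :: "'a::euclidean_space set"
  assumes "A \<in> sets borel"
  shows "hausdorff_outer DIM('a) A \<le> emeasure lborel A"
  unfolding hausdorff_outer_def
proof (rule SUP_least, rule ennreal_le_epsilon)
  fix \<delta> e :: real assume "\<delta> \<in> {0<..}" and "0 < e"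
  then have "0 < \<delta>" by simp
  obtain U where U: "open U" "A \<subseteq> U" "emeasure lborel (U - A) \<le> e"
    using outer_regular_lborel_le[OF assms \<open>0 < e\<close>] by metis
  define K where "K = {(x, r). cball x r \<subseteq> U \<and> 0 < r \<and> r \<le> \<delta> / 2}"
  have "\<exists>i\<in>K. x \<in> cball (fst i) (snd i) \<and> snd i < d" if "x \<in> U" "0 < d" for x d
  proof -
    obtain r where r: "r > 0" "cball x r \<subseteq> U" using U(1) \<open>x \<in> U\<close> open_contains_cball by blast
    let ?r = "min r (min (\<delta> / 2) (d / 2))"
    have "cball x ?r \<subseteq> cball x r" by (rule subset_cball) simp
    then have "(x, ?r) \<in> K" using r \<open>0 < \<delta>\<close> \<open>0 < d\<close> by (auto simp: K_def)
    moreover have "?r < d" using \<open>0 < d\<close> by auto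
    ultimately show ?thesis using r \<open>0 < \<delta>\<close> \<open>0 < d\<close> by (intro bexI[of _ "(x, ?r)"]) auto
  qed
  then have cov: "\<exists>i. i \<in> K \<and> x \<in> cball (fst i) (snd i) \<and> snd i < d" if "x \<in> U" "0 < d" for x d
    using that by blast
  obtain C where C: "countable C" "C \<subseteq> K"
      "pairwise (\<lambda>i j. disjnt (cball (fst i) (snd i)) (cball (fst j) (snd j))) C"
      "negligible (U - (\<Union>i \<in> C. cball (fst i) (snd i)))"
  proof (rule Vitali_covering_theorem_cballs[OF _ cov])
    show "0 < snd i" if "i \<in> K" for i using that by (auto simp: K_def)
  qed
  let ?B = "\<Union>i\<in>C. cball (fst i) (snd i)"
  have "hausdorff_pre DIM('a) \<delta> A \<le> hausdorff_pre DIM('a) \<delta> (?B \<union> (U - ?B))"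
    using U(2) by (intro hausdorff_pre_mono) auto
  also have "\<dots> \<le> hausdorff_pre DIM('a) \<delta> ?B + hausdorff_pre DIM('a) \<delta> (U - ?B)"
    using \<open>0 < \<delta>\<close> by (intro hausdorff_pre_Un_le) auto
  also have "\<dots> = hausdorff_pre DIM('a) \<delta> ?B"
    using C(4) \<open>0 < \<delta>\<close> by (simp add: hausdorff_pre_negligible)
  also have "\<dots> \<le> 1 * emeasure lborel ?B"
  proof (rule hausdorff_pre_UN_le_measure)
    fix i assume "i \<in> C"
    then have i: "0 < snd i" "snd i \<le> \<delta> / 2" using C(2) by (auto simp: K_def)
    have "hausdorff_pre DIM('a) \<delta> (cball (fst i) (snd i))
        \<le> ennreal (unit_ball_vol (real DIM('a)) / 2 ^ DIM('a) * diameter (cball (fst i) (snd i)) ^ DIM('a))"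
      using i by (intro hausdorff_pre_bounded_set) auto
    also have "\<dots> = emeasure lborel (cball (fst i) (snd i))"
      using i by (simp add: emeasure_cball power_mult_distrib)
    finally show "hausdorff_pre DIM('a) \<delta> (cball (fst i) (snd i)) \<le> 1 * emeasure lborel (cball (fst i) (snd i))"
      by simp
  next
    show "disjoint_family_on (\<lambda>i. cball (fst i) (snd i)) C"
      using C(3) by (auto simp: disjoint_family_on_def pairwise_def disjnt_def)
  qed (use C(1) \<open>0 < \<delta>\<close> in auto)
  also have "\<dots> \<le> emeasure lborel U"
  proof -
    have "?B \<subseteq> U" using C(2) by (fastforce simp: K_def subset_iff)
    then show ?thesis using U(1) by (simp add: emeasure_mono)
  qed
  also have "\<dots> \<le> emeasure lborel (A \<union> (U - A))"
    using assms U by (intro emeasure_mono) auto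
  also have "\<dots> \<le> emeasure lborel A + emeasure lborel (U - A)"
    using assms U by (intro emeasure_subadditive) auto
  also have "\<dots> \<le> emeasure lborel A + ennreal e"
    using U(3) by (rule add_left_mono)
  finally show "hausdorff_pre DIM('a) \<delta> A \<le> emeasure lborel A + ennreal e" .
qed

theorem hausdorff_outer_eq_lborel:
  fixes A :: "'a::euclidean_space set"
  assumes "A \<in> sets borel"
  shows "hausdorff_outer DIM('a) A = emeasure lborel A"
  using assms by (intro antisym hausdorff_outer_le_lborel lborel_le_hausdorff_outer)

lemma hausdorff_measure_eq_lborel: "hausdorff_measure DIM('a::euclidean_space) = (lborel :: 'a measure)"
  by (rule measure_eqI) (simp_all add: emeasure_hausdorff_measure hausdorff_outer_eq_lborel)

section \<open>Volume distortion of linear maps\<close>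

lemma linear_borel_measurable:
  fixes f :: "'a::euclidean_space \<Rightarrow> 'b::euclidean_space"
  shows "linear f \<Longrightarrow> f \<in> borel_measurable borel"
  by (intro borel_measurable_continuous_onI linear_continuous_on) (simp add: linear_conv_bounded_linear)

lemma linear_image_in_borel:
  fixes T :: "'a::euclidean_space \<Rightarrow> 'b::euclidean_space"
  assumes "linear T" "bij T" "A \<in> sets borel"
  shows "T ` A \<in> sets borel"
proof -
  obtain g where g: "linear g" "g \<circ> T = id"
    using linear_injective_left_inverse[OF \<open>linear T\<close>] \<open>bij T\<close> by (auto simp: bij_def)
  have gT: "g (T x) = x" for x
    using g(2) by (simp add: fun_eq_iff)
  have "g \<in> borel_measurable borel"
    using g(1) by (rule linear_borel_measurable)
  then have "g -` A \<in> sets borel" using assms(3) by (rule measurable_sets_borel)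
  also have "g -` A = T ` A"
  proof safe
    fix y assume "g y \<in> A"
    obtain x where "y = T x" using \<open>bij T\<close> by (meson bij_pointE)
    with \<open>g y \<in> A\<close> show "y \<in> T ` A" using gT by auto
  qed (simp add: gT)
  finally show ?thesis .
qed

text \<open>
  Hausdorff measure visibly depends on distances only, so the identification with Lebesgue measure
  yields the invariance of the latter, also between different Euclidean spaces.
\<close>

lemma emeasure_lborel_isometry:
  fixes \<phi> :: "'a::euclidean_space \<Rightarrow> 'b::euclidean_space"
  assumes "linear \<phi>" "\<And>x. norm (\<phi> x) = norm x" "surj \<phi>" "A \<in> sets borel"
  shows "emeasure lborel (\<phi> ` A) = emeasure lborel A"
proof -
  have dist: "dist (\<phi> x) (\<phi> y) = dist x y" for x y
    using assms(1,2) by (simp add: dist_norm linear_diff[symmetric])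
  then have "inj \<phi>" by (metis dist_eq_0_iff injI)
  have dim: "DIM('a) = DIM('b)"
    using dim_image_eq[of \<phi> UNIV] \<open>linear \<phi>\<close> \<open>inj \<phi>\<close> \<open>surj \<phi>\<close> by simp
  have m: "\<phi> ` A \<in> sets borel"
    using assms \<open>inj \<phi>\<close> by (intro linear_image_in_borel) (auto simp: bij_def)
  have "hausdorff_outer DIM('a) (\<phi> ` A) \<le> ennreal (1 ^ DIM('a)) * hausdorff_outer DIM('a) A"
    by (rule hausdorff_outer_lipschitz_image) (auto simp: dist)
  moreover have "hausdorff_outer DIM('a) (inv \<phi> ` \<phi> ` A) \<le> ennreal (1 ^ DIM('a)) * hausdorff_outer DIM('a) (\<phi> ` A)"
    using \<open>inj \<phi>\<close> by (intro hausdorff_outer_lipschitz_image) (auto simp: dist)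
  ultimately have "hausdorff_outer DIM('a) (\<phi> ` A) = hausdorff_outer DIM('a) A"
    using \<open>inj \<phi>\<close> by (simp add: image_inv_f_f)
  then show ?thesis
    using hausdorff_outer_eq_lborel[OF m] hausdorff_outer_eq_lborel[OF assms(4)] dim by simp
qed

lemma nn_integral_lborel_isometry:
  fixes \<phi> :: "'a::euclidean_space \<Rightarrow> 'b::euclidean_space"
  assumes "linear \<phi>" "\<And>x. norm (\<phi> x) = norm x" "surj \<phi>" and [measurable]: "h \<in> borel_measurable borel"
  shows "(\<integral>\<^sup>+x. h x \<partial>lborel) = (\<integral>\<^sup>+x. h (\<phi> x) \<partial>lborel)"
proof -
  have [measurable]: "\<phi> \<in> borel_measurable borel"
    using \<open>linear \<phi>\<close> by (rule linear_borel_measurable)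
  have "lborel = distr lborel borel \<phi>"
  proof (rule measure_eqI)
    fix B :: "'b set" assume "B \<in> sets lborel"
    then have [measurable]: "B \<in> sets borel" by simp
    have "\<phi> -` B \<in> sets borel" by (rule measurable_sets_borel[OF \<open>\<phi> \<in> borel_measurable borel\<close>]) measurable
    then have "emeasure lborel (\<phi> ` (\<phi> -` B)) = emeasure lborel (\<phi> -` B)"
      using assms by (intro emeasure_lborel_isometry) auto
    then show "emeasure lborel B = emeasure (distr lborel borel \<phi>) B"
      using \<open>surj \<phi>\<close> by (simp add: emeasure_distr surj_image_vimage_eq)
  qed simp
  then have "(\<integral>\<^sup>+x. h x \<partial>lborel) = (\<integral>\<^sup>+x. h x \<partial>distr lborel borel \<phi>)" by simp
  then show ?thesis by (simp add: nn_integral_distr)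
qed

text \<open>
  In the coordinate \<open>a\<close> alone, with all others fixed, the shear is a translation.
\<close>

lemma nn_integral_lborel_shear:
  fixes a b :: "'a::euclidean_space"
  assumes "a \<in> Basis" "b \<in> Basis" "a \<noteq> b" and [measurable]: "h \<in> borel_measurable borel"
  shows "(\<integral>\<^sup>+x. h (x + (x \<bullet> b) *\<^sub>R a) \<partial>lborel) = (\<integral>\<^sup>+x. h x \<partial>lborel)"
proof -
  let ?P = "\<lambda>I. \<Pi>\<^sub>M b\<in>I. (lborel :: real measure)"
  define \<Phi> :: "('a \<Rightarrow> real) \<Rightarrow> 'a" where "\<Phi> x = (\<Sum>b\<in>Basis. x b *\<^sub>R b)" for x
  interpret product_sigma_finite "\<lambda>_::'a. lborel :: real measure" ..
  have Phi[measurable]: "\<Phi> \<in> measurable (?P Basis) borel"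
    unfolding \<Phi>_def by measurable
  have ins: "insert a (Basis - {a}) = Basis" using assms(1) by auto
  have fubini: "(\<integral>\<^sup>+x. u x \<partial>lborel) = (\<integral>\<^sup>+x. (\<integral>\<^sup>+y. u (\<Phi> (x(a := y))) \<partial>lborel) \<partial>?P (Basis - {a}))"
    if [measurable]: "u \<in> borel_measurable borel" for u :: "'a \<Rightarrow> ennreal"
  proof -
    have "(\<integral>\<^sup>+x. u x \<partial>lborel) = (\<integral>\<^sup>+x. u (\<Phi> x) \<partial>?P Basis)"
      by (subst lborel_eq) (simp add: nn_integral_distr \<Phi>_def[symmetric, abs_def])
    also have "\<dots> = (\<integral>\<^sup>+x. u (\<Phi> x) \<partial>?P (insert a (Basis - {a})))"
      by (simp only: ins)
    also have "\<dots> = (\<integral>\<^sup>+x. (\<integral>\<^sup>+y. u (\<Phi> (x(a := y))) \<partial>lborel) \<partial>?P (Basis - {a}))"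
      by (rule product_nn_integral_insert) (simp, simp, unfold ins, measurable)
    finally show ?thesis .
  qed
  have "(\<integral>\<^sup>+x. h (x + (x \<bullet> b) *\<^sub>R a) \<partial>lborel)
      = (\<integral>\<^sup>+x. (\<integral>\<^sup>+y. h (\<Phi> (x(a := y)) + (\<Phi> (x(a := y)) \<bullet> b) *\<^sub>R a) \<partial>lborel) \<partial>?P (Basis - {a}))"
    by (rule fubini) measurable
  also have "\<dots> = (\<integral>\<^sup>+x. (\<integral>\<^sup>+y. h (\<Phi> (x(a := y))) \<partial>lborel) \<partial>?P (Basis - {a}))"
  proof (rule nn_integral_cong)
    fix x assume x: "x \<in> space (?P (Basis - {a}))"
    have shift: "\<Phi> (x(a := y)) + (\<Phi> (x(a := y)) \<bullet> b) *\<^sub>R a = \<Phi> (x(a := x b + 1 * y))" for y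
    proof -
      have "\<Phi> (x(a := y)) \<bullet> b = x b"
        using assms inner_sum_left_Basis[of b "x(a := y)"] unfolding \<Phi>_def by simp
      moreover have "\<Phi> (x(a := z)) = (\<Sum>b\<in>Basis - {a}. x b *\<^sub>R b) + z *\<^sub>R a" for z
        unfolding \<Phi>_def by (subst sum.remove[OF _ assms(1)]) (auto intro!: sum.cong)
      ultimately show ?thesis by (simp add: scaleR_add_left algebra_simps)
    qed
    have "(\<lambda>y. x(a := y)) \<in> measurable lborel (?P (insert a (Basis - {a})))"
      using x by (intro measurable_component_update) auto
    then have [measurable]: "(\<lambda>y. \<Phi> (x(a := y))) \<in> borel_measurable borel"
      unfolding ins using measurable_compose[OF _ Phi] by simp
    have "(\<integral>\<^sup>+y. h (\<Phi> (x(a := y))) \<partial>lborel) = ennreal \<bar>1\<bar> * (\<integral>\<^sup>+y. h (\<Phi> (x(a := x b + 1 * y))) \<partial>lborel)"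
      by (rule nn_integral_real_affine) auto
    then show "(\<integral>\<^sup>+y. h (\<Phi> (x(a := y)) + (\<Phi> (x(a := y)) \<bullet> b) *\<^sub>R a) \<partial>lborel) = (\<integral>\<^sup>+y. h (\<Phi> (x(a := y))) \<partial>lborel)"
      unfolding shift by simp
  qed
  also have "\<dots> = (\<integral>\<^sup>+x. h x \<partial>lborel)"
    by (rule fubini[symmetric]) measurable
  finally show ?thesis .
qed

lemma nn_integral_lborel_diagonal:
  fixes c :: "'n::finite \<Rightarrow> real"
  assumes c: "\<And>i. c i \<noteq> 0" and [measurable]: "h \<in> borel_measurable borel"
  shows "(\<integral>\<^sup>+x. h x \<partial>lborel) = ennreal \<bar>\<Prod>i\<in>UNIV. c i\<bar> * (\<integral>\<^sup>+x. h (\<chi> i. c i * x $ i) \<partial>lborel)"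
proof -
  let ?c = "\<lambda>b::real^'n. (\<chi> i. c i) \<bullet> b"
  have B: "(Basis :: (real^'n) set) = (\<lambda>i. axis i 1) ` UNIV" by (auto simp: Basis_vec_def)
  have inj: "inj (\<lambda>i. axis i 1 :: real^'n)" by (auto intro!: injI simp: axis_eq_axis)
  have "lborel = density (distr lborel borel (\<lambda>x::real^'n. 0 + (\<Sum>j\<in>Basis. (?c j * (x \<bullet> j)) *\<^sub>R j))) (\<lambda>_. (\<Prod>j\<in>Basis. \<bar>?c j\<bar>))"
    by (rule lborel_affine_euclidean) (auto simp: Basis_vec_def inner_axis c)
  also have "(\<lambda>x::real^'n. 0 + (\<Sum>j\<in>Basis. (?c j * (x \<bullet> j)) *\<^sub>R j)) = (\<lambda>x. \<chi> i. c i * x $ i)"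
    unfolding B sum.reindex[OF inj] comp_def inner_axis fun_eq_iff vec_eq_iff
    by (simp add: axis_def if_distrib sum.If_cases cong: if_cong)
  also have "(\<Prod>j\<in>Basis. \<bar>?c j\<bar>) = \<bar>\<Prod>i\<in>UNIV. c i\<bar>"
    by (simp add: B prod.reindex[OF inj] inner_axis abs_prod)
  finally have eq: "lborel = density (distr lborel borel (\<lambda>x. \<chi> i. c i * x $ i)) (\<lambda>_. ennreal \<bar>\<Prod>i\<in>UNIV. c i\<bar>)" .
  have [measurable]: "(\<lambda>x. \<chi> i. c i * x $ i) \<in> borel_measurable (borel :: (real^'n) measure)"
    by (intro borel_measurable_continuous_onI continuous_intros)
  have "(\<integral>\<^sup>+x. h x \<partial>lborel) = (\<integral>\<^sup>+x. h x \<partial>density (distr lborel borel (\<lambda>x. \<chi> i. c i * x $ i)) (\<lambda>_. ennreal \<bar>\<Prod>i\<in>UNIV. c i\<bar>))"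
    by (subst eq) (rule refl)
  then show ?thesis
    by (simp add: nn_integral_density nn_integral_cmult nn_integral_distr)
qed

text \<open>
  Every linear map is a composition of diagonal maps, transpositions of coordinates, shears, and maps
  with a vanishing coordinate; the last are excluded by the determinant.
\<close>

theorem nn_integral_lborel_linear:
  fixes T :: "real^'n::finite \<Rightarrow> real^'n"
  assumes T: "linear T" "det (matrix T) \<noteq> 0" "h \<in> borel_measurable borel"
  shows "(\<integral>\<^sup>+x. h x \<partial>lborel) = ennreal \<bar>det (matrix T)\<bar> * (\<integral>\<^sup>+x. h (T x) \<partial>lborel)"
proof -
  define Q :: "(real^'n \<Rightarrow> real^'n) \<Rightarrow> bool" where
    "Q T \<longleftrightarrow> (det (matrix T) \<noteq> 0 \<longrightarrow> (\<forall>h\<in>borel_measurable borel.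
      (\<integral>\<^sup>+x. h x \<partial>lborel) = ennreal \<bar>det (matrix T)\<bar> * (\<integral>\<^sup>+x. h (T x) \<partial>lborel)))" for T
  have "Q T"
  proof (rule induct_linear_elementary[where P=Q, OF T(1)])
    fix f g :: "real^'n \<Rightarrow> real^'n"
    assume lin: "linear f" "linear g" and Q: "Q f" "Q g"
    have det: "det (matrix (f \<circ> g)) = det (matrix f) * det (matrix g)"
      by (simp only: matrix_compose[OF lin(2,1)] det_mul)
    have [measurable]: "f \<in> borel_measurable borel"
      using lin(1) by (rule linear_borel_measurable)
    show "Q (f \<circ> g)"
      unfolding Q_def
    proof (intro impI ballI)
      fix h :: "real^'n \<Rightarrow> ennreal" assume nz: "det (matrix (f \<circ> g)) \<noteq> 0" and [measurable]: "h \<in> borel_measurable borel"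
      have nz': "det (matrix f) \<noteq> 0" "det (matrix g) \<noteq> 0" using nz det by auto
      have "(\<integral>\<^sup>+x. h x \<partial>lborel) = ennreal \<bar>det (matrix f)\<bar> * (\<integral>\<^sup>+x. h (f x) \<partial>lborel)"
        using Q(1)[unfolded Q_def, THEN mp, OF nz'(1)] by (rule bspec) measurable
      also have "(\<integral>\<^sup>+x. h (f x) \<partial>lborel) = ennreal \<bar>det (matrix g)\<bar> * (\<integral>\<^sup>+x. h (f (g x)) \<partial>lborel)"
        using Q(2)[unfolded Q_def, THEN mp, OF nz'(2)] by (rule bspec) measurable
      finally show "(\<integral>\<^sup>+x. h x \<partial>lborel) = ennreal \<bar>det (matrix (f \<circ> g))\<bar> * (\<integral>\<^sup>+x. h ((f \<circ> g) x) \<partial>lborel)"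
        by (simp add: det abs_mult ennreal_mult mult.assoc)
    qed
  next
    fix f :: "real^'n \<Rightarrow> real^'n" and i
    assume "linear f" "\<And>x. f x $ i = 0"
    then have "row i (matrix f) = 0" by (simp add: row_def matrix_def vec_eq_iff)
    then show "Q f" by (simp add: Q_def det_zero_row)
  next
    fix c :: "'n \<Rightarrow> real"
    have "matrix (\<lambda>x. \<chi> i. c i * x $ i) = (\<chi> i j. if i = j then c i else 0)"
      by (simp add: matrix_def vec_eq_iff axis_def)
    then have det: "det (matrix (\<lambda>x. \<chi> i. c i * x $ i)) = (\<Prod>i\<in>UNIV. c i)"
      by (simp add: det_diagonal)
    show "Q (\<lambda>x. \<chi> i. c i * x $ i)"
      unfolding Q_def det using nn_integral_lborel_diagonal[of c] by (intro impI ballI) simp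
  next
    fix m n :: 'n assume "m \<noteq> n"
    let ?S = "\<lambda>x::real^'n. \<chi> i. x $ Transposition.transpose m n i"
    have lin: "linear ?S" by (rule linearI) (auto simp: vec_eq_iff)
    have norm: "norm (?S x) = norm x" for x
      unfolding norm_vec_def L2_set_def
      by (intro arg_cong[where f=sqrt]) (simp, rule sum.permute[symmetric, unfolded comp_def], simp add: permutes_swap_id)
    have inv: "?S (?S x) = x" for x by (simp add: vec_eq_iff)
    have "orthogonal_transformation ?S" using lin norm by (simp add: orthogonal_transformation)
    then have det: "\<bar>det (matrix ?S)\<bar> = 1" by (simp add: orthogonal_transformation_det)
    have "surj ?S" by (rule surjI[where g="?S" and f="?S", OF inv])
    then show "Q ?S"
      unfolding Q_def det using nn_integral_lborel_isometry[OF lin norm] by simp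
  next
    fix m n :: 'n assume mn: "m \<noteq> n"
    let ?S = "\<lambda>x::real^'n. \<chi> i. if i = m then x $ m + x $ n else x $ i"
    have "matrix ?S = (\<chi> k. if k = m then row m (mat 1) + 1 *s row n (mat 1) else row k (mat 1))"
      by (auto simp: matrix_def vec_eq_iff row_def mat_def axis_def)
    then have det: "det (matrix ?S) = 1"
      using det_row_operation[OF mn, of "mat 1 :: real^'n^'n" 1] by simp
    have S: "?S x = x + (x \<bullet> axis n 1) *\<^sub>R axis m 1" for x
      by (auto simp: vec_eq_iff inner_axis) (auto simp: axis_def)
    show "Q ?S"
      unfolding Q_def S det[unfolded S] using mn by (simp add: nn_integral_lborel_shear axis_eq_axis)
  qed
  then show ?thesis unfolding Q_def using T(2,3) by blast
qed

corollary emeasure_lborel_linear_image: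
  fixes T :: "real^'n::finite \<Rightarrow> real^'n"
  assumes "linear T" "det (matrix T) \<noteq> 0" "A \<in> sets borel"
  shows "emeasure lborel (T ` A) = ennreal \<bar>det (matrix T)\<bar> * emeasure lborel A"
proof -
  have "bij T" using assms(1,2) by (metis bijI det_nz_iff_inj linear_injective_imp_surjective)
  then have [measurable]: "T ` A \<in> sets borel" using assms by (intro linear_image_in_borel)
  have "(\<integral>\<^sup>+x. indicator (T ` A) x \<partial>lborel) = ennreal \<bar>det (matrix T)\<bar> * (\<integral>\<^sup>+x. indicator (T ` A) (T x) \<partial>lborel)"
    using assms by (intro nn_integral_lborel_linear) auto
  also have "(\<lambda>x. indicator (T ` A) (T x)) = (indicator A :: _ \<Rightarrow> ennreal)"
    using \<open>bij T\<close> by (auto simp: indicator_def fun_eq_iff bij_def inj_image_mem_iff)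
  finally show ?thesis using assms(3) by simp
qed

text \<open>
  The volume distortion \<open>c\<close> of an injective linear map \<open>L\<close> into a space of possibly larger dimension. It is
  measured by a linear map \<open>T\<close> of the source space that stretches every vector as \<open>L\<close> does: \<open>L\<close> is then
  \<open>T\<close> followed by an isometry onto the range of \<open>L\<close>. Jacobians of surfaces and Jacobians of the whole map
  are both instances.
\<close>

definition scales_volume :: "('a::euclidean_space \<Rightarrow> 'b::euclidean_space) \<Rightarrow> real \<Rightarrow> bool" where
  "scales_volume L c \<longleftrightarrow> (\<exists>T :: 'a \<Rightarrow> 'a. linear T \<and> (\<forall>v. norm (T v) = norm (L v)) \<and>
    (\<forall>A\<in>sets borel. emeasure lborel (T ` A) = ennreal c * emeasure lborel A))"

lemma linear_norm_eq_imp_inner_eq: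
  fixes L :: "'a::real_vector \<Rightarrow> 'b::real_inner" and T :: "'a \<Rightarrow> 'c::real_inner"
  assumes "linear L" "linear T" "\<And>v. norm (T v) = norm (L v)"
  shows "T u \<bullet> T v = L u \<bullet> L v"
  using assms(3)[of "u + v"] assms(3)[of u] assms(3)[of v] assms(1,2)
  by (simp add: dot_norm linear_add)

text \<open>
  \<open>T\<close> is \<open>L\<close> followed by an isometry from the range of \<open>L\<close> onto the source space. The two have the same
  Gram matrix, and the Gram determinant of the square matrix of \<open>T\<close> is the square of its determinant.
\<close>

lemma scales_volume_gram_det:
  fixes L :: "real^'m::finite \<Rightarrow> real^'n::finite"
  assumes "linear L" "inj L"
  defines "G \<equiv> transpose (matrix L) ** matrix L"
  shows "scales_volume L (sqrt (det G))" and "0 < sqrt (det G)"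
proof -
  have "dim (range L) = dim (UNIV :: (real^'m) set)"
    using assms by (intro dim_image_eq) auto
  then obtain f :: "real^'n \<Rightarrow> real^'m" where f: "linear f" "\<And>x. x \<in> range L \<Longrightarrow> norm (f x) = norm x"
    using isometry_subspaces[of "range L" "UNIV :: (real^'m) set"] \<open>linear L\<close>
    by (metis linear_subspace_image subspace_UNIV)
  define T where "T = f \<circ> L"
  have T: "linear T" "norm (T v) = norm (L v)" for v
    using f \<open>linear L\<close> by (auto simp: T_def linear_compose)
  have "inj T"
  proof (rule injI)
    fix x y assume "T x = T y"
    then have "norm (T (x - y)) = 0" using T(1) by (simp add: linear_diff)
    then show "x = y" using T(2)[of "x - y"] assms by (simp add: linear_diff injD)
  qed
  then have nz: "det (matrix T) \<noteq> 0" using T(1) by (simp add: det_nz_iff_inj)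
  have entry: "(transpose (matrix S) ** matrix S) $ i $ j = S (axis i 1) \<bullet> S (axis j 1)"
    for S :: "real^'m \<Rightarrow> real^'p::finite" and i j
    by (simp add: matrix_matrix_mult_def transpose_def matrix_def inner_vec_def)
  have "transpose (matrix T) ** matrix T = G"
    unfolding G_def vec_eq_iff entry using linear_norm_eq_imp_inner_eq[OF \<open>linear L\<close> T] by simp
  then have "det G = (det (matrix T))\<^sup>2"
    by (metis det_mul det_transpose power2_eq_square)
  then have sq: "sqrt (det G) = \<bar>det (matrix T)\<bar>" by simp
  show "0 < sqrt (det G)" using nz sq by simp
  show "scales_volume L (sqrt (det G))"
    unfolding scales_volume_def sq
    using T emeasure_lborel_linear_image[OF T(1) nz] by (intro exI[of _ T]) auto
qed

text \<open>
  Source and target have the same dimension but different types. Reading a vector indexed by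
  \<^typ>\<open>'k + 'm\<close> as a pair is an isometry \<open>\<psi>\<close> that maps the basis to the vectors whose images are the
  columns of \<open>M\<close>.
\<close>

lemma scales_volume_square:
  fixes L :: "(real^'k::finite) \<times> (real^'m::finite) \<Rightarrow> real^('k + 'm)"
  assumes "linear L" "inj L"
  defines "M \<equiv> \<chi> i j. L (case j of Inl a \<Rightarrow> (axis a 1, 0) | Inr b \<Rightarrow> (0, axis b 1)) $ i"
  shows "scales_volume L \<bar>det M\<bar>" and "det M \<noteq> 0"
proof -
  define \<psi> :: "real^('k + 'm) \<Rightarrow> (real^'k) \<times> (real^'m)" where
    "\<psi> x = (\<chi> a. x $ Inl a, \<chi> b. x $ Inr b)" for x
  define \<psi>' :: "(real^'k) \<times> (real^'m) \<Rightarrow> real^('k + 'm)" where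
    "\<psi>' z = (\<chi> j. case j of Inl a \<Rightarrow> fst z $ a | Inr b \<Rightarrow> snd z $ b)" for z
  have inv: "\<psi> (\<psi>' z) = z" "\<psi>' (\<psi> x) = x" for z x
    by (auto simp: \<psi>_def \<psi>'_def vec_eq_iff prod_eq_iff split: sum.splits)
  have lin: "linear \<psi>"
    by (rule linearI) (auto simp: \<psi>_def vec_eq_iff)
  have lin': "linear \<psi>'"
    by (rule linearI) (auto simp: \<psi>'_def vec_eq_iff split: sum.splits)
  have norm: "norm (\<psi> x) = norm x" for x
    by (simp add: \<psi>_def norm_Pair norm_vec_def L2_set_def sum_nonneg UNIV_Plus_UNIV[symmetric] sum.Plus del: UNIV_Plus_UNIV)
  have norm': "norm (\<psi>' z) = norm z" for z
    using norm[of "\<psi>' z"] inv by simp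
  have bij: "surj \<psi>" "surj \<psi>'" "bij \<psi>'" "bij \<psi>"
    using inv by (metis surjI, metis surjI, metis bijI' inv, metis bijI' inv)
  have linL: "linear (L \<circ> \<psi>)" using lin \<open>linear L\<close> by (rule linear_compose)
  have M: "matrix (L \<circ> \<psi>) = M"
  proof -
    have "\<psi> (axis j 1) = (case j of Inl a \<Rightarrow> (axis a 1, 0) | Inr b \<Rightarrow> (0, axis b 1))" for j
      by (auto simp: \<psi>_def axis_def vec_eq_iff split: sum.splits)
    then show ?thesis by (simp add: matrix_def M_def)
  qed
  have "inj (L \<circ> \<psi>)" using \<open>inj L\<close> bij(4) by (simp add: inj_compose bij_is_inj)
  then show nz: "det M \<noteq> 0" using linL M by (metis det_nz_iff_inj)
  have "bij (L \<circ> \<psi>)" using \<open>inj (L \<circ> \<psi>)\<close> linL by (metis bijI linear_injective_imp_surjective)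
  have "emeasure lborel ((\<psi> \<circ> L) ` A) = ennreal \<bar>det M\<bar> * emeasure lborel A" if "A \<in> sets borel" for A
  proof -
    have m: "\<psi>' ` A \<in> sets borel" using lin' bij that by (intro linear_image_in_borel)
    have img: "L ` A = (L \<circ> \<psi>) ` (\<psi>' ` A)" by (simp add: image_comp comp_def inv)
    have "L ` A \<in> sets borel"
      unfolding img using linL \<open>bij (L \<circ> \<psi>)\<close> m by (rule linear_image_in_borel)
    then have "emeasure lborel ((\<psi> \<circ> L) ` A) = emeasure lborel (L ` A)"
      using emeasure_lborel_isometry[OF lin norm bij(1), of "L ` A"] by (simp add: image_comp)
    also have "\<dots> = ennreal \<bar>det M\<bar> * emeasure lborel (\<psi>' ` A)"
      unfolding img using emeasure_lborel_linear_image[OF linL _ m] nz M by simp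
    also have "emeasure lborel (\<psi>' ` A) = emeasure lborel A"
      using emeasure_lborel_isometry[OF lin' norm' bij(2) that] .
    finally show ?thesis .
  qed
  then show "scales_volume L \<bar>det M\<bar>"
    unfolding scales_volume_def using lin \<open>linear L\<close> norm
    by (intro exI[of _ "\<psi> \<circ> L"]) (auto intro: linear_compose)
qed

section \<open>The area formula\<close>

abbreviation weighted_volume :: "('a::euclidean_space \<Rightarrow> real) \<Rightarrow> 'a set \<Rightarrow> ennreal" where
  "weighted_volume J A \<equiv> (\<integral>\<^sup>+y\<in>A. ennreal (J y) \<partial>lborel)"

lemma ennreal_le_of_le_all_factors:
  fixes a b :: ennreal
  assumes "\<And>K. 1 < K \<Longrightarrow> a \<le> ennreal K * b"
  shows "a \<le> b"
proof (cases b)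
  case (real r)
  show ?thesis
  proof (rule ennreal_le_epsilon)
    fix e :: real assume "0 < e"
    define K where "K = 1 + e / (r + 1)"
    have "1 < K" using \<open>0 < e\<close> real by (simp add: K_def)
    have "K * r \<le> r + e"
      using \<open>0 < e\<close> real by (simp add: K_def field_simps)
    have "a \<le> ennreal K * b" by (rule assms) fact
    also have "\<dots> = ennreal (K * r)" using real \<open>1 < K\<close> by (simp add: ennreal_mult)
    also have "\<dots> \<le> ennreal (r + e)" by (rule ennreal_leI) fact
    finally show "a \<le> b + ennreal e" using real \<open>0 < e\<close> by simp
  qed
qed simp

text \<open>
  On a small ball the derivative of \<open>g\<close> differs from that at the centre by less than a small multiple \<open>\<eta>\<close>
  of the smallest stretching of \<open>T\<close>. By the mean value inequality for \<open>g\<close> minus its linear part,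
  distances between values of \<open>g\<close> and of \<open>T\<close> then agree up to factors \<open>1 \<plusminus> \<eta>\<close>.
\<close>

lemma near_linear_bilipschitz:
  fixes g :: "'a::euclidean_space \<Rightarrow> 'b::euclidean_space" and g' :: "'a \<Rightarrow> 'a \<Rightarrow>\<^sub>L 'b"
    and T :: "'a \<Rightarrow> 'a"
  assumes "open V" "y0 \<in> V" "1 < L"
    and deriv: "\<And>y. y \<in> V \<Longrightarrow> (g has_derivative blinfun_apply (g' y)) (at y)"
    and cont: "continuous_on V g'"
    and T: "linear T" "inj T" "\<And>v. norm (T v) = norm (g' y0 v)"
  shows "\<exists>r>0. ball y0 r \<subseteq> V \<and> (\<forall>x\<in>ball y0 r. \<forall>y\<in>ball y0 r.
    dist (g x) (g y) \<le> L * dist (T x) (T y) \<and> dist (T x) (T y) \<le> L * dist (g x) (g y))"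
proof -
  obtain c where c: "c > 0" "\<And>v. c * norm v \<le> norm (T v)"
    using linear_inj_bounded_below_pos[OF T(1,2)] by blast
  \<comment> \<open>With this choice \<open>1 - \<eta> = 1 / L\<close> and \<open>1 + \<eta> \<le> L\<close>, so \<open>L\<close> bounds both factors.\<close>
  define \<eta> where "\<eta> = 1 - 1 / L"
  have eta: "0 < \<eta>" "1 + \<eta> \<le> L" "L * (1 - \<eta>) = 1"
  proof -
    show "0 < \<eta>" "L * (1 - \<eta>) = 1" using \<open>1 < L\<close> by (auto simp: \<eta>_def)
    have "0 \<le> (L - 1)\<^sup>2 / L" using \<open>1 < L\<close> by simp
    also have "(L - 1)\<^sup>2 / L = L - (1 + \<eta>)"
      using \<open>1 < L\<close> by (simp add: \<eta>_def power2_eq_square field_simps)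
    finally show "1 + \<eta> \<le> L" by simp
  qed
  have "0 < \<eta> * c" using eta c by simp
  then obtain d where d: "d > 0" "\<And>y. y \<in> V \<Longrightarrow> dist y y0 < d \<Longrightarrow> dist (g' y) (g' y0) < \<eta> * c"
    using cont \<open>y0 \<in> V\<close> unfolding continuous_on_iff by blast
  obtain r0 where r0: "r0 > 0" "ball y0 r0 \<subseteq> V"
    using \<open>open V\<close> \<open>y0 \<in> V\<close> open_contains_ball by blast
  define r where "r = min d r0"
  have r: "r > 0" "ball y0 r \<subseteq> V" "\<And>y. y \<in> ball y0 r \<Longrightarrow> norm (g' y - g' y0) \<le> \<eta> * c"
  proof -
    show "r > 0" using d r0 by (simp add: r_def)
    have "ball y0 r \<subseteq> ball y0 r0" unfolding r_def by (rule subset_ball) simp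
    then show V: "ball y0 r \<subseteq> V" using r0(2) by (rule order_trans)
    fix y assume y: "y \<in> ball y0 r"
    then have "y \<in> V" using V by (rule subsetD[rotated])
    moreover have "dist y y0 < d" using y by (simp add: r_def dist_commute)
    ultimately show "norm (g' y - g' y0) \<le> \<eta> * c"
      using d(2) unfolding dist_norm by fastforce
  qed
  have close: "norm ((g x - g y) - g' y0 (x - y)) \<le> \<eta> * norm (T (x - y))"
    if xy: "x \<in> ball y0 r" "y \<in> ball y0 r" for x y
  proof -
    have "norm ((g x - g' y0 x) - (g y - g' y0 y)) \<le> \<eta> * c * norm (x - y)"
    proof (rule differentiable_bound[OF convex_ball, where f'="\<lambda>y. blinfun_apply (g' y - g' y0)"])
      fix z assume z: "z \<in> ball y0 r"
      have "(g has_derivative blinfun_apply (g' z)) (at z within ball y0 r)"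
        using deriv z r(2) by (meson has_derivative_at_withinI subsetD)
      then have "((\<lambda>z. g z - g' y0 z) has_derivative (\<lambda>v. g' z v - g' y0 v)) (at z within ball y0 r)"
        by (intro has_derivative_diff) (auto intro: bounded_linear_imp_has_derivative blinfun.bounded_linear_right)
      then show "((\<lambda>z. g z - g' y0 z) has_derivative blinfun_apply (g' z - g' y0)) (at z within ball y0 r)"
        by (simp add: blinfun.diff_left[abs_def])
      show "onorm (blinfun_apply (g' z - g' y0)) \<le> \<eta> * c"
        using r(3)[OF z] by (simp add: norm_blinfun.rep_eq)
    qed (use xy in auto)
    also have "\<dots> \<le> \<eta> * norm (T (x - y))"
      using c(2)[of "x - y"] eta by (simp add: mult.assoc)
    finally show ?thesis by (simp add: blinfun.diff_right algebra_simps)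
  qed
  have bi: "dist (g x) (g y) \<le> L * dist (T x) (T y) \<and> dist (T x) (T y) \<le> L * dist (g x) (g y)"
    if xy: "x \<in> ball y0 r" "y \<in> ball y0 r" for x y
  proof
    let ?t = "norm (T (x - y))"
    have t: "dist (T x) (T y) = ?t" using T(1) by (simp add: dist_norm linear_diff)
    have n: "norm (g' y0 (x - y)) = ?t" using T(3) by simp
    note cl = close[OF xy]
    have "norm (g x - g y) \<le> norm (g' y0 (x - y)) + norm ((g x - g y) - g' y0 (x - y))"
      by (rule norm_triangle_sub)
    also have "\<dots> \<le> (1 + \<eta>) * ?t" using cl n by (simp add: algebra_simps)
    also have "\<dots> \<le> L * ?t" using eta by (intro mult_right_mono) auto
    finally show "dist (g x) (g y) \<le> L * dist (T x) (T y)" unfolding t by (simp add: dist_norm)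
    have "?t \<le> norm (g x - g y) + norm (g' y0 (x - y) - (g x - g y))"
      unfolding n[symmetric] by (rule norm_triangle_sub)
    then have "(1 - \<eta>) * ?t \<le> norm (g x - g y)"
      using cl by (simp add: norm_minus_commute algebra_simps)
    then have "L * ((1 - \<eta>) * ?t) \<le> L * norm (g x - g y)"
      using \<open>1 < L\<close> by (intro mult_left_mono) auto
    then show "dist (T x) (T y) \<le> L * dist (g x) (g y)"
      unfolding t mult.assoc[symmetric] eta(3) by (simp add: dist_norm)
  qed
  show ?thesis using r(1,2) bi by blast
qed

text \<open>
  On a small ball \<open>g\<close> and \<open>T\<close> are bi-Lipschitz images of each other with constant \<open>L\<close>, which changes
  Hausdorff measure by at most \<open>L\<close> to the power of the dimension; a further factor \<open>L\<close> pays for replacing \<open>J\<close>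
  by its value at the centre. For \<open>T\<close> the formula is the volume distortion of a linear map.
\<close>

lemma area_formula_local:
  fixes g :: "'a::euclidean_space \<Rightarrow> 'b::euclidean_space" and g' :: "'a \<Rightarrow> 'a \<Rightarrow>\<^sub>L 'b"
  assumes "open V" "y0 \<in> V" "1 < K"
    and deriv: "\<And>y. y \<in> V \<Longrightarrow> (g has_derivative blinfun_apply (g' y)) (at y)"
    and cont: "continuous_on V g'" and contJ: "continuous_on V J"
    and "inj (blinfun_apply (g' y0))" "0 < J y0" and sv: "scales_volume (blinfun_apply (g' y0)) (J y0)"
  shows "\<exists>r>0. ball y0 r \<subseteq> V \<and> (\<forall>A\<in>sets borel. A \<subseteq> ball y0 r \<longrightarrow>
    hausdorff_outer DIM('a) (g ` A) \<le> ennreal K * weighted_volume J A \<and>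
    weighted_volume J A \<le> ennreal K * hausdorff_outer DIM('a) (g ` A))"
proof -
  let ?m = "DIM('a)"
  \<comment> \<open>One factor \<open>L\<close> for each dimension and one for the oscillation of \<open>J\<close>.\<close>
  define L where "L = root (Suc ?m) K"
  have L: "1 < L" "L * L ^ ?m = K"
    using \<open>1 < K\<close> real_root_pow_pos2[of "Suc ?m" K] by (simp_all add: L_def)
  obtain T :: "'a \<Rightarrow> 'a" where T: "linear T" "\<And>v. norm (T v) = norm (g' y0 v)"
    "\<And>A. A \<in> sets borel \<Longrightarrow> emeasure lborel (T ` A) = ennreal (J y0) * emeasure lborel A"
    using sv unfolding scales_volume_def by blast
  have "inj T"
  proof (rule injI)
    fix x y assume "T x = T y"
    then have "norm (g' y0 (x - y)) = 0" using T(1) by (simp add: linear_diff T(2)[symmetric])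
    then have "g' y0 x = g' y0 y" by (simp add: blinfun.diff_right)
    then show "x = y" using \<open>inj (blinfun_apply (g' y0))\<close> by (simp add: inj_eq)
  qed
  then have "bij T" using T(1) linear_injective_imp_surjective by (auto simp: bij_def)
  obtain r1 where r1: "r1 > 0" "ball y0 r1 \<subseteq> V"
    and bi: "\<And>x y. x \<in> ball y0 r1 \<Longrightarrow> y \<in> ball y0 r1 \<Longrightarrow>
      dist (g x) (g y) \<le> L * dist (T x) (T y) \<and> dist (T x) (T y) \<le> L * dist (g x) (g y)"
    using near_linear_bilipschitz[OF assms(1,2) L(1) deriv cont T(1) \<open>inj T\<close> T(2)] by blast
  have "0 < (1 - 1 / L) * J y0" using L \<open>0 < J y0\<close> by simp
  then obtain d where d: "d > 0" "\<And>y. y \<in> V \<Longrightarrow> dist y y0 < d \<Longrightarrow> dist (J y) (J y0) < (1 - 1 / L) * J y0"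
    using contJ \<open>y0 \<in> V\<close> unfolding continuous_on_iff by blast
  define r where "r = min d r1"
  have sub: "ball y0 r \<subseteq> ball y0 r1" unfolding r_def by (rule subset_ball) simp
  have Jb: "J y \<le> L * J y0" "J y0 \<le> L * J y" "0 \<le> J y" if y: "y \<in> ball y0 r" for y
  proof -
    have "y \<in> V" "dist y y0 < d" using y r1(2) by (auto simp: r_def dist_commute)
    then have a: "\<bar>J y - J y0\<bar> < (1 - 1 / L) * J y0" using d(2) by (simp add: dist_real_def)
    then have lo: "J y0 / L < J y" by (simp add: algebra_simps)
    then show "J y0 \<le> L * J y" using L by (simp add: field_simps)
    have "0 \<le> J y0 / L" using L \<open>0 < J y0\<close> by simp
    then show "0 \<le> J y" using lo by linarith
    have "2 - 1 / L \<le> L"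
    proof -
      have "0 \<le> (L - 1)\<^sup>2 / L" using L by simp
      also have "(L - 1)\<^sup>2 / L = L - (2 - 1 / L)"
        using L by (simp add: power2_eq_square field_simps)
      finally show ?thesis by simp
    qed
    then have "(2 - 1 / L) * J y0 \<le> L * J y0" using \<open>0 < J y0\<close> by (intro mult_right_mono) auto
    moreover have "J y \<le> (2 - 1 / L) * J y0" using a by (simp add: algebra_simps)
    ultimately show "J y \<le> L * J y0" by linarith
  qed
  have main: "hausdorff_outer ?m (g ` A) \<le> ennreal K * weighted_volume J A \<and>
      weighted_volume J A \<le> ennreal K * hausdorff_outer ?m (g ` A)"
    if A: "A \<in> sets borel" "A \<subseteq> ball y0 r" for A
  proof
    have A1: "A \<subseteq> ball y0 r1" using A(2) sub by (rule order_trans)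
    have biA: "dist (g x) (g y) \<le> L * dist (T x) (T y)" "dist (T x) (T y) \<le> L * dist (g x) (g y)"
      if "x \<in> A" "y \<in> A" for x y
      using bi[OF subsetD[OF A1 that(1)] subsetD[OF A1 that(2)]] by auto
    have TA: "hausdorff_outer ?m (T ` A) = ennreal (J y0) * emeasure lborel A"
      using hausdorff_outer_eq_lborel[OF linear_image_in_borel[OF T(1) \<open>bij T\<close> A(1)]] T(3)[OF A(1)] by simp
    have inj: "inj_on g A"
    proof (rule inj_onI)
      fix x y assume "x \<in> A" "y \<in> A" "g x = g y"
      then have "dist (T x) (T y) \<le> 0" using biA(2)[of x y] by simp
      then show "x = y" using \<open>inj T\<close> by (simp add: inj_eq)
    qed
    have int: "(\<integral>\<^sup>+y\<in>A. ennreal c \<partial>lborel) = ennreal c * emeasure lborel A" for c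
      using A(1) by (simp add: nn_integral_cmult_indicator)
    have "hausdorff_outer ?m ((g \<circ> inv T) ` (T ` A)) \<le> ennreal (L ^ ?m) * hausdorff_outer ?m (T ` A)"
    proof (rule hausdorff_outer_lipschitz_image)
      fix u v assume "u \<in> T ` A" "v \<in> T ` A"
      then show "dist ((g \<circ> inv T) u) ((g \<circ> inv T) v) \<le> L * dist u v"
        using biA(1) \<open>inj T\<close> by (auto simp: inv_f_f)
    qed (use L in simp)
    also have "(g \<circ> inv T) ` (T ` A) = g ` A"
      unfolding image_comp[symmetric] image_inv_f_f[OF \<open>inj T\<close>] ..
    also have "ennreal (L ^ ?m) * hausdorff_outer ?m (T ` A) = ennreal (L ^ ?m) * (\<integral>\<^sup>+y\<in>A. ennreal (J y0) \<partial>lborel)"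
      unfolding TA int ..
    also have "\<dots> \<le> ennreal (L ^ ?m) * (\<integral>\<^sup>+y\<in>A. ennreal L * ennreal (J y) \<partial>lborel)"
    proof (intro mult_left_mono nn_integral_mono)
      fix y
      have "ennreal (J y0) \<le> ennreal L * ennreal (J y)" if "y \<in> A"
      proof -
        have "y \<in> ball y0 r" using that A(2) by blast
        note Jb[OF this]
        then show ?thesis using L by (simp add: ennreal_mult[symmetric] ennreal_leI)
      qed
      then show "ennreal (J y0) * indicator A y \<le> ennreal L * ennreal (J y) * indicator A y"
        by (simp add: indicator_def)
    qed simp
    also have "(\<integral>\<^sup>+y\<in>A. ennreal L * ennreal (J y) \<partial>lborel) = ennreal L * weighted_volume J A"
    proof -
      have "continuous_on A J"
        by (rule continuous_on_subset[OF contJ]) (use A1 r1(2) in blast)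
      then have "(\<lambda>y. ennreal (indicator A y * J y)) \<in> borel_measurable lborel"
        using borel_measurable_continuous_on_indicator[OF A(1), of J] by simp
      also have "(\<lambda>y. ennreal (indicator A y * J y)) = (\<lambda>y. ennreal (J y) * indicator A y)"
        by (simp add: fun_eq_iff indicator_def)
      finally have "(\<lambda>y. ennreal (J y) * indicator A y) \<in> borel_measurable lborel" .
      then show ?thesis by (simp add: nn_integral_cmult mult.assoc)
    qed
    also have "ennreal (L ^ ?m) * (ennreal L * weighted_volume J A) = ennreal K * weighted_volume J A"
      using L by (simp add: mult.assoc[symmetric] ennreal_mult[symmetric] mult.commute)
    finally show "hausdorff_outer ?m (g ` A) \<le> ennreal K * weighted_volume J A" .
    have "weighted_volume J A \<le> (\<integral>\<^sup>+y\<in>A. ennreal (L * J y0) \<partial>lborel)"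
    proof (rule nn_integral_mono)
      fix y
      have "J y \<le> L * J y0" if "y \<in> A" using Jb(1) that A(2) by blast
      then show "ennreal (J y) * indicator A y \<le> ennreal (L * J y0) * indicator A y"
        by (simp add: indicator_def ennreal_leI)
    qed
    also have "\<dots> = ennreal L * hausdorff_outer ?m (T ` A)"
      unfolding TA int using L \<open>0 < J y0\<close> by (simp add: ennreal_mult mult.assoc)
    also have "hausdorff_outer ?m (T ` A) = hausdorff_outer ?m ((T \<circ> inv_into A g) ` (g ` A))"
      unfolding image_comp[symmetric] inv_into_image_cancel[OF inj subset_refl] ..
    also have "\<dots> \<le> ennreal (L ^ ?m) * hausdorff_outer ?m (g ` A)"
    proof (rule hausdorff_outer_lipschitz_image)
      fix u v assume "u \<in> g ` A" "v \<in> g ` A"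
      then show "dist ((T \<circ> inv_into A g) u) ((T \<circ> inv_into A g) v) \<le> L * dist u v"
        using biA(2) inj by (auto simp: inv_into_f_f)
    qed (use L in simp)
    also have "ennreal L * (ennreal (L ^ ?m) * hausdorff_outer ?m (g ` A)) = ennreal K * hausdorff_outer ?m (g ` A)"
      using L by (simp add: mult.assoc[symmetric] ennreal_mult[symmetric])
    finally show "weighted_volume J A \<le> ennreal K * hausdorff_outer ?m (g ` A)"
      by (simp add: mult_left_mono)
  qed
  have "0 < r" using d r1 by (simp add: r_def)
  moreover have "ball y0 r \<subseteq> V" using sub r1(2) by (rule order_trans)
  ultimately show ?thesis using main by blast
qed

text \<open>
  Countably many balls with the local estimate cover \<open>V\<close>. Cut \<open>A\<close> into disjoint pieces inside them; both
  sides of the formula are countably additive, so they agree up to the factor \<open>K\<close>, and \<open>K > 1\<close> is arbitrary.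
\<close>

lemma area_formula_set:
  fixes g :: "'a::euclidean_space \<Rightarrow> 'b::euclidean_space" and g' :: "'a \<Rightarrow> 'a \<Rightarrow>\<^sub>L 'b"
  assumes "open V" and inj: "inj_on g V"
    and deriv: "\<And>y. y \<in> V \<Longrightarrow> (g has_derivative blinfun_apply (g' y)) (at y)"
    and cont: "continuous_on V g'" and contJ: "continuous_on V J"
    and inj': "\<And>y. y \<in> V \<Longrightarrow> inj (blinfun_apply (g' y))" and J: "\<And>y. y \<in> V \<Longrightarrow> 0 < J y"
    and sv: "\<And>y. y \<in> V \<Longrightarrow> scales_volume (blinfun_apply (g' y)) (J y)"
    and image: "\<And>A. A \<in> sets borel \<Longrightarrow> A \<subseteq> V \<Longrightarrow> g ` A \<in> sets borel"
    and A: "A \<in> sets borel" "A \<subseteq> V"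
  shows "emeasure (hausdorff_measure DIM('a)) (g ` A) = weighted_volume J A"
proof -
  let ?H = "hausdorff_measure DIM('a) :: 'b measure"
  define N where "N = density lborel (\<lambda>y. ennreal (indicator V y * J y))"
  have J_meas [measurable]: "(\<lambda>y. ennreal (indicator V y * J y)) \<in> borel_measurable lborel"
    using borel_measurable_continuous_on_indicator[OF _ contJ] \<open>open V\<close> by (simp add: mult.commute)
  have N: "emeasure N X = weighted_volume J X" if "X \<in> sets borel" "X \<subseteq> V" for X
  proof -
    have "emeasure N X = (\<integral>\<^sup>+y. ennreal (indicator V y * J y) * indicator X y \<partial>lborel)"
      unfolding N_def using that(1) by (intro emeasure_density) auto
    also have "\<dots> = weighted_volume J X"
      using that(2) by (intro nn_integral_cong) (auto simp: indicator_def)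
    finally show ?thesis .
  qed
  have bounds: "emeasure ?H (g ` A) \<le> ennreal K * emeasure N A \<and> emeasure N A \<le> ennreal K * emeasure ?H (g ` A)"
    if "1 < K" for K
  proof -
    define good where "good B \<longleftrightarrow> open B \<and> (\<forall>X\<in>sets borel. X \<subseteq> V \<longrightarrow> X \<subseteq> B \<longrightarrow>
      emeasure ?H (g ` X) \<le> ennreal K * emeasure N X \<and> emeasure N X \<le> ennreal K * emeasure ?H (g ` X))" for B
    have ex: "\<exists>B. good B \<and> y \<in> B" if y: "y \<in> V" for y
    proof -
      obtain r where r: "r > 0" "\<forall>X\<in>sets borel. X \<subseteq> ball y r \<longrightarrow>
          hausdorff_outer DIM('a) (g ` X) \<le> ennreal K * weighted_volume J X \<and>
          weighted_volume J X \<le> ennreal K * hausdorff_outer DIM('a) (g ` X)"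
        using area_formula_local[OF \<open>open V\<close> y \<open>1 < K\<close> deriv cont contJ inj'[OF y] J[OF y] sv[OF y]] by blast
      have "good (ball y r)"
        unfolding good_def
      proof (intro conjI ballI impI)
        fix X :: "'a set" assume X: "X \<in> sets borel" "X \<subseteq> V" "X \<subseteq> ball y r"
        note * = r(2)[rule_format, OF X(1,3)] emeasure_hausdorff_measure[OF image[OF X(1,2)], of "DIM('a)"] N[OF X(1,2)]
        show "emeasure ?H (g ` X) \<le> ennreal K * emeasure N X" using * by simp
        show "emeasure N X \<le> ennreal K * emeasure ?H (g ` X)" using * by simp
      qed simp
      then show ?thesis using r(1) by (intro exI[of _ "ball y r"]) simp
    qed
    obtain F where F: "F \<subseteq> Collect good" "countable F" "\<Union>F = \<Union>(Collect good)"
      by (rule Lindelof[of "Collect good"]) (auto simp: good_def)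
    have "good {}" by (auto simp: good_def)
    \<comment> \<open>The empty set is added because an enumeration needs a non-empty family.\<close>
    define B where "B = from_nat_into (insert {} F)"
    have rangeB: "range B = insert {} F"
      unfolding B_def using F(2) by (intro range_from_nat_into) auto
    have good: "good (B n)" for n
    proof -
      have "B n \<in> insert {} F" unfolding rangeB[symmetric] by simp
      then show ?thesis using F(1) \<open>good {}\<close> by auto
    qed
    have cover: "V \<subseteq> (\<Union>n. B n)"
    proof
      fix y assume "y \<in> V"
      then have "y \<in> \<Union>F" unfolding F(3) using ex by auto
      then show "y \<in> (\<Union>n. B n)" unfolding rangeB by auto
    qed
    define D where "D n = A \<inter> disjointed B n" for n
    have D: "D n \<in> sets borel" "D n \<subseteq> V" "D n \<subseteq> B n" for n
    proof -
      have "range B \<subseteq> sets borel" using good by (auto simp: good_def)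
      then have "range (disjointed B) \<subseteq> sets borel" by (rule sets.range_disjointed_sets)
      then show "D n \<in> sets borel" using A(1) by (auto simp: D_def)
      show "D n \<subseteq> V" "D n \<subseteq> B n" using A(2) disjointed_subset[of B n] by (auto simp: D_def)
    qed
    have disj: "disjoint_family D"
      using disjoint_family_disjointed[of B] by (auto simp: disjoint_family_on_def D_def)
    have disj_g: "disjoint_family (\<lambda>n. g ` D n)"
      unfolding disjoint_family_on_def
    proof (intro ballI impI)
      fix m n :: nat assume "m \<noteq> n"
      then have "D m \<inter> D n = {}" using disj by (auto simp: disjoint_family_on_def)
      then have "g ` (D m \<inter> D n) = {}" by simp
      then show "g ` D m \<inter> g ` D n = {}"
        using inj_on_image_Int[OF inj D(2) D(2)] by metis
    qed
    have "A = (\<Union>n. D n)"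
      using A(2) cover UN_disjointed_eq[of B] by (auto simp: D_def)
    have sum_N: "emeasure N A = (\<Sum>n. emeasure N (D n))"
    proof -
      have "range D \<subseteq> sets N" using D(1) by (auto simp: N_def)
      then show ?thesis unfolding \<open>A = (\<Union>n. D n)\<close> by (rule suminf_emeasure[OF _ disj, symmetric])
    qed
    have sum_H: "emeasure ?H (g ` A) = (\<Sum>n. emeasure ?H (g ` D n))"
    proof -
      have "range (\<lambda>n. g ` D n) \<subseteq> sets ?H" using image[OF D(1,2)] by auto
      then show ?thesis
        unfolding \<open>A = (\<Union>n. D n)\<close> image_UN by (rule suminf_emeasure[OF _ disj_g, symmetric])
    qed
    have le: "emeasure ?H (g ` D n) \<le> ennreal K * emeasure N (D n)"
        "emeasure N (D n) \<le> ennreal K * emeasure ?H (g ` D n)" for n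
      using good[of n, unfolded good_def, THEN conjunct2, rule_format, OF D] by auto
    show ?thesis
    proof
      show "emeasure ?H (g ` A) \<le> ennreal K * emeasure N A"
        unfolding sum_N sum_H ennreal_suminf_cmult[symmetric] by (rule suminf_le[OF le(1)]) simp_all
      show "emeasure N A \<le> ennreal K * emeasure ?H (g ` A)"
        unfolding sum_N sum_H ennreal_suminf_cmult[symmetric] by (rule suminf_le[OF le(2)]) simp_all
    qed
  qed
  have "emeasure ?H (g ` A) = emeasure N A"
  proof (rule antisym)
    show "emeasure ?H (g ` A) \<le> emeasure N A"
      by (rule ennreal_le_of_le_all_factors) (rule bounds[THEN conjunct1])
    show "emeasure N A \<le> emeasure ?H (g ` A)"
      by (rule ennreal_le_of_le_all_factors) (rule bounds[THEN conjunct2])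
  qed
  then show ?thesis using N[OF A] by simp
qed

text \<open>
  Equality on sets says that the image of the measure \<open>J dy\<close> under \<open>g\<close> is Hausdorff measure
  restricted to \<open>g ` V\<close>. Outside \<open>V\<close> the functions are set to \<open>0\<close>, which makes them Borel on the whole space.
\<close>

theorem area_formula:
  fixes g :: "'a::euclidean_space \<Rightarrow> 'b::euclidean_space" and g' :: "'a \<Rightarrow> 'a \<Rightarrow>\<^sub>L 'b"
  assumes "open V" and inj: "inj_on g V"
    and deriv: "\<And>y. y \<in> V \<Longrightarrow> (g has_derivative blinfun_apply (g' y)) (at y)"
    and cont: "continuous_on V g'" and contJ: "continuous_on V J"
    and inj': "\<And>y. y \<in> V \<Longrightarrow> inj (blinfun_apply (g' y))" and J: "\<And>y. y \<in> V \<Longrightarrow> 0 < J y"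
    and sv: "\<And>y. y \<in> V \<Longrightarrow> scales_volume (blinfun_apply (g' y)) (J y)"
    and image: "\<And>A. A \<in> sets borel \<Longrightarrow> A \<subseteq> V \<Longrightarrow> g ` A \<in> sets borel"
    and h [measurable]: "h \<in> borel_measurable borel"
  shows "(\<integral>\<^sup>+z\<in>g ` V. h z \<partial>hausdorff_measure DIM('a)) = (\<integral>\<^sup>+y\<in>V. h (g y) * ennreal (J y) \<partial>lborel)"
proof -
  let ?H = "hausdorff_measure DIM('a) :: 'b measure"
  let ?J = "\<lambda>y. ennreal (indicator V y * J y)" and ?g = "\<lambda>y. indicator V y *\<^sub>R g y"
  have V [measurable]: "V \<in> sets borel" using \<open>open V\<close> by simp
  have gV [measurable]: "g ` V \<in> sets borel" using image[OF V] by simp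
  have J_meas [measurable]: "?J \<in> borel_measurable borel"
    using borel_measurable_continuous_on_indicator[OF V contJ] by (simp add: mult.commute)
  have "continuous_on V g"
    using deriv by (meson continuous_at_imp_continuous_on has_derivative_continuous)
  then have g_meas [measurable]: "?g \<in> borel_measurable borel"
    by (intro borel_measurable_continuous_on_indicator V)
  have eq: "distr (density lborel ?J) borel ?g = density ?H (indicator (g ` V))"
  proof (rule measure_eqI)
    fix B :: "'b set" assume "B \<in> sets (distr (density lborel ?J) borel ?g)"
    then have [measurable]: "B \<in> sets borel" by simp
    define A where "A = (?g -` B) \<inter> V"
    have "?g -` B \<in> sets borel" by (rule measurable_sets_borel[OF g_meas]) measurable
    then have A: "A \<in> sets borel" "A \<subseteq> V" by (auto simp: A_def)
    have gA: "g ` A = B \<inter> g ` V" by (auto simp: A_def)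
    have "emeasure (distr (density lborel ?J) borel ?g) B = emeasure (density lborel ?J) (?g -` B)"
      by (subst emeasure_distr) auto
    also have "\<dots> = (\<integral>\<^sup>+y. ?J y * indicator (?g -` B) y \<partial>lborel)"
      using \<open>?g -` B \<in> sets borel\<close> by (intro emeasure_density) auto
    also have "\<dots> = weighted_volume J A"
      by (intro nn_integral_cong) (auto simp: A_def indicator_def)
    also have "\<dots> = emeasure ?H (g ` A)"
      using area_formula_set[OF assms(1-9) A] by simp
    also have "\<dots> = (\<integral>\<^sup>+z. indicator (g ` V) z * indicator B z \<partial>?H)"
      using gV unfolding gA by (simp add: indicator_inter_arith[symmetric] Int_commute)
    also have "\<dots> = emeasure (density ?H (indicator (g ` V))) B"
      using gV by (intro emeasure_density[symmetric]) auto
    finally show "emeasure (distr (density lborel ?J) borel ?g) B = emeasure (density ?H (indicator (g ` V))) B" .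
  qed simp
  have "(\<integral>\<^sup>+z\<in>g ` V. h z \<partial>?H) = (\<integral>\<^sup>+z. h z \<partial>density ?H (indicator (g ` V)))"
    using gV by (subst nn_integral_density) (auto simp: mult.commute)
  also have "\<dots> = (\<integral>\<^sup>+y. ?J y * h (?g y) \<partial>lborel)"
    unfolding eq[symmetric] by (simp add: nn_integral_distr nn_integral_density)
  also have "\<dots> = (\<integral>\<^sup>+y\<in>V. h (g y) * ennreal (J y) \<partial>lborel)"
    by (intro nn_integral_cong) (auto simp: indicator_def mult.commute)
  finally show ?thesis .
qed

section \<open>Tangents of powers and equality of integrals\<close>

text \<open>
  The graph of \<open>s \<mapsto> s powr p\<close> lies strictly above its tangent at \<open>t\<close>, away from the point of contact. This is
  the convexity behind both the minimality and the uniqueness of the extremal function.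
\<close>

lemma power_tangent_le:
  fixes p s t :: real
  assumes "1 < p" "0 \<le> s" "0 \<le> t"
  shows "p * t powr (p - 1) * s \<le> s powr p + (p - 1) * t powr p"
    and "p * t powr (p - 1) * s = s powr p + (p - 1) * t powr p \<Longrightarrow> s = t"
proof -
  have strict: "p * t powr (p - 1) * s < s powr p + (p - 1) * t powr p" if "s \<noteq> t"
  proof (cases "s = 0 \<or> t = 0")
    case True
    then show ?thesis using assms that by auto
  next
    case False
    then have pos: "0 < s" "0 < t" using assms by auto
    have der: "((\<lambda>x. x powr p) has_real_derivative p * x powr (p - 1)) (at x)" if "0 < x" for x
      using that by (auto intro!: derivative_eq_intros simp: powr_diff)
    have t: "t powr p = t * t powr (p - 1)" using pos by (simp add: powr_mult_base)
    have "p * t powr (p - 1) * (s - t) < s powr p - t powr p"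
    proof (cases "t < s")
      case True
      then obtain z where z: "t < z" "z < s" "s powr p - t powr p = (s - t) * (p * z powr (p - 1))"
        using MVT2[of t s "\<lambda>x. x powr p" "\<lambda>x. p * x powr (p - 1)"] der pos by auto
      have "t powr (p - 1) < z powr (p - 1)" using z pos assms by (intro powr_less_mono2) auto
      then have "(s - t) * (p * t powr (p - 1)) < (s - t) * (p * z powr (p - 1))"
        using True assms by (intro mult_strict_left_mono) auto
      then show ?thesis using z(3) by (simp add: mult.commute)
    next
      case False
      then have "s < t" using \<open>s \<noteq> t\<close> by simp
      then obtain z where z: "s < z" "z < t" "t powr p - s powr p = (t - s) * (p * z powr (p - 1))"
        using MVT2[of s t "\<lambda>x. x powr p" "\<lambda>x. p * x powr (p - 1)"] der pos by auto
      have "z powr (p - 1) < t powr (p - 1)" using z pos assms by (intro powr_less_mono2) auto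
      then have "(t - s) * (p * z powr (p - 1)) < (t - s) * (p * t powr (p - 1))"
        using \<open>s < t\<close> assms by (intro mult_strict_left_mono) auto
      then show ?thesis using z(3) by (simp add: algebra_simps)
    qed
    then show ?thesis unfolding t by (simp add: algebra_simps)
  qed
  have eq: "p * t powr (p - 1) * t = t powr p + (p - 1) * t powr p"
    using assms powr_mult_base[of t "p - 1"] by (simp add: algebra_simps)
  show "p * t powr (p - 1) * s \<le> s powr p + (p - 1) * t powr p"
    using strict eq by (cases "s = t") auto
  show "s = t" if "p * t powr (p - 1) * s = s powr p + (p - 1) * t powr p"
    using strict that by fastforce
qed

lemma ennreal_powr_ennreal:
  assumes "0 \<le> r" "0 < a"
  shows "ennreal_powr (ennreal r) a = ennreal (r powr a)"
  using assms by (cases "r = 0") (auto simp: ennreal_powr_def)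

lemma ennreal_powr_top: "0 < a \<Longrightarrow> ennreal_powr top a = top"
  by (simp add: ennreal_powr_def)

lemma ennreal_powr_neg: "0 < r \<Longrightarrow> ennreal_powr (ennreal r) a = ennreal (r powr a)"
  by (auto simp: ennreal_powr_def)

lemma ennreal_powr_measurable [measurable]: "(\<lambda>x. ennreal_powr x a) \<in> borel_measurable borel"
  unfolding ennreal_powr_def by measurable

text \<open>
  The same with possibly infinite \<open>s\<close>. Terms are arranged so that no subtraction occurs. The equality
  case needs finite \<open>s\<close>, because at \<open>s = \<infinity>\<close> both sides may be infinite.
\<close>

lemma ennreal_power_tangent_le:
  fixes s :: ennreal and t p :: real
  assumes "1 < p" "0 \<le> t"
  shows "ennreal (p * t powr (p - 1)) * s \<le> ennreal_powr s p + ennreal ((p - 1) * t powr p)"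
    and "ennreal (p * t powr (p - 1)) * s = ennreal_powr s p + ennreal ((p - 1) * t powr p) \<Longrightarrow>
      ennreal_powr s p < top \<Longrightarrow> s = ennreal t"
proof -
  show "ennreal (p * t powr (p - 1)) * s \<le> ennreal_powr s p + ennreal ((p - 1) * t powr p)"
  proof (cases s)
    case (real r)
    then show ?thesis
      using power_tangent_le(1)[of p r t] assms
      by (simp add: ennreal_powr_ennreal ennreal_mult[symmetric] ennreal_plus[symmetric] ennreal_leI del: ennreal_plus)
  qed (use assms in \<open>simp add: ennreal_powr_top\<close>)
  assume eq: "ennreal (p * t powr (p - 1)) * s = ennreal_powr s p + ennreal ((p - 1) * t powr p)"
    and fin: "ennreal_powr s p < top"
  obtain r where r: "s = ennreal r" "0 \<le> r"
    using fin assms by (cases s) (auto simp: ennreal_powr_top)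
  have "ennreal (p * t powr (p - 1) * r) = ennreal (r powr p + (p - 1) * t powr p)"
    using eq assms r by (simp add: ennreal_powr_ennreal ennreal_mult)
  then have "p * t powr (p - 1) * r = r powr p + (p - 1) * t powr p"
    using assms r by (subst (asm) ennreal_inj) auto
  then show "s = ennreal t" using power_tangent_le(2)[of p r t] assms r by simp
qed

text \<open>
  Finiteness is essential: it allows the smaller integral to be subtracted.
\<close>

lemma AE_eq_of_le_of_nn_integral_ge:
  fixes a b :: "'a \<Rightarrow> ennreal"
  assumes [measurable]: "a \<in> borel_measurable N" "b \<in> borel_measurable N"
    and le: "\<And>x. b x \<le> a x" and ge: "integral\<^sup>N N a \<le> integral\<^sup>N N b" and fin: "integral\<^sup>N N a < top"
  shows "AE x in N. b x = a x"
proof -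
  have fin_b: "integral\<^sup>N N b \<noteq> \<infinity>"
    using nn_integral_mono[of N b a] le fin by (auto simp: top_unique)
  have "(\<integral>\<^sup>+x. a x - b x \<partial>N) = integral\<^sup>N N a - integral\<^sup>N N b"
    using fin_b le by (intro nn_integral_diff) auto
  also have "\<dots> = 0" using ge fin by (simp add: diff_eq_0_iff_ennreal)
  finally have "AE x in N. a x - b x = 0"
    by (subst (asm) nn_integral_0_iff_AE) auto
  moreover have "AE x in N. a x \<noteq> \<infinity>"
    using fin by (intro nn_integral_PInf_AE) auto
  ultimately show ?thesis
  proof eventually_elim
    case (elim x)
    then have "a x \<le> b x" using ennreal_minus_eq_0 by blast
    then show ?case using le[of x] by (rule antisym[rotated])
  qed
qed

section \<open>Domains foliated by surfaces\<close>

text \<open>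
  A diffeomorphism of a product of open sets; its image is foliated by the surfaces \<open>f ` ({x} \<times> V)\<close>.
\<close>

locale surface_foliation =
  fixes U :: "(real^'k::finite) set" and V :: "(real^'m::finite) set" and \<Omega> :: "(real^('k + 'm)) set"
    and f :: "(real^'k) \<times> (real^'m) \<Rightarrow> real^('k + 'm)" and p q :: real
  assumes p: "1 < p" and pq: "1 / p + 1 / q = 1"
    and open_U: "open U" and open_V: "open V" and V_ne: "V \<noteq> {}" and open_\<Omega>: "open \<Omega>"
    and diffeo: "C1_diffeomorphism (U \<times> V) \<Omega> f"
begin

abbreviation "W \<equiv> U \<times> V"
abbreviation "F \<equiv> the_inv_into W f"

lemma open_W: "open W" using open_U open_V by (rule open_Times)

lemma inj_f: "inj_on f W" and image_f: "f ` W = \<Omega>"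
  using diffeo by (auto simp: C1_diffeomorphism_def bij_betw_def)

lemma F_f: "w \<in> W \<Longrightarrow> F (f w) = w"
  using inj_f by (rule the_inv_into_f_f)

lemma f_in: "w \<in> W \<Longrightarrow> f w \<in> \<Omega>"
  using image_f by blast

definition f' :: "(real^'k) \<times> (real^'m) \<Rightarrow> ((real^'k) \<times> (real^'m)) \<Rightarrow>\<^sub>L (real^('k + 'm))" where
  "f' = (SOME D. (\<forall>z\<in>W. (f has_derivative blinfun_apply (D z)) (at z)) \<and> continuous_on W D)"

lemma f'_deriv: "w \<in> W \<Longrightarrow> (f has_derivative blinfun_apply (f' w)) (at w)"
  and f'_cont: "continuous_on W f'"
proof -
  have "\<exists>D. (\<forall>z\<in>W. (f has_derivative blinfun_apply (D z)) (at z)) \<and> continuous_on W D"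
    using diffeo by (simp add: C1_diffeomorphism_def C1_on_def)
  from someI_ex[OF this]
  show "w \<in> W \<Longrightarrow> (f has_derivative blinfun_apply (f' w)) (at w)" and "continuous_on W f'"
    unfolding f'_def by auto
qed

lemma F_deriv: "z \<in> \<Omega> \<Longrightarrow> \<exists>D. (F has_derivative D) (at z)"
  using diffeo unfolding C1_diffeomorphism_def C1_on_def by blast

lemma F_cont: "continuous_on \<Omega> F"
  using F_deriv by (meson continuous_at_imp_continuous_on has_derivative_continuous)

text \<open>
  The chain rule for the differentiable inverse gives a left inverse of the derivative.
\<close>

lemma inj_f':
  assumes w: "w \<in> W"
  shows "inj (blinfun_apply (f' w))"
proof -
  obtain D where D: "(F has_derivative D) (at (f w))" using F_deriv[OF f_in[OF w]] by blast
  have "(F \<circ> f has_derivative D \<circ> blinfun_apply (f' w)) (at w)"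
    using f'_deriv[OF w] D by (rule diff_chain_at)
  then have 1: "((\<lambda>x. x) has_derivative D \<circ> blinfun_apply (f' w)) (at w)"
    by (rule has_derivative_transform_within_open[OF _ open_W w]) (simp add: F_f)
  have "D \<circ> blinfun_apply (f' w) = (\<lambda>x. x)"
    by (rule has_derivative_unique[OF 1 has_derivative_ident])
  then show ?thesis by (metis inj_on_imageI2 inj_on_id2)
qed

lemma image_borel:
  assumes "B \<in> sets borel" "B \<subseteq> W"
  shows "f ` B \<in> sets borel"
proof -
  have m: "(\<lambda>z. indicator \<Omega> z *\<^sub>R F z) \<in> borel_measurable borel"
    using open_\<Omega> F_cont by (intro borel_measurable_continuous_on_indicator) auto
  have "f ` B = \<Omega> \<inter> (\<lambda>z. indicator \<Omega> z *\<^sub>R F z) -` B"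
  proof (intro equalityI subsetI)
    fix z assume "z \<in> f ` B"
    then obtain w where w: "w \<in> B" "z = f w" by blast
    then have "w \<in> W" using assms(2) by blast
    then show "z \<in> \<Omega> \<inter> (\<lambda>z. indicator \<Omega> z *\<^sub>R F z) -` B" using w f_in F_f by simp
  next
    fix z assume z: "z \<in> \<Omega> \<inter> (\<lambda>z. indicator \<Omega> z *\<^sub>R F z) -` B"
    then have "z \<in> \<Omega>" by blast
    then have "F z \<in> B" using z by simp
    moreover have "f (F z) = z" using \<open>z \<in> \<Omega>\<close> image_f by (intro f_the_inv_into_f inj_f) auto
    ultimately show "z \<in> f ` B" by (metis imageI)
  qed
  moreover have "(\<lambda>z. indicator \<Omega> z *\<^sub>R F z) -` B \<in> sets borel"
    using m assms(1) by (rule measurable_sets_borel)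
  ultimately show ?thesis using open_\<Omega> by auto
qed

lemma frechet_f: "w \<in> W \<Longrightarrow> frechet_derivative f (at w) = blinfun_apply (f' w)"
  using f'_deriv by (metis frechet_derivative_at)

abbreviation J :: "(real^'k) \<times> (real^'m) \<Rightarrow> real" where
  "J w \<equiv> \<bar>jac f (fst w) (snd w)\<bar>"
abbreviation Jy :: "(real^'k) \<times> (real^'m) \<Rightarrow> real" where
  "Jy w \<equiv> jac_y f (fst w) (snd w)"

lemma jac_eq:
  assumes "w \<in> W"
  shows "jac f (fst w) (snd w) =
    det (\<chi> i j. blinfun_apply (f' w) (case j of Inl a \<Rightarrow> (axis a 1, 0) | Inr b \<Rightarrow> (0, axis b 1)) $ i)"
  using frechet_f[OF assms] by (simp add: jac_def)

lemma scales_volume_f: "w \<in> W \<Longrightarrow> scales_volume (blinfun_apply (f' w)) (J w)"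
  and J_pos: "w \<in> W \<Longrightarrow> 0 < J w"
proof -
  assume w: "w \<in> W"
  have "linear (blinfun_apply (f' w))" by (rule bounded_linear.linear[OF blinfun.bounded_linear_right])
  note * = scales_volume_square[OF this inj_f'[OF w]]
  show "scales_volume (blinfun_apply (f' w)) (J w)" "0 < J w"
    using * unfolding jac_eq[OF w] by simp_all
qed

text \<open>
  The derivative of \<open>f\<close> in the direction of the surface, as a bounded linear map that depends
  continuously on the point.
\<close>

definition slice' :: "(real^'k) \<times> (real^'m) \<Rightarrow> (real^'m) \<Rightarrow>\<^sub>L (real^('k + 'm))" where
  "slice' w = f' w o\<^sub>L Blinfun (\<lambda>v. (0, v))"

lemma slice'_apply: "blinfun_apply (slice' w) v = f' w (0, v)"
  unfolding slice'_def by (simp add: bounded_linear_Blinfun_apply bounded_linear_Pair bounded_linear_zero bounded_linear_ident)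

lemma slice'_cont: "continuous_on W slice'"
  unfolding slice'_def
  by (intro bounded_bilinear.continuous_on[OF bounded_bilinear_blinfun_compose] f'_cont continuous_on_const)

lemma slice_deriv:
  assumes "x \<in> U" "y \<in> V"
  shows "((\<lambda>v. f (x, v)) has_derivative blinfun_apply (slice' (x, y))) (at y)"
proof -
  have "((\<lambda>v. (x, v)) has_derivative (\<lambda>v. (0, v))) (at y)"
    by (auto intro!: derivative_eq_intros)
  moreover have "(f has_derivative blinfun_apply (f' (x, y))) (at (x, y))"
    using assms by (intro f'_deriv) auto
  ultimately have "(f \<circ> (\<lambda>v. (x, v)) has_derivative blinfun_apply (f' (x, y)) \<circ> (\<lambda>v. (0, v))) (at y)"
    by (rule diff_chain_at)
  then show ?thesis by (simp add: comp_def slice'_apply[abs_def])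
qed

lemma inj_slice': "w \<in> W \<Longrightarrow> inj (blinfun_apply (slice' w))"
  using inj_f'[of w] by (auto simp: slice'_apply inj_def)

lemma jac_y_eq:
  assumes "w \<in> W"
  shows "jac_y f (fst w) (snd w) =
    sqrt (det (transpose (matrix (blinfun_apply (slice' w))) ** matrix (blinfun_apply (slice' w))))"
proof -
  have "frechet_derivative (\<lambda>v. f (fst w, v)) (at (snd w)) = blinfun_apply (slice' (fst w, snd w))"
    using assms by (intro frechet_derivative_at[symmetric] slice_deriv) auto
  then show ?thesis by (simp add: jac_y_def Let_def)
qed

lemma scales_volume_slice: "w \<in> W \<Longrightarrow> scales_volume (blinfun_apply (slice' w)) (Jy w)"
  and Jy_pos: "w \<in> W \<Longrightarrow> 0 < Jy w"
proof -
  assume w: "w \<in> W"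
  have "linear (blinfun_apply (slice' w))" by (rule bounded_linear.linear[OF blinfun.bounded_linear_right])
  note * = scales_volume_gram_det[OF this inj_slice'[OF w]]
  show "scales_volume (blinfun_apply (slice' w)) (Jy w)" "0 < Jy w"
    using * unfolding jac_y_eq[OF w] by simp_all
qed

lemma J_cont: "continuous_on W J"
proof -
  have "continuous_on W (\<lambda>w. det (\<chi> i j. blinfun_apply (f' w) (case j of Inl a \<Rightarrow> (axis a 1, 0) | Inr b \<Rightarrow> (0, axis b 1)) $ i))"
    unfolding det_def by (simp, intro continuous_intros f'_cont)
  then have "continuous_on W (\<lambda>w. \<bar>det (\<chi> i j. blinfun_apply (f' w) (case j of Inl a \<Rightarrow> (axis a 1, 0) | Inr b \<Rightarrow> (0, axis b 1)) $ i)\<bar>)"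
    by (rule continuous_on_rabs)
  then show ?thesis by (rule continuous_on_eq) (simp add: jac_eq)
qed

lemma Jy_cont: "continuous_on W Jy"
proof -
  have "continuous_on W (\<lambda>w. sqrt (det (transpose (matrix (blinfun_apply (slice' w))) ** matrix (blinfun_apply (slice' w)))))"
    unfolding det_def
    by (intro continuous_intros)
      (simp add: matrix_matrix_mult_def transpose_def matrix_def, intro continuous_intros slice'_cont)
  then show ?thesis by (rule continuous_on_eq) (simp add: jac_y_eq)
qed

section \<open>Integration along and across the surfaces\<close>

lemma q_eq: "(q - 1) * (p - 1) = 1" "(q - 1) * p = q"
proof -
  have "q \<noteq> 0" using pq p by auto
  then have "q + p = p * q" using pq p by (simp add: field_simps)
  then show "(q - 1) * (p - 1) = 1" "(q - 1) * p = q" by (simp_all add: algebra_simps)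
qed

text \<open>
  The algebra of the conjugate exponents for \<open>t = a powr (q - 1) / r\<close>, the form of the extremal function
  on a surface: \<open>t powr (p - 1)\<close> is a constant multiple of \<open>a\<close>, and \<open>t powr p\<close> one of \<open>a powr q\<close>.
\<close>

lemma weight_powr:
  assumes "0 < a" "0 < r"
  shows "(a powr (q - 1) / r) powr (p - 1) = r powr (1 - p) * a"
    and "(a powr (q - 1) / r) powr p = r powr (- p) * a powr q"
proof -
  have "(a powr (q - 1) / r) powr (p - 1) = a / r powr (p - 1)"
    using assms by (simp add: powr_divide powr_powr q_eq)
  then show "(a powr (q - 1) / r) powr (p - 1) = r powr (1 - p) * a"
    using powr_minus_divide[of r "p - 1"] by simp
  show "(a powr (q - 1) / r) powr p = r powr (- p) * a powr q"
    using assms by (simp add: powr_divide powr_powr q_eq powr_minus_divide)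
qed

lemma restrict_W_borel: "continuous_on W u \<Longrightarrow> (\<lambda>w. indicator W w *\<^sub>R u w) \<in> borel_measurable borel"
  for u :: "_ \<Rightarrow> 'z::{real_normed_vector, second_countable_topology}"
  using open_W by (intro borel_measurable_continuous_on_indicator) auto

lemma f_cont: "continuous_on W f"
  using f'_deriv by (meson continuous_at_imp_continuous_on has_derivative_continuous)

lemma measurable_restrict_\<Omega>:
  "g \<in> borel_measurable (restrict_space borel \<Omega>) \<longleftrightarrow> (\<lambda>z. g z * indicator \<Omega> z :: ennreal) \<in> borel_measurable borel"
  using open_\<Omega> by (intro borel_measurable_restrict_space_iff_ennreal) auto

lemma measurable_along_f:
  fixes g :: "real^('k + 'm) \<Rightarrow> ennreal"
  assumes g: "g \<in> borel_measurable (restrict_space borel \<Omega>)"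
  shows "(\<lambda>w. g (f w) * indicator W w) \<in> borel_measurable borel"
proof -
  have [measurable]: "(\<lambda>w. indicator W w *\<^sub>R f w) \<in> borel_measurable borel" "W \<in> sets borel"
    using restrict_W_borel[OF f_cont] open_W by auto
  have [measurable]: "(\<lambda>z. g z * indicator \<Omega> z) \<in> borel_measurable borel"
    using g measurable_restrict_\<Omega> by blast
  have "(\<lambda>w. (\<lambda>z. g z * indicator \<Omega> z) (indicator W w *\<^sub>R f w) * indicator W w) \<in> borel_measurable borel"
    by measurable
  also have "(\<lambda>w. (\<lambda>z. g z * indicator \<Omega> z) (indicator W w *\<^sub>R f w) * indicator W w) = (\<lambda>w. g (f w) * indicator W w)"
  proof
    fix w show "(\<lambda>z. g z * indicator \<Omega> z) (indicator W w *\<^sub>R f w) * indicator W w = g (f w) * indicator W w"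
      using f_in[of w] by (cases "w \<in> W") simp_all
  qed
  finally show ?thesis .
qed

lemma measurable_pullback:
  assumes "S \<in> borel_measurable borel"
  shows "(\<lambda>z. S (F z) :: ennreal) \<in> borel_measurable (restrict_space borel \<Omega>)"
  using borel_measurable_continuous_on_restrict[OF F_cont] assms by (rule measurable_compose)

lemma measurable_slice_integral:
  fixes G :: "(real^'k) \<times> (real^'m) \<Rightarrow> ennreal"
  assumes "G \<in> borel_measurable borel"
  shows "(\<lambda>x. \<integral>\<^sup>+y. G (x, y) \<partial>lborel) \<in> borel_measurable borel"
    and "(\<lambda>y. G (x, y)) \<in> borel_measurable borel"
    and "(\<integral>\<^sup>+w. G w \<partial>lborel) = (\<integral>\<^sup>+x. \<integral>\<^sup>+y. G (x, y) \<partial>lborel \<partial>lborel)"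
proof -
  have G: "G \<in> borel_measurable (lborel \<Otimes>\<^sub>M lborel)"
    using assms by (simp add: lborel_prod)
  show "(\<lambda>x. \<integral>\<^sup>+y. G (x, y) \<partial>lborel) \<in> borel_measurable borel"
    using lborel.borel_measurable_nn_integral_fst[OF G] by simp
  show "(\<lambda>y. G (x, y)) \<in> borel_measurable borel"
    using measurable_compose[OF measurable_Pair1' G, of x] by simp
  show "(\<integral>\<^sup>+w. G w \<partial>lborel) = (\<integral>\<^sup>+x. \<integral>\<^sup>+y. G (x, y) \<partial>lborel \<partial>lborel)"
    using lborel.nn_integral_fst[OF G] by (simp add: lborel_prod)
qed

lemma measurable_on_slice:
  assumes "continuous_on W u" "x \<in> U"
  shows "(\<lambda>y. ennreal (u (x, y)) * indicator V y) \<in> borel_measurable borel"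
proof -
  have "(\<lambda>w. ennreal (indicator W w *\<^sub>R u w)) \<in> borel_measurable borel"
    using restrict_W_borel[OF assms(1)] by (rule measurable_compose) simp
  from measurable_slice_integral(2)[OF this, of x]
  have "(\<lambda>y. ennreal (indicator W (x, y) *\<^sub>R u (x, y))) \<in> borel_measurable borel" .
  also have "(\<lambda>y. ennreal (indicator W (x, y) *\<^sub>R u (x, y))) = (\<lambda>y. ennreal (u (x, y)) * indicator V y)"
    using assms(2) by (auto simp: fun_eq_iff indicator_def)
  finally show ?thesis .
qed

lemma measurable_surface_integrand:
  assumes g: "g \<in> borel_measurable (restrict_space borel \<Omega>)" and "continuous_on W j" "x \<in> U"
  shows "(\<lambda>y. g (f (x, y)) * ennreal (j (x, y)) * indicator V y) \<in> borel_measurable borel"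
proof -
  have "(\<lambda>y. (g (f (x, y)) * indicator W (x, y)) * (ennreal (j (x, y)) * indicator V y)) \<in> borel_measurable borel"
    by (rule borel_measurable_times_ennreal[OF measurable_slice_integral(2)[OF measurable_along_f[OF g]] measurable_on_slice[OF assms(2,3)]])
  also have "(\<lambda>y. (g (f (x, y)) * indicator W (x, y)) * (ennreal (j (x, y)) * indicator V y)) = (\<lambda>y. g (f (x, y)) * ennreal (j (x, y)) * indicator V y)"
    using assms(3) by (auto simp: fun_eq_iff indicator_def)
  finally show ?thesis .
qed

lemma surface_eq: "surface f V x = (\<lambda>v. f (x, v)) ` V"
  by (auto simp: surface_def)

lemma surface_subset: "x \<in> U \<Longrightarrow> surface f V x \<subseteq> \<Omega>"
  using image_f by (auto simp: surface_def)

lemma slice_pair_cont: "continuous_on V (\<lambda>y. (x, y))"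
  by (intro continuous_intros)

abbreviation surface_mass :: "(real^('k + 'm) \<Rightarrow> ennreal) \<Rightarrow> real^'k \<Rightarrow> ennreal" where
  "surface_mass g x \<equiv> (\<integral>\<^sup>+y\<in>V. g (f (x, y)) * ennreal (Jy (x, y)) \<partial>lborel)"

abbreviation surface_energy :: "(real^('k + 'm) \<Rightarrow> ennreal) \<Rightarrow> real^'k \<Rightarrow> ennreal" where
  "surface_energy g x \<equiv> (\<integral>\<^sup>+y\<in>V. ennreal_powr (g (f (x, y))) p * ennreal (J (x, y)) \<partial>lborel)"

text \<open>
  The area formula for the parametrisation \<open>y \<mapsto> f (x, y)\<close> of the surface.
\<close>

lemma surface_integral:
  assumes g: "g \<in> borel_measurable (restrict_space borel \<Omega>)" and x: "x \<in> U"
  shows "(\<integral>\<^sup>+z\<in>surface f V x. g z \<partial>hausdorff_measure CARD('m))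
    = surface_mass g x"
proof -
  let ?h = "\<lambda>z. g z * indicator \<Omega> z"
  have sub: "(\<lambda>y. (x, y)) ` V \<subseteq> W" using x by auto
  have "(\<integral>\<^sup>+z\<in>surface f V x. g z \<partial>hausdorff_measure CARD('m))
      = (\<integral>\<^sup>+z\<in>surface f V x. ?h z \<partial>hausdorff_measure CARD('m))"
  proof (rule nn_integral_cong)
    fix z show "g z * indicator (surface f V x) z = ?h z * indicator (surface f V x) z"
      using subsetD[OF surface_subset[OF x], of z] by (cases "z \<in> surface f V x") simp_all
  qed
  also have "\<dots> = (\<integral>\<^sup>+z\<in>(\<lambda>v. f (x, v)) ` V. ?h z \<partial>hausdorff_measure DIM(real^'m))"
    unfolding surface_eq by simp
  also have "\<dots> = surface_mass ?h x"
  proof (rule area_formula[OF open_V, where g'="\<lambda>y. slice' (x, y)"])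
    show "inj_on (\<lambda>v. f (x, v)) V"
      using inj_f x by (auto simp: inj_on_def)
    show "continuous_on V (\<lambda>y. slice' (x, y))"
      by (rule continuous_on_compose2[OF slice'_cont slice_pair_cont sub])
    show "continuous_on V (\<lambda>y. Jy (x, y))"
      by (rule continuous_on_compose2[OF Jy_cont slice_pair_cont sub])
    show "(\<lambda>v. f (x, v)) ` A \<in> sets borel" if "A \<in> sets borel" "A \<subseteq> V" for A
    proof -
      have "{x} \<times> A \<in> sets borel" using that by (intro borel_Times) auto
      then have "f ` ({x} \<times> A) \<in> sets borel" using that x by (intro image_borel) auto
      moreover have "f ` ({x} \<times> A) = (\<lambda>v. f (x, v)) ` A" by auto
      ultimately show ?thesis by simp
    qed
    show "?h \<in> borel_measurable borel" using g measurable_restrict_\<Omega> by blast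
    fix y assume y: "y \<in> V"
    then have w: "(x, y) \<in> W" using x by simp
    show "((\<lambda>v. f (x, v)) has_derivative blinfun_apply (slice' (x, y))) (at y)"
      using x y by (rule slice_deriv)
    show "inj (blinfun_apply (slice' (x, y)))" by (rule inj_slice'[OF w])
    show "0 < Jy (x, y)" by (rule Jy_pos[OF w])
    show "scales_volume (blinfun_apply (slice' (x, y))) (Jy (x, y))" by (rule scales_volume_slice[OF w])
  qed
  also have "\<dots> = surface_mass g x"
  proof (rule nn_integral_cong)
    fix y show "?h (f (x, y)) * ennreal (Jy (x, y)) * indicator V y = g (f (x, y)) * ennreal (Jy (x, y)) * indicator V y"
      using x f_in[of "(x, y)"] by (cases "y \<in> V") simp_all
  qed
  finally show ?thesis .
qed

text \<open>
  The area formula in full dimension, where Hausdorff measure is Lebesgue measure, followed by Tonelli's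
  theorem on the product of \<open>U\<close> and \<open>V\<close>.
\<close>

lemma volume_integral:
  assumes h: "h \<in> borel_measurable (restrict_space borel \<Omega>)"
  shows "(\<integral>\<^sup>+z\<in>\<Omega>. h z \<partial>lborel) = (\<integral>\<^sup>+x\<in>U. (\<integral>\<^sup>+y\<in>V. h (f (x, y)) * ennreal (J (x, y)) \<partial>lborel) \<partial>lborel)"
proof -
  let ?h = "\<lambda>z. h z * indicator \<Omega> z"
  have dim: "DIM((real^'k) \<times> (real^'m)) = DIM(real^('k + 'm))" by simp
  have "(\<integral>\<^sup>+z\<in>\<Omega>. h z \<partial>lborel) = (\<integral>\<^sup>+z\<in>f ` W. ?h z \<partial>hausdorff_measure DIM((real^'k) \<times> (real^'m)))"
    unfolding dim hausdorff_measure_eq_lborel image_f by (intro nn_integral_cong) (auto simp: indicator_def)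
  also have "\<dots> = (\<integral>\<^sup>+w\<in>W. ?h (f w) * ennreal (J w) \<partial>lborel)"
  proof (rule area_formula[OF open_W inj_f f'_deriv f'_cont J_cont inj_f' J_pos scales_volume_f image_borel])
    show "?h \<in> borel_measurable borel" using h measurable_restrict_\<Omega> by blast
  qed
  also have "\<dots> = (\<integral>\<^sup>+w. h (f w) * indicator W w * ennreal (indicator W w *\<^sub>R J w) \<partial>lborel)"
  proof (rule nn_integral_cong)
    fix w show "?h (f w) * ennreal (J w) * indicator W w = h (f w) * indicator W w * ennreal (indicator W w *\<^sub>R J w)"
      using f_in[of w] by (cases "w \<in> W") simp_all
  qed
  also have "\<dots> = (\<integral>\<^sup>+x. \<integral>\<^sup>+y. h (f (x, y)) * indicator W (x, y) * ennreal (indicator W (x, y) *\<^sub>R J (x, y)) \<partial>lborel \<partial>lborel)"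
  proof (rule measurable_slice_integral(3))
    show "(\<lambda>w. h (f w) * indicator W w * ennreal (indicator W w *\<^sub>R J w)) \<in> borel_measurable borel"
      using measurable_along_f[OF h] restrict_W_borel[OF J_cont] by measurable
  qed
  also have "\<dots> = (\<integral>\<^sup>+x\<in>U. (\<integral>\<^sup>+y\<in>V. h (f (x, y)) * ennreal (J (x, y)) \<partial>lborel) \<partial>lborel)"
  proof (rule nn_integral_cong)
    fix x
    show "(\<integral>\<^sup>+y. h (f (x, y)) * indicator W (x, y) * ennreal (indicator W (x, y) *\<^sub>R J (x, y)) \<partial>lborel)
      = (\<integral>\<^sup>+y\<in>V. h (f (x, y)) * ennreal (J (x, y)) \<partial>lborel) * indicator U x"
      by (cases "x \<in> U") (auto simp: indicator_times intro!: nn_integral_cong split: split_indicator)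
  qed
  finally show ?thesis .
qed

lemma p_energy_eq:
  assumes g: "g \<in> borel_measurable (restrict_space borel \<Omega>)"
  shows "p_energy p \<Omega> g = (\<integral>\<^sup>+x\<in>U. surface_energy g x \<partial>lborel)"
  unfolding p_energy_def using g by (intro volume_integral) measurable

lemma in_adm_iff:
  assumes "E \<subseteq> U"
  shows "g \<in> adm CARD('m) \<Omega> (surface f V ` E) \<longleftrightarrow> g \<in> borel_measurable (restrict_space borel \<Omega>) \<and>
    (\<forall>x\<in>E. 1 \<le> surface_mass g x)"
proof -
  have "(\<forall>x\<in>E. 1 \<le> (\<integral>\<^sup>+z\<in>surface f V x. g z \<partial>hausdorff_measure CARD('m)))
      \<longleftrightarrow> (\<forall>x\<in>E. 1 \<le> surface_mass g x)"
    if g: "g \<in> borel_measurable (restrict_space borel \<Omega>)"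
    by (intro ball_cong refl, subst surface_integral[OF g]) (use assms in auto)
  then show ?thesis by (auto simp: adm_def)
qed

abbreviation ratio :: "(real^'k) \<times> (real^'m) \<Rightarrow> real" where
  "ratio w \<equiv> Jy w / J w"
abbreviation l :: "real^'k \<Rightarrow> ennreal" where
  "l \<equiv> l_fun q f V"

abbreviation weight :: "(real^'k) \<times> (real^'m) \<Rightarrow> real" where
  "weight w \<equiv> ratio w powr q * J w"

lemma ratio_pos: "w \<in> W \<Longrightarrow> 0 < ratio w"
  using J_pos Jy_pos by (intro divide_pos_pos)

lemma ratio_powr_cont: "continuous_on W (\<lambda>w. ratio w powr a)"
proof (intro continuous_on_powr continuous_on_divide J_cont Jy_cont continuous_on_const ballI)
  show "J w \<noteq> 0" if "w \<in> W" for w using J_pos[OF that] by simp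
  then show "ratio w \<noteq> 0" if "w \<in> W" for w using ratio_pos[OF that] by (metis less_irrefl that)
qed

lemma weight_cont: "continuous_on W (\<lambda>w. weight w)"
  by (intro continuous_on_mult ratio_powr_cont J_cont)

lemma l_eq: "l x = (\<integral>\<^sup>+y\<in>V. ennreal (weight (x, y)) \<partial>lborel)"
  by (simp add: l_fun_def)

lemma ratio_powr_Jy: "w \<in> W \<Longrightarrow> ratio w powr (q - 1) * Jy w = weight w"
  using ratio_pos[of w] J_pos[of w] powr_mult_base[of "ratio w" "q - 1"] by (simp add: field_simps)

lemma l_pos:
  assumes x: "x \<in> U"
  shows "0 < l x"
proof (rule ccontr)
  assume "\<not> 0 < l x"
  then have "(\<integral>\<^sup>+y\<in>V. ennreal (weight (x, y)) \<partial>lborel) = 0"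
    by (simp add: l_eq)
  then have "AE y in lborel. ennreal (weight (x, y)) * indicator V y = 0"
    using measurable_on_slice[OF weight_cont x] by (subst (asm) nn_integral_0_iff_AE) auto
  then have "AE y in lborel. y \<notin> V"
  proof (rule AE_mp, intro AE_I2 impI notI)
    fix y assume "ennreal (weight (x, y)) * indicator V y = 0" "y \<in> V"
    then show False using Jy_pos[of "(x, y)"] J_pos[of "(x, y)"] x by simp
  qed
  then have "emeasure lborel V = 0"
    using open_V by (subst (asm) AE_iff_measurable[where N=V]) auto
  then have "negligible V"
    using open_V by (simp add: negligible_iff_emeasure0)
  then show False using open_not_negligible[OF open_V V_ne] by simp
qed

lemma l_measurable: "(\<lambda>x. l x * indicator U x) \<in> borel_measurable borel"
proof -
  have "(\<lambda>w. ennreal (indicator W w *\<^sub>R weight w)) \<in> borel_measurable borel"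
    using restrict_W_borel[OF weight_cont] by (rule measurable_compose) simp
  from measurable_slice_integral(1)[OF this]
  have "(\<lambda>x. \<integral>\<^sup>+y. ennreal (indicator W (x, y) *\<^sub>R weight (x, y)) \<partial>lborel) \<in> borel_measurable borel" .
  also have "(\<lambda>x. \<integral>\<^sup>+y. ennreal (indicator W (x, y) *\<^sub>R weight (x, y)) \<partial>lborel) = (\<lambda>x. l x * indicator U x)"
  proof
    fix x
    show "(\<integral>\<^sup>+y. ennreal (indicator W (x, y) *\<^sub>R weight (x, y)) \<partial>lborel) = l x * indicator U x"
      unfolding l_eq by (cases "x \<in> U") (auto simp: indicator_times intro!: nn_integral_cong split: split_indicator)
  qed
  finally show ?thesis .
qed

text \<open>
  With \<open>K\<close> the whole product and \<open>r = l x\<close> this is the extremal function on a surface with finite \<open>l\<close>; smaller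
  sets \<open>K\<close> give the functions used where \<open>l\<close> is infinite.
\<close>

lemma weighted_surface:
  assumes x: "x \<in> U" and K: "K \<in> sets borel"
    and r: "(\<integral>\<^sup>+y\<in>V. indicator K (x, y) * ennreal (weight (x, y)) \<partial>lborel) = ennreal r" "0 < r"
    and g: "\<And>y. y \<in> V \<Longrightarrow> g (f (x, y)) = ennreal (indicator K (x, y) * ratio (x, y) powr (q - 1) / r)"
  shows "surface_mass g x = 1" and "surface_energy g x = ennreal (r powr (1 - p))"
proof -
  let ?d = "\<lambda>y. indicator K (x, y) * ennreal (weight (x, y)) * indicator V y"
  have Kx: "(\<lambda>y. indicator K (x, y) :: ennreal) \<in> borel_measurable borel"
    using K by (intro measurable_slice_integral(2) borel_measurable_indicator)
  have d: "?d \<in> borel_measurable lborel"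
    using borel_measurable_times_ennreal[OF Kx measurable_on_slice[OF weight_cont x]] by (simp add: mult.assoc)
  have "surface_mass g x = (\<integral>\<^sup>+y. ennreal (1 / r) * ?d y \<partial>lborel)"
  proof (rule nn_integral_cong)
    fix y
    show "g (f (x, y)) * ennreal (Jy (x, y)) * indicator V y = ennreal (1 / r) * ?d y"
    proof (cases "y \<in> V")
      case y: True
      then have w: "(x, y) \<in> W" using x by simp
      have "ratio (x, y) powr (q - 1) / r * Jy (x, y) = 1 / r * weight (x, y)"
        using ratio_powr_Jy[OF w] by simp
      then show ?thesis
        using y Jy_pos[OF w] r(2) by (cases "(x, y) \<in> K") (simp_all add: g[OF y] ennreal_mult[symmetric])
    qed simp
  qed
  also have "\<dots> = ennreal (1 / r) * ennreal r"
    using d r(1) by (subst nn_integral_cmult) auto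
  also have "\<dots> = 1" using r(2) by (simp add: ennreal_mult[symmetric])
  finally show "surface_mass g x = 1" .
  have "surface_energy g x = (\<integral>\<^sup>+y. ennreal (r powr (- p)) * ?d y \<partial>lborel)"
  proof (rule nn_integral_cong)
    fix y
    show "ennreal_powr (g (f (x, y))) p * ennreal (J (x, y)) * indicator V y = ennreal (r powr (- p)) * ?d y"
    proof (cases "y \<in> V \<and> (x, y) \<in> K")
      case True
      then have y: "y \<in> V" and w: "(x, y) \<in> W" using x by simp_all
      have "ennreal_powr (g (f (x, y))) p = ennreal ((ratio (x, y) powr (q - 1) / r) powr p)"
        unfolding g[OF y] using True r(2) p by (subst ennreal_powr_ennreal) auto
      also have "(ratio (x, y) powr (q - 1) / r) powr p = r powr (- p) * ratio (x, y) powr q"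
        by (rule weight_powr(2)[OF ratio_pos[OF w] r(2)])
      finally show ?thesis using True J_pos[OF w] by (simp add: ennreal_mult mult.assoc)
    next
      case False
      then show ?thesis using p g[of y] by (cases "y \<in> V") (simp_all add: ennreal_powr_def)
    qed
  qed
  also have "\<dots> = ennreal (r powr (- p)) * ennreal r"
    using d r(1) by (subst nn_integral_cmult) auto
  also have "\<dots> = ennreal (r powr (1 - p))"
    using r(2) powr_mult_base[of r "- p"] by (simp add: ennreal_mult[symmetric] mult.commute)
  finally show "surface_energy g x = ennreal (r powr (1 - p))" .
qed

lemma surface_energy_zero:
  assumes "\<And>y. y \<in> V \<Longrightarrow> g (f (x, y)) = 0"
  shows "surface_energy g x = 0"
proof -
  have "surface_energy g x = (\<integral>\<^sup>+y. 0 \<partial>(lborel :: (real^'m) measure))"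
  proof (rule nn_integral_cong)
    fix y show "ennreal_powr (g (f (x, y))) p * ennreal (J (x, y)) * indicator V y = 0"
      using assms[of y] p by (cases "y \<in> V") (simp_all add: ennreal_powr_def)
  qed
  then show ?thesis by simp
qed

text \<open>
  Let \<open>t\<close> be the value of the extremal function on the surface and \<open>r = l x\<close>, which may be assumed finite since
  the bound is zero otherwise. The tangent inequality at \<open>t\<close>
  reads \<open>p t^(p-1) g \<le> g^p + (p-1) t^p\<close>. Multiplied by \<open>J\<close> its left-hand side is \<open>p r^(1-p) g Jy\<close>, which the
  admissibility condition integrates to at least \<open>p r^(1-p)\<close>, while the last term integrates to
  \<open>(p-1) r^(1-p)\<close>.
\<close>

lemma surface_energy_lower_bound:
  assumes x: "x \<in> U" and g: "g \<in> borel_measurable (restrict_space borel \<Omega>)"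
    and one: "1 \<le> surface_mass g x"
  shows "ennreal_powr (l x) (1 - p) \<le> surface_energy g x"
    (is "_ \<le> ?A")
proof (cases "l x")
  case top
  then show ?thesis using p by (simp add: ennreal_powr_def)
next
  case (real r)
  then have r: "0 < r" using l_pos[OF x] by (cases "r = 0") auto
  define t where "t y = ratio (x, y) powr (q - 1) / r" for y
  note m1 = measurable_surface_integrand[OF g Jy_cont x]
  note m2 = measurable_surface_integrand[OF measurable_compose[OF g ennreal_powr_measurable] J_cont x]
  have m3: "(\<lambda>y. ennreal (weight (x, y)) * indicator V y) \<in> borel_measurable borel"
    by (rule measurable_on_slice[OF weight_cont x])
  have "ennreal (p * r powr (1 - p)) * 1 \<le> ennreal (p * r powr (1 - p)) * surface_mass g x"
    using one by (rule mult_left_mono) simp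
  also have "\<dots> = (\<integral>\<^sup>+y. ennreal (p * r powr (1 - p)) * (g (f (x, y)) * ennreal (Jy (x, y)) * indicator V y) \<partial>lborel)"
    using m1 by (intro nn_integral_cmult[symmetric]) simp
  also have "\<dots> \<le> (\<integral>\<^sup>+y. ennreal_powr (g (f (x, y))) p * ennreal (J (x, y)) * indicator V y
      + ennreal ((p - 1) * r powr (- p)) * (ennreal (weight (x, y)) * indicator V y) \<partial>lborel)"
  proof (rule nn_integral_mono)
    fix y
    show "ennreal (p * r powr (1 - p)) * (g (f (x, y)) * ennreal (Jy (x, y)) * indicator V y)
      \<le> ennreal_powr (g (f (x, y))) p * ennreal (J (x, y)) * indicator V y
      + ennreal ((p - 1) * r powr (- p)) * (ennreal (weight (x, y)) * indicator V y)"
    proof (cases "y \<in> V")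
      case True
      then have w: "(x, y) \<in> W" using x by simp
      note pos = ratio_pos[OF w] J_pos[OF w] Jy_pos[OF w]
      have t0: "0 \<le> t y" using r by (simp add: t_def)
      have t1: "t y powr (p - 1) * J (x, y) = r powr (1 - p) * Jy (x, y)"
        unfolding t_def weight_powr(1)[OF pos(1) r] using pos by simp
      have t2: "t y powr p = r powr (- p) * ratio (x, y) powr q"
        unfolding t_def by (rule weight_powr(2)[OF pos(1) r])
      have "ennreal (p * r powr (1 - p)) * (g (f (x, y)) * ennreal (Jy (x, y)))
          = ennreal (p * t y powr (p - 1)) * g (f (x, y)) * ennreal (J (x, y))"
      proof -
        have "ennreal (p * r powr (1 - p)) * ennreal (Jy (x, y)) = ennreal (p * t y powr (p - 1)) * ennreal (J (x, y))"
          using t1 p pos by (simp add: ennreal_mult[symmetric] mult.assoc)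
        then show ?thesis by (simp add: mult_ac) (metis mult.left_commute)
      qed
      also have "\<dots> \<le> (ennreal_powr (g (f (x, y))) p + ennreal ((p - 1) * t y powr p)) * ennreal (J (x, y))"
        by (intro mult_right_mono ennreal_power_tangent_le(1) p t0) simp
      also have "\<dots> = ennreal_powr (g (f (x, y))) p * ennreal (J (x, y))
          + ennreal ((p - 1) * r powr (- p)) * ennreal (weight (x, y))"
        using p pos unfolding t2 by (simp add: distrib_right ennreal_mult[symmetric] mult.assoc)
      finally show ?thesis using True by simp
    qed simp
  qed
  also have "\<dots> = ?A + ennreal ((p - 1) * r powr (- p)) * l x"
    using m2 m3 by (simp add: nn_integral_add nn_integral_cmult l_eq)
  also have "ennreal ((p - 1) * r powr (- p)) * l x = ennreal ((p - 1) * r powr (1 - p))"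
    using real r p powr_mult_base[of r "- p"] by (simp add: ennreal_mult[symmetric] mult.commute mult.left_commute)
  finally have "ennreal (p * r powr (1 - p)) \<le> ?A + ennreal ((p - 1) * r powr (1 - p))" by simp
  moreover have "ennreal (p * r powr (1 - p)) = ennreal (r powr (1 - p)) + ennreal ((p - 1) * r powr (1 - p))"
    using p r by (subst ennreal_plus[symmetric]) (auto simp: algebra_simps)
  ultimately have "ennreal (r powr (1 - p)) \<le> ?A"
    by (simp add: add.commute ennreal_add_left_cancel_le)
  then show ?thesis using real r by (simp add: ennreal_powr_neg)
qed

section \<open>The extremal function\<close>

abbreviation f\<Sigma> :: "real^('k + 'm) \<Rightarrow> ennreal" where
  "f\<Sigma> \<equiv> f_Sigma q f U V"
abbreviation modulus_value :: ennreal where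
  "modulus_value \<equiv> \<integral>\<^sup>+x\<in>U. ennreal_powr (l x) (1 - p) \<partial>lborel"

lemma f_Sigma_f: "w \<in> W \<Longrightarrow> f\<Sigma> (f w) = 1 / l (fst w) * ennreal (ratio w powr (q - 1))"
  by (simp add: f_Sigma_def F_f case_prod_beta)

lemma f_Sigma_f_finite:
  assumes "x \<in> U" "y \<in> V" "l x = ennreal r" "0 < r"
  shows "f\<Sigma> (f (x, y)) = ennreal (indicator W (x, y) * ratio (x, y) powr (q - 1) / r)"
proof -
  have "f\<Sigma> (f (x, y)) = 1 / ennreal r * ennreal (ratio (x, y) powr (q - 1))"
    using f_Sigma_f[of "(x, y)"] assms by simp
  also have "1 / ennreal r = ennreal (1 / r)"
    using assms(4) divide_ennreal[of 1 r] by simp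
  also have "ennreal (1 / r) * ennreal (ratio (x, y) powr (q - 1)) = ennreal (1 / r * ratio (x, y) powr (q - 1))"
    using assms(4) by (intro ennreal_mult[symmetric]) auto
  finally show ?thesis using assms by simp
qed

lemma f_Sigma_f_infinite: "x \<in> U \<Longrightarrow> y \<in> V \<Longrightarrow> l x = top \<Longrightarrow> f\<Sigma> (f (x, y)) = 0"
  using f_Sigma_f[of "(x, y)"] by simp

lemma borel_measurable_fst: "fst \<in> borel_measurable (borel :: ((real^'k) \<times> (real^'m)) measure)"
  by (intro borel_measurable_continuous_onI continuous_intros)

lemma fst_measurable:
  "h \<in> measurable borel N \<Longrightarrow> (\<lambda>w::(real^'k) \<times> (real^'m). h (fst w)) \<in> measurable borel N"
  by (rule measurable_compose[OF borel_measurable_fst])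

lemma ratio_measurable: "(\<lambda>w. indicator W w *\<^sub>R ratio w powr a) \<in> borel_measurable borel"
  by (rule restrict_W_borel[OF ratio_powr_cont])

lemma f_Sigma_measurable: "f\<Sigma> \<in> borel_measurable (restrict_space borel \<Omega>)"
proof -
  define S where "S w = inverse (l (fst w) * indicator U (fst w)) * ennreal (indicator W w *\<^sub>R ratio w powr (q - 1))" for w
  have [measurable]: "(\<lambda>w::(real^'k) \<times> (real^'m). l (fst w) * indicator U (fst w)) \<in> borel_measurable borel"
    by (rule fst_measurable[OF l_measurable])
  note ratio_measurable[measurable]
  have "S \<in> borel_measurable borel" unfolding S_def by measurable
  then have "(\<lambda>z. S (F z)) \<in> borel_measurable (restrict_space borel \<Omega>)" by (rule measurable_pullback)
  also have "?this \<longleftrightarrow> f\<Sigma> \<in> borel_measurable (restrict_space borel \<Omega>)"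
  proof (rule measurable_cong)
    fix z assume "z \<in> space (restrict_space borel \<Omega>)"
    then have "z \<in> f ` W" using image_f by (simp add: space_restrict_space)
    then obtain w where w: "w \<in> W" "z = f w" by blast
    then show "S (F z) = f\<Sigma> z"
      using f_Sigma_f[OF w(1)] by (auto simp: S_def F_f divide_ennreal_def)
  qed
  finally show ?thesis .
qed

lemma l_as_weighted:
  "x \<in> U \<Longrightarrow> (\<integral>\<^sup>+y\<in>V. indicator W (x, y) * ennreal (weight (x, y)) \<partial>lborel) = l x"
  unfolding l_eq by (intro nn_integral_cong) (simp split: split_indicator)

lemma l_finiteE:
  assumes "x \<in> U" "l x \<noteq> top"
  obtains r where "l x = ennreal r" "0 < r"
proof (cases "l x")
  case (real r)
  then show ?thesis using that l_pos[OF assms(1)] by (cases "r = 0") auto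
qed (use assms in simp)

lemma W_borel: "W \<in> sets borel"
  using open_W by simp

lemma f_Sigma_surface_mass:
  assumes "x \<in> U" "l x \<noteq> top"
  shows "surface_mass f\<Sigma> x = 1"
proof -
  obtain r where r: "l x = ennreal r" "0 < r" using l_finiteE[OF assms] .
  show ?thesis
    by (rule weighted_surface(1)[OF assms(1) W_borel trans[OF l_as_weighted[OF assms(1)] r(1)] r(2)
          f_Sigma_f_finite[OF assms(1) _ r]])
qed

lemma f_Sigma_surface_energy:
  assumes "x \<in> U"
  shows "surface_energy f\<Sigma> x = ennreal_powr (l x) (1 - p)"
proof (cases "l x = top")
  case True
  then show ?thesis
    using surface_energy_zero[of f\<Sigma> x, OF f_Sigma_f_infinite[OF assms _ True]] p by (simp add: ennreal_powr_def)
next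
  case False
  obtain r where r: "l x = ennreal r" "0 < r" using l_finiteE[OF assms False] .
  have "surface_energy f\<Sigma> x = ennreal (r powr (1 - p))"
    by (rule weighted_surface(2)[OF assms(1) W_borel trans[OF l_as_weighted[OF assms(1)] r(1)] r(2)
          f_Sigma_f_finite[OF assms(1) _ r]])
  then show ?thesis using r by (simp add: ennreal_powr_neg)
qed

lemma f_Sigma_energy: "p_energy p \<Omega> f\<Sigma> = modulus_value"
  unfolding p_energy_eq[OF f_Sigma_measurable]
proof (rule nn_integral_cong)
  fix x
  show "surface_energy f\<Sigma> x * indicator U x
    = ennreal_powr (l x) (1 - p) * indicator U x"
    using f_Sigma_surface_energy[of x] by (cases "x \<in> U") simp_all
qed

text \<open>
  The lower bound holds surface by surface, and energies integrate over \<open>U\<close>.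
\<close>

lemma modulus_ge: "modulus_value \<le> p_modulus CARD('m) p \<Omega> (surface f V ` U)"
  unfolding p_modulus_def
proof (rule INF_greatest)
  fix g assume "g \<in> adm CARD('m) \<Omega> (surface f V ` U)"
  then have g: "g \<in> borel_measurable (restrict_space borel \<Omega>)"
      "\<And>x. x \<in> U \<Longrightarrow> 1 \<le> surface_mass g x"
    by (simp_all add: in_adm_iff[OF subset_refl])
  show "modulus_value \<le> p_energy p \<Omega> g"
    unfolding p_energy_eq[OF g(1)]
  proof (rule nn_integral_mono)
    fix x
    show "ennreal_powr (l x) (1 - p) * indicator U x
      \<le> surface_energy g x * indicator U x"
      using surface_energy_lower_bound[OF _ g(1) g(2), of x] by (cases "x \<in> U") simp_all
  qed
qed

section \<open>Surfaces on which the extremal function vanishes\<close>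

text \<open>
  On \<open>trunc N\<close> the weight and \<open>y\<close> are bounded, so the truncated \<open>l\<close> is finite; the
  sets exhaust \<open>U \<times> V\<close>.
\<close>

definition trunc :: "nat \<Rightarrow> ((real^'k) \<times> (real^'m)) set" where
  "trunc N = {w \<in> W. weight w \<le> real N \<and> norm (snd w) \<le> real N}"

definition l_trunc :: "nat \<Rightarrow> real^'k \<Rightarrow> ennreal" where
  "l_trunc N x = (\<integral>\<^sup>+y\<in>V. indicator (trunc N) (x, y) * ennreal (weight (x, y)) \<partial>lborel)"

lemma trunc_borel: "trunc N \<in> sets borel"
proof -
  have [measurable]: "(\<lambda>w. indicator W w *\<^sub>R weight w) \<in> borel_measurable borel" "W \<in> sets borel"
    by (rule restrict_W_borel[OF weight_cont], rule W_borel)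
  have [measurable]: "(\<lambda>w::(real^'k) \<times> (real^'m). norm (snd w)) \<in> borel_measurable borel"
    by (intro borel_measurable_continuous_onI continuous_intros)
  have "{w \<in> space borel. w \<in> W \<and> indicator W w *\<^sub>R weight w \<le> real N \<and> norm (snd w) \<le> real N} \<in> sets borel"
    by measurable
  also have "{w \<in> space borel. w \<in> W \<and> indicator W w *\<^sub>R weight w \<le> real N \<and> norm (snd w) \<le> real N} = trunc N"
    by (auto simp: trunc_def)
  finally show ?thesis .
qed

lemma l_trunc_measurable: "l_trunc N \<in> borel_measurable borel"
proof -
  have "(\<lambda>w. ennreal (indicator W w *\<^sub>R weight w)) \<in> borel_measurable borel"
    using restrict_W_borel[OF weight_cont] by (rule measurable_compose) simp
  then have "(\<lambda>w. indicator (trunc N) w * ennreal (indicator W w *\<^sub>R weight w)) \<in> borel_measurable borel"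
    using trunc_borel by (intro borel_measurable_times_ennreal borel_measurable_indicator)
  from measurable_slice_integral(1)[OF this]
  have "(\<lambda>x. \<integral>\<^sup>+y. indicator (trunc N) (x, y) * ennreal (indicator W (x, y) *\<^sub>R weight (x, y)) \<partial>lborel) \<in> borel_measurable borel" .
  also have "(\<lambda>x. \<integral>\<^sup>+y. indicator (trunc N) (x, y) * ennreal (indicator W (x, y) *\<^sub>R weight (x, y)) \<partial>lborel) = l_trunc N"
  proof
    fix x
    show "(\<integral>\<^sup>+y. indicator (trunc N) (x, y) * ennreal (indicator W (x, y) *\<^sub>R weight (x, y)) \<partial>lborel) = l_trunc N x"
      unfolding l_trunc_def
    proof (rule nn_integral_cong)
      fix y
      show "indicator (trunc N) (x, y) * ennreal (indicator W (x, y) *\<^sub>R weight (x, y))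
        = indicator (trunc N) (x, y) * ennreal (weight (x, y)) * indicator V y"
        by (cases "(x, y) \<in> trunc N") (simp_all add: trunc_def)
    qed
  qed
  finally show ?thesis .
qed

lemma l_trunc_finite: "l_trunc N x < top"
proof -
  have "l_trunc N x \<le> (\<integral>\<^sup>+y. ennreal (real N) * indicator (cball 0 (real N)) y \<partial>(lborel :: (real^'m) measure))"
    unfolding l_trunc_def
  proof (rule nn_integral_mono)
    fix y
    show "indicator (trunc N) (x, y) * ennreal (weight (x, y)) * indicator V y
      \<le> ennreal (real N) * indicator (cball 0 (real N)) y"
      by (cases "(x, y) \<in> trunc N") (auto simp: trunc_def ennreal_leI split: split_indicator)
  qed
  also have "\<dots> = ennreal (real N) * emeasure lborel (cball (0::real^'m) (real N))"
    by (rule nn_integral_cmult_indicator) simp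
  also have "\<dots> < top"
    using emeasure_bounded_finite[OF bounded_cball, of "0::real^'m" "real N"] by (simp add: ennreal_mult_less_top)
  finally show ?thesis .
qed

lemma l_trunc_SUP:
  assumes x: "x \<in> U"
  shows "(SUP N. l_trunc N x) = l x"
proof -
  let ?d = "\<lambda>y. ennreal (weight (x, y))"
  have Kx: "(\<lambda>y. indicator (trunc N) (x, y) :: ennreal) \<in> borel_measurable borel" for N
    using trunc_borel by (intro measurable_slice_integral(2) borel_measurable_indicator)
  have m: "(\<lambda>y. indicator (trunc N) (x, y) * ?d y * indicator V y) \<in> borel_measurable lborel" for N
    using borel_measurable_times_ennreal[OF Kx measurable_on_slice[OF weight_cont x]] by (simp add: mult.assoc)
  have mono: "indicator (trunc M0) (x, y) \<le> (indicator (trunc N) (x, y) :: ennreal)" if "M0 \<le> N" for M0 N y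
  proof -
    have "real M0 \<le> real N" using that by simp
    then show ?thesis by (auto simp: trunc_def indicator_def)
  qed
  have sup: "(SUP N. indicator (trunc N) (x, y) * ?d y * indicator V y) = ?d y * indicator V y" for y
  proof (cases "y \<in> V")
    case True
    obtain N where N: "max (weight (x, y)) (norm y) \<le> real N" using real_arch_simple by blast
    then have "(x, y) \<in> trunc N" using x True by (simp add: trunc_def)
    show ?thesis
    proof (rule antisym)
      show "(SUP N. indicator (trunc N) (x, y) * ?d y * indicator V y) \<le> ?d y * indicator V y"
        by (rule SUP_least) (simp split: split_indicator)
      show "?d y * indicator V y \<le> (SUP N. indicator (trunc N) (x, y) * ?d y * indicator V y)"
        using \<open>(x, y) \<in> trunc N\<close> by (intro SUP_upper2[of N]) simp_all
    qed
  qed simp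
  have "l x = (\<integral>\<^sup>+y. (SUP N. indicator (trunc N) (x, y) * ?d y * indicator V y) \<partial>lborel)"
    unfolding sup by (rule l_eq)
  also have "\<dots> = (SUP N. \<integral>\<^sup>+y. indicator (trunc N) (x, y) * ?d y * indicator V y \<partial>lborel)"
  proof (rule nn_integral_monotone_convergence_SUP)
    show "incseq (\<lambda>N y. indicator (trunc N) (x, y) * ?d y * indicator V y)"
      unfolding incseq_def le_fun_def by (intro allI impI mult_right_mono mono) simp_all
  qed (rule m)
  finally show ?thesis by (simp add: l_trunc_def)
qed

text \<open>
  Where \<open>l\<close> is infinite, the truncations \<open>l_trunc N x\<close> exceed any bound. A function of the extremal form for
  the truncated weight has mass \<open>1\<close> on the surface and energy \<open>l_trunc N x powr (1 - p)\<close>, which is small for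
  large \<open>N\<close>. The level \<open>N = n x\<close> is chosen for each \<open>x\<close> separately, so that this energy is below a given
  positive function \<open>\<phi>\<close> of small integral; a level common to all \<open>x\<close> would not do in general, for
  instance if the total energy over a \<open>U\<close> of infinite measure diverges at every level.
\<close>

lemma infinite_surfaces_cheap:
  assumes "0 < \<epsilon>"
  shows "\<exists>g. g \<in> borel_measurable (restrict_space borel \<Omega>) \<and> p_energy p \<Omega> g \<le> ennreal \<epsilon> \<and>
    (\<forall>x\<in>U. l x = top \<longrightarrow> 1 \<le> surface_mass g x)"
proof -
  obtain h :: "real^'k \<Rightarrow> real" where h: "h \<in> borel_measurable lborel" "\<And>x. 0 < h x" "\<And>x. h x \<le> 1" "integrable lborel h"
  proof (rule sigma_finite_measure.obtain_positive_integrable_function[OF lborel.sigma_finite_measure_axioms])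
    fix h :: "real^'k \<Rightarrow> real"
    assume "h \<in> borel_measurable lborel" "\<And>x. 0 < h x" "\<And>x. h x \<le> 1" "integrable lborel h"
    then show thesis by (rule that)
  qed
  define i where "i = integral\<^sup>L lborel h"
  have i: "0 \<le> i" unfolding i_def by (rule Bochner_Integration.integral_nonneg) (rule less_imp_le[OF h(2)])
  define c where "c = \<epsilon> / (i + 1)"
  have c: "0 < c" "c * i \<le> \<epsilon>"
  proof -
    show "0 < c" unfolding c_def using \<open>0 < \<epsilon>\<close> i by (intro divide_pos_pos) simp_all
    then have "c * i \<le> c * (i + 1)" by simp
    also have "c * (i + 1) = \<epsilon>" using i by (simp add: c_def)
    finally show "c * i \<le> \<epsilon>" .
  qed
  define \<phi> where "\<phi> x = c * h x" for x
  have \<phi>_pos: "0 < \<phi> x" for x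
    using c h(2)[of x] by (simp add: \<phi>_def)
  have \<phi>_meas [measurable]: "\<phi> \<in> borel_measurable borel" using h(1) unfolding \<phi>_def by measurable
  have \<phi>_int: "(\<integral>\<^sup>+x. ennreal (\<phi> x) \<partial>lborel) \<le> ennreal \<epsilon>"
  proof -
    have "(\<integral>\<^sup>+x. ennreal (\<phi> x) \<partial>lborel) = ennreal (integral\<^sup>L lborel \<phi>)"
    proof (rule nn_integral_eq_integral)
      show "integrable lborel \<phi>" unfolding \<phi>_def[abs_def] using h(4) by simp
      show "AE x in lborel. 0 \<le> \<phi> x" by (intro AE_I2 less_imp_le \<phi>_pos)
    qed
    also have "integral\<^sup>L lborel \<phi> = c * i" by (simp add: \<phi>_def[abs_def] i_def)
    finally show ?thesis using c(2) by (simp add: ennreal_leI)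
  qed
  \<comment> \<open>The size of the truncated \<open>l\<close> that makes the energy equal to \<open>\<phi>\<close>.\<close>
  define \<tau> where "\<tau> x = \<phi> x powr (1 / (1 - p))" for x
  have \<tau>: "0 < \<tau> x" "\<tau> x powr (1 - p) = \<phi> x" for x
  proof -
    show "0 < \<tau> x" unfolding \<tau>_def using \<phi>_pos[of x] by simp
    have "1 / (1 - p) * (1 - p) = 1" using p by simp
    then show "\<tau> x powr (1 - p) = \<phi> x" unfolding \<tau>_def powr_powr using \<phi>_pos[of x] by simp
  qed
  have \<tau>_meas: "\<tau> \<in> borel_measurable borel" unfolding \<tau>_def by measurable
  define n where "n x = (LEAST N. ennreal (\<tau> x) \<le> l_trunc N x)" for x
  have n: "ennreal (\<tau> x) \<le> l_trunc (n x) x" if "x \<in> U" "l x = top" for x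
  proof -
    have "ennreal (\<tau> x) < (SUP N. l_trunc N x)" unfolding l_trunc_SUP[OF that(1)] that(2) by simp
    then obtain N where "ennreal (\<tau> x) < l_trunc N x" unfolding less_SUP_iff by blast
    then have "ennreal (\<tau> x) \<le> l_trunc N x" by (rule less_imp_le)
    then show ?thesis unfolding n_def by (rule LeastI[where P="\<lambda>N. ennreal (\<tau> x) \<le> l_trunc N x"])
  qed
  have n_meas: "n \<in> measurable borel (count_space UNIV)"
    unfolding n_def
  proof (rule measurable_Least)
    fix N
    note l_trunc_measurable[measurable] \<tau>_meas[measurable]
    show "Measurable.pred borel (\<lambda>x. ennreal (\<tau> x) \<le> l_trunc N x)" by measurable
  qed
  define A where "A = {x \<in> U. l x = top}"
  have A_borel: "A \<in> sets borel"
  proof -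
    note l_measurable[measurable]
    have "{x \<in> space borel. l x * indicator U x = top} \<in> sets borel" by measurable
    also have "{x \<in> space borel. l x * indicator U x = top} = A"
      by (auto simp: A_def indicator_def)
    finally show ?thesis .
  qed
  define G where "G N w = indicator A (fst w) *
    ennreal (indicator (trunc N) w * (indicator W w *\<^sub>R ratio w powr (q - 1)) / enn2real (l_trunc N (fst w)))" for N w
  have G_meas: "G N \<in> borel_measurable borel" for N
  proof -
    have [measurable]: "(\<lambda>w::(real^'k) \<times> (real^'m). indicator A (fst w) :: ennreal) \<in> borel_measurable borel"
      by (rule fst_measurable) (rule borel_measurable_indicator[OF A_borel])
    have [measurable]: "(\<lambda>w::(real^'k) \<times> (real^'m). l_trunc N (fst w)) \<in> borel_measurable borel"
      by (rule fst_measurable[OF l_trunc_measurable])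
    note ratio_measurable[measurable] trunc_borel[measurable]
    show ?thesis unfolding G_def by measurable
  qed
  have n_fst: "(\<lambda>w::(real^'k) \<times> (real^'m). n (fst w)) \<in> measurable borel (count_space UNIV)"
    by (rule fst_measurable[OF n_meas])
  \<comment> \<open>Measurability of \<open>g\<close> rests on the countable range of \<open>n\<close>.\<close>
  define g where "g z = G (n (fst (F z))) (F z)" for z
  have g_meas: "g \<in> borel_measurable (restrict_space borel \<Omega>)"
    unfolding g_def
    by (rule measurable_pullback[OF measurable_compose_countable[OF G_meas n_fst]])
  have g_f: "g (f (x, y)) = indicator A x * ennreal (indicator (trunc (n x)) (x, y) * ratio (x, y) powr (q - 1) / enn2real (l_trunc (n x) x))"
    if "x \<in> U" "y \<in> V" for x y
    using that by (simp add: g_def F_f G_def)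
  have slice: "surface_mass g x = 1 \<and>
      surface_energy g x \<le> ennreal (\<phi> x)"
    if x: "x \<in> U" "l x = top" for x
  proof -
    define r where "r = enn2real (l_trunc (n x) x)"
    have u_r: "l_trunc (n x) x = ennreal r" using l_trunc_finite[of "n x" x] by (simp add: r_def)
    have "0 \<le> r" by (simp add: r_def)
    then have "\<tau> x \<le> r" using n[OF x] unfolding u_r by simp
    then have r: "0 < r" using \<tau>(1)[of x] by linarith
    have gx: "g (f (x, y)) = ennreal (indicator (trunc (n x)) (x, y) * ratio (x, y) powr (q - 1) / r)" if "y \<in> V" for y
      using g_f[OF x(1) that] x by (simp add: A_def r_def)
    note * = weighted_surface[OF x(1) trunc_borel u_r[unfolded l_trunc_def] r gx]
    have "r powr (1 - p) \<le> \<tau> x powr (1 - p)"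
      using \<open>\<tau> x \<le> r\<close> \<tau>(1)[of x] p by (intro powr_mono2') auto
    then show ?thesis using * \<tau>(2)[of x] by (simp add: ennreal_leI)
  qed
  have "p_energy p \<Omega> g \<le> (\<integral>\<^sup>+x. ennreal (\<phi> x) \<partial>lborel)"
    unfolding p_energy_eq[OF g_meas]
  proof (rule nn_integral_mono)
    fix x
    show "surface_energy g x * indicator U x \<le> ennreal (\<phi> x)"
    proof (cases "x \<in> U")
      case U: True
      show ?thesis
      proof (cases "l x = top")
        case True
        then show ?thesis using slice[OF U] U by simp
      next
        case False
        have "surface_energy g x = 0"
          using g_f[OF U] False by (intro surface_energy_zero) (simp add: A_def)
        then show ?thesis by simp
      qed
    qed simp
  qed
  then have "p_energy p \<Omega> g \<le> ennreal \<epsilon>" using \<phi>_int by (rule order_trans)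
  moreover have "1 \<le> surface_mass g x" if "x \<in> U" "l x = top" for x
    using slice[OF that] by simp
  ultimately show ?thesis using g_meas by blast
qed

section \<open>Modulus and extremality\<close>

abbreviation infinite_surfaces :: "(real^('k + 'm)) set set" where
  "infinite_surfaces \<equiv> surface f V ` {x \<in> U. l x = top}"

lemma p_modulus_infinite: "p_modulus CARD('m) p \<Omega> infinite_surfaces = 0"
proof -
  have "p_modulus CARD('m) p \<Omega> infinite_surfaces \<le> 0 + ennreal \<epsilon>" if \<epsilon>: "0 < \<epsilon>" for \<epsilon>
  proof -
    obtain g where g: "g \<in> borel_measurable (restrict_space borel \<Omega>)" "p_energy p \<Omega> g \<le> ennreal \<epsilon>"
        "\<forall>x\<in>U. l x = top \<longrightarrow> 1 \<le> surface_mass g x"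
      using infinite_surfaces_cheap[OF \<epsilon>] by blast
    have "g \<in> adm CARD('m) \<Omega> infinite_surfaces"
      using g(1,3) by (subst in_adm_iff) auto
    then have "p_modulus CARD('m) p \<Omega> infinite_surfaces \<le> p_energy p \<Omega> g"
      unfolding p_modulus_def by (rule INF_lower)
    then show ?thesis using g(2) by simp
  qed
  then have "p_modulus CARD('m) p \<Omega> infinite_surfaces \<le> 0" by (rule ennreal_le_epsilon)
  then show ?thesis by simp
qed

lemma slice_integral_mono:
  assumes "\<And>z. g z \<le> h z"
  shows "surface_mass g x \<le> surface_mass h x"
  by (intro nn_integral_mono mult_right_mono assms) simp_all

lemma p_energy_max_le:
  assumes g: "g \<in> borel_measurable (restrict_space borel \<Omega>)" and h: "h \<in> borel_measurable (restrict_space borel \<Omega>)"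
  shows "p_energy p \<Omega> (\<lambda>z. max (g z) (h z)) \<le> p_energy p \<Omega> g + p_energy p \<Omega> h"
proof -
  have m: "(\<lambda>z. ennreal_powr (v z) p * indicator \<Omega> z) \<in> borel_measurable lborel"
    if "v \<in> borel_measurable (restrict_space borel \<Omega>)" for v
    using measurable_compose[OF that ennreal_powr_measurable] measurable_restrict_\<Omega>[of "\<lambda>z. ennreal_powr (v z) p"] by simp
  have "p_energy p \<Omega> (\<lambda>z. max (g z) (h z)) \<le> (\<integral>\<^sup>+z. ennreal_powr (g z) p * indicator \<Omega> z + ennreal_powr (h z) p * indicator \<Omega> z \<partial>lborel)"
    unfolding p_energy_def
    by (rule nn_integral_mono) (simp add: max_def split: split_indicator)
  also have "\<dots> = p_energy p \<Omega> g + p_energy p \<Omega> h"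
    unfolding p_energy_def by (rule nn_integral_add[OF m[OF g] m[OF h]])
  finally show ?thesis .
qed

text \<open>
  For the upper bound, the extremal function is corrected on the surfaces with infinite \<open>l\<close>, where it
  vanishes, by a function of small energy.
\<close>

theorem p_modulus_eq: "p_modulus CARD('m) p \<Omega> (surface f V ` U) = modulus_value"
proof (rule antisym[OF _ modulus_ge], rule ennreal_le_epsilon)
  fix \<epsilon> :: real assume \<epsilon>: "0 < \<epsilon>"
  obtain g where g: "g \<in> borel_measurable (restrict_space borel \<Omega>)" "p_energy p \<Omega> g \<le> ennreal \<epsilon>"
      "\<forall>x\<in>U. l x = top \<longrightarrow> 1 \<le> surface_mass g x"
    using infinite_surfaces_cheap[OF \<epsilon>] by blast
  let ?h = "\<lambda>z. max (f\<Sigma> z) (g z)"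
  have "?h \<in> adm CARD('m) \<Omega> (surface f V ` U)"
    unfolding in_adm_iff[OF subset_refl]
  proof (intro conjI ballI)
    show "?h \<in> borel_measurable (restrict_space borel \<Omega>)"
      using f_Sigma_measurable g(1) by measurable
    fix x assume x: "x \<in> U"
    show "1 \<le> surface_mass ?h x"
    proof (cases "l x = top")
      case True
      then have "1 \<le> surface_mass g x" using g(3) x by blast
      also have "\<dots> \<le> surface_mass ?h x"
        by (rule slice_integral_mono) simp
      finally show ?thesis .
    next
      case False
      have "1 = surface_mass f\<Sigma> x"
        by (rule f_Sigma_surface_mass[OF x False, symmetric])
      also have "\<dots> \<le> surface_mass ?h x"
        by (rule slice_integral_mono) simp
      finally show ?thesis .
    qed
  qed
  then have "p_modulus CARD('m) p \<Omega> (surface f V ` U) \<le> p_energy p \<Omega> ?h"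
    unfolding p_modulus_def by (rule INF_lower)
  also have "\<dots> \<le> p_energy p \<Omega> f\<Sigma> + p_energy p \<Omega> g"
    by (rule p_energy_max_le[OF f_Sigma_measurable g(1)])
  also have "\<dots> \<le> modulus_value + ennreal \<epsilon>"
    unfolding f_Sigma_energy using g(2) by (rule add_left_mono)
  finally show "p_modulus CARD('m) p \<Omega> (surface f V ` U) \<le> modulus_value + ennreal \<epsilon>" .
qed

text \<open>
  On the surfaces with infinite \<open>l\<close> the extremal function is zero; they form the exceptional family.
\<close>

theorem extremal_f_Sigma: "extremal CARD('m) p \<Omega> (surface f V ` U) f\<Sigma>"
  unfolding extremal_def
proof (intro conjI exI[of _ infinite_surfaces])
  show "infinite_surfaces \<subseteq> surface f V ` U" by auto
  show "p_modulus CARD('m) p \<Omega> infinite_surfaces = 0" by (rule p_modulus_infinite)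
  have "f\<Sigma> \<in> adm CARD('m) \<Omega> (surface f V ` {x \<in> U. l x \<noteq> top})"
    using f_Sigma_measurable f_Sigma_surface_mass by (subst in_adm_iff) auto
  moreover have "surface f V ` U - infinite_surfaces \<subseteq> surface f V ` {x \<in> U. l x \<noteq> top}" by blast
  ultimately show "f\<Sigma> \<in> adm CARD('m) \<Omega> (surface f V ` U - infinite_surfaces)"
    by (auto simp: adm_def)
  show "p_energy p \<Omega> f\<Sigma> = p_modulus CARD('m) p \<Omega> (surface f V ` U)"
    by (simp only: f_Sigma_energy p_modulus_eq)
qed

lemma surface_integral_measurable:
  assumes g: "g \<in> borel_measurable (restrict_space borel \<Omega>)" and J': "continuous_on W J'"
  shows "(\<lambda>x. (\<integral>\<^sup>+y\<in>V. g (f (x, y)) * ennreal (J' (x, y)) \<partial>lborel) * indicator U x) \<in> borel_measurable borel"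
proof -
  have "(\<lambda>w. ennreal (indicator W w *\<^sub>R J' w)) \<in> borel_measurable borel"
    using restrict_W_borel[OF J'] by (rule measurable_compose) simp
  from measurable_slice_integral(1)[OF borel_measurable_times_ennreal[OF measurable_along_f[OF g] this]]
  have "(\<lambda>x. \<integral>\<^sup>+y. g (f (x, y)) * indicator W (x, y) * ennreal (indicator W (x, y) *\<^sub>R J' (x, y)) \<partial>lborel) \<in> borel_measurable borel" .
  also have "(\<lambda>x. \<integral>\<^sup>+y. g (f (x, y)) * indicator W (x, y) * ennreal (indicator W (x, y) *\<^sub>R J' (x, y)) \<partial>lborel)
    = (\<lambda>x. (\<integral>\<^sup>+y\<in>V. g (f (x, y)) * ennreal (J' (x, y)) \<partial>lborel) * indicator U x)"
  proof
    fix x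
    show "(\<integral>\<^sup>+y. g (f (x, y)) * indicator W (x, y) * ennreal (indicator W (x, y) *\<^sub>R J' (x, y)) \<partial>lborel)
      = (\<integral>\<^sup>+y\<in>V. g (f (x, y)) * ennreal (J' (x, y)) \<partial>lborel) * indicator U x"
      by (cases "x \<in> U") (auto simp: indicator_times intro!: nn_integral_cong split: split_indicator)
  qed
  finally show ?thesis .
qed

text \<open>
  If \<open>E\<close> carries admissible functions of arbitrarily small energy, then for almost all \<open>x\<close> their surface
  energies come arbitrarily close to \<open>0\<close>, whereas for \<open>x \<in> E\<close> they are at least \<open>l x powr (1 - p)\<close>. The set
  \<open>E\<close> itself may fail to be measurable; the null set is cut out by the infimum of the surface energies.
\<close>

lemma modulus_zero_imp_AE_infinite:
  assumes "p_modulus CARD('m) p \<Omega> (surface f V ` E) = 0" "E \<subseteq> U"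
  shows "AE x in lborel. x \<in> E \<longrightarrow> l x = top"
proof -
  have "\<exists>g. g \<in> adm CARD('m) \<Omega> (surface f V ` E) \<and> p_energy p \<Omega> g < ennreal (1 / real (Suc j))" for j
  proof -
    have "p_modulus CARD('m) p \<Omega> (surface f V ` E) < ennreal (1 / real (Suc j))"
      using assms(1) by simp
    then show ?thesis unfolding p_modulus_def INF_less_iff by blast
  qed
  then have "\<forall>j. \<exists>g. g \<in> adm CARD('m) \<Omega> (surface f V ` E) \<and> p_energy p \<Omega> g < ennreal (1 / real (Suc j))"
    by blast
  from choice[OF this] obtain g where
    g: "\<And>j. g j \<in> adm CARD('m) \<Omega> (surface f V ` E)" "\<And>j. p_energy p \<Omega> (g j) < ennreal (1 / real (Suc j))"
    by blast
  have gm: "g j \<in> borel_measurable (restrict_space borel \<Omega>)" for j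
    using g(1)[of j] unfolding in_adm_iff[OF assms(2)] by blast
  define \<psi> where "\<psi> j x = surface_energy (g j) x * indicator U x" for j x
  have \<psi>_meas: "\<psi> j \<in> borel_measurable lborel" for j
    using surface_integral_measurable[OF measurable_compose[OF gm ennreal_powr_measurable] J_cont]
    by (simp add: \<psi>_def[abs_def])
  have "(\<integral>\<^sup>+x. (INF j. \<psi> j x) \<partial>lborel) \<le> 0 + ennreal e" if "0 < e" for e
  proof -
    obtain j where j: "1 / real (Suc j) < e"
      using reals_Archimedean[OF \<open>0 < e\<close>] by (auto simp: inverse_eq_divide)
    have "(\<integral>\<^sup>+x. (INF j. \<psi> j x) \<partial>lborel) \<le> (\<integral>\<^sup>+x. \<psi> j x \<partial>lborel)"
      by (intro nn_integral_mono INF_lower) simp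
    also have "\<dots> = p_energy p \<Omega> (g j)" unfolding p_energy_eq[OF gm] \<psi>_def ..
    also have "\<dots> \<le> ennreal e"
      using g(2)[of j] j by (meson ennreal_leI less_imp_le order_trans)
    finally show ?thesis by simp
  qed
  then have "(\<integral>\<^sup>+x. (INF j. \<psi> j x) \<partial>lborel) \<le> 0" by (rule ennreal_le_epsilon)
  then have "(\<integral>\<^sup>+x. (INF j. \<psi> j x) \<partial>lborel) = 0" by simp
  then have "AE x in lborel. (INF j. \<psi> j x) = 0"
    using \<psi>_meas by (subst (asm) nn_integral_0_iff_AE) (auto intro!: borel_measurable_INF)
  then show ?thesis
  proof (rule AE_mp, intro AE_I2 impI)
    fix x assume zero: "(INF j. \<psi> j x) = 0" and x: "x \<in> E"
    then have xU: "x \<in> U" using assms(2) by blast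
    have "ennreal_powr (l x) (1 - p) \<le> (INF j. \<psi> j x)"
    proof (rule INF_greatest)
      fix j
      have "1 \<le> surface_mass (g j) x"
        using g(1)[of j] x unfolding in_adm_iff[OF assms(2)] by blast
      then show "ennreal_powr (l x) (1 - p) \<le> \<psi> j x"
        using surface_energy_lower_bound[OF xU gm] xU by (simp add: \<psi>_def)
    qed
    then have *: "ennreal_powr (l x) (1 - p) = 0" using zero by simp
    show "l x = top"
    proof (rule ccontr)
      assume "l x \<noteq> top"
      then obtain r where "l x = ennreal r" "0 < r" using l_finiteE[OF xU] by blast
      then show False using * by (simp add: ennreal_powr_neg)
    qed
  qed
qed

text \<open>
  On a surface with finite \<open>l\<close>, \<open>f\<Sigma> powr (p - 1)\<close> times \<open>J\<close> is \<open>l x powr (1 - p)\<close> times \<open>Jy\<close>. So the integral on the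
  right turns into the surface masses of \<open>g\<close>.
\<close>

lemma p_energy_le_f_Sigma_pairing:
  assumes g: "g \<in> borel_measurable (restrict_space borel \<Omega>)"
    and one: "AE x in lborel. x \<in> U \<longrightarrow> l x \<noteq> top \<longrightarrow> 1 \<le> surface_mass g x"
  shows "modulus_value \<le> (\<integral>\<^sup>+z\<in>\<Omega>. ennreal_powr (f\<Sigma> z) (p - 1) * g z \<partial>lborel)"
proof -
  have m: "(\<lambda>z. ennreal_powr (f\<Sigma> z) (p - 1) * g z) \<in> borel_measurable (restrict_space borel \<Omega>)"
    using measurable_compose[OF f_Sigma_measurable ennreal_powr_measurable] g by (rule borel_measurable_times_ennreal)
  show ?thesis
    unfolding volume_integral[OF m]
  proof (rule nn_integral_mono_AE, use one in eventually_elim)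
    fix x assume 1: "x \<in> U \<longrightarrow> l x \<noteq> top \<longrightarrow> 1 \<le> surface_mass g x"
    show "ennreal_powr (l x) (1 - p) * indicator U x
      \<le> (\<integral>\<^sup>+y\<in>V. ennreal_powr (f\<Sigma> (f (x, y))) (p - 1) * g (f (x, y)) * ennreal (J (x, y)) \<partial>lborel) * indicator U x"
    proof (cases "x \<in> U \<and> l x \<noteq> top")
      case True
      then have x: "x \<in> U" "l x \<noteq> top" by auto
      obtain r where r: "l x = ennreal r" "0 < r" using l_finiteE[OF x] .
      have mg: "(\<lambda>y. g (f (x, y)) * ennreal (Jy (x, y)) * indicator V y) \<in> borel_measurable lborel"
        using measurable_surface_integrand[OF g Jy_cont x(1)] by simp
      have "ennreal_powr (l x) (1 - p) * 1 \<le> ennreal (r powr (1 - p)) * surface_mass g x"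
        using r 1 x by (intro mult_mono) (auto simp: ennreal_powr_neg)
      also have "\<dots> = (\<integral>\<^sup>+y. ennreal (r powr (1 - p)) * (g (f (x, y)) * ennreal (Jy (x, y)) * indicator V y) \<partial>lborel)"
        using mg by (rule nn_integral_cmult[symmetric])
      also have "\<dots> = (\<integral>\<^sup>+y\<in>V. ennreal_powr (f\<Sigma> (f (x, y))) (p - 1) * g (f (x, y)) * ennreal (J (x, y)) \<partial>lborel)"
      proof (rule nn_integral_cong)
        fix y
        show "ennreal (r powr (1 - p)) * (g (f (x, y)) * ennreal (Jy (x, y)) * indicator V y)
          = ennreal_powr (f\<Sigma> (f (x, y))) (p - 1) * g (f (x, y)) * ennreal (J (x, y)) * indicator V y"
        proof (cases "y \<in> V")
          case y: True
          then have w: "(x, y) \<in> W" using x by simp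
          note pos = ratio_pos[OF w] J_pos[OF w] Jy_pos[OF w]
          have "ennreal_powr (f\<Sigma> (f (x, y))) (p - 1) = ennreal ((ratio (x, y) powr (q - 1) / r) powr (p - 1))"
            using f_Sigma_f_finite[OF x(1) y r] w p r pos by (simp add: ennreal_powr_ennreal)
          also have "\<dots> = ennreal (r powr (1 - p) * ratio (x, y))"
            by (simp only: weight_powr(1)[OF pos(1) r(2)])
          finally have "ennreal_powr (f\<Sigma> (f (x, y))) (p - 1) * ennreal (J (x, y)) = ennreal (r powr (1 - p) * ratio (x, y) * J (x, y))"
            using pos by (simp add: ennreal_mult[symmetric])
          also have "r powr (1 - p) * ratio (x, y) * J (x, y) = r powr (1 - p) * Jy (x, y)" using pos by simp
          also have "ennreal (r powr (1 - p) * Jy (x, y)) = ennreal (r powr (1 - p)) * ennreal (Jy (x, y))"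
            using pos by (simp add: ennreal_mult)
          finally have eq: "ennreal_powr (f\<Sigma> (f (x, y))) (p - 1) * ennreal (J (x, y)) = ennreal (r powr (1 - p)) * ennreal (Jy (x, y))" .
          have "ennreal (r powr (1 - p)) * (g (f (x, y)) * ennreal (Jy (x, y))) = (ennreal (r powr (1 - p)) * ennreal (Jy (x, y))) * g (f (x, y))"
            by (simp only: mult_ac)
          also have "\<dots> = ennreal_powr (f\<Sigma> (f (x, y))) (p - 1) * g (f (x, y)) * ennreal (J (x, y))"
            unfolding eq[symmetric] by (simp only: mult_ac)
          finally show ?thesis using y by simp
        qed simp
      qed
      finally show ?thesis using x by simp
    next
      case False
      then show ?thesis using p by (auto simp: ennreal_powr_def indicator_def)
    qed
  qed
qed

lemma f_Sigma_lt_top: "z \<in> \<Omega> \<Longrightarrow> f\<Sigma> z < top"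
proof -
  assume "z \<in> \<Omega>"
  then obtain x y where xy: "x \<in> U" "y \<in> V" "z = f (x, y)" using image_f by blast
  show "f\<Sigma> z < top"
  proof (cases "l x = top")
    case True
    then show ?thesis using f_Sigma_f_infinite xy by simp
  next
    case False
    then obtain r where "l x = ennreal r" "0 < r" using l_finiteE[OF xy(1)] by blast
    then show ?thesis using f_Sigma_f_finite[OF xy(1,2)] xy(3) by simp
  qed
qed

text \<open>
  Integrate the tangent inequality at \<open>f\<Sigma>\<close> over the whole domain. For extremal \<open>g\<close> the larger side \<open>a\<close> has
  integral \<open>p\<close> times the modulus, and by the pairing lemma the smaller side \<open>b\<close> has at least that. As the
  modulus is finite, equality holds almost everywhere, and the tangent touches the power only at
  \<open>g = f\<Sigma>\<close>.
\<close>

theorem extremal_unique: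
  assumes fin: "modulus_value < top" and ext: "extremal CARD('m) p \<Omega> (surface f V ` U) g"
  shows "AE z in lborel. z \<in> \<Omega> \<longrightarrow> g z = f\<Sigma> z"
proof -
  obtain \<Sigma>1 where S1: "\<Sigma>1 \<subseteq> surface f V ` U" "p_modulus CARD('m) p \<Omega> \<Sigma>1 = 0"
      "g \<in> adm CARD('m) \<Omega> (surface f V ` U - \<Sigma>1)"
    and en: "p_energy p \<Omega> g = modulus_value"
    using ext unfolding extremal_def p_modulus_eq by blast
  have g: "g \<in> borel_measurable (restrict_space borel \<Omega>)" using S1(3) by (simp add: adm_def)
  define E where "E = {x \<in> U. surface f V x \<in> \<Sigma>1}"
  have "surface f V ` E = \<Sigma>1" using S1(1) by (auto simp: E_def)
  then have null: "AE x in lborel. x \<in> E \<longrightarrow> l x = top"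
    using S1(2) by (intro modulus_zero_imp_AE_infinite) (auto simp: E_def)
  have "AE x in lborel. x \<in> U \<longrightarrow> l x \<noteq> top \<longrightarrow> 1 \<le> surface_mass g x"
    using null
  proof (rule AE_mp, intro AE_I2 impI)
    fix x assume x: "x \<in> E \<longrightarrow> l x = top" "x \<in> U" "l x \<noteq> top"
    then have "surface f V x \<in> surface f V ` U - \<Sigma>1" by (auto simp: E_def)
    moreover have "\<forall>\<sigma>\<in>surface f V ` U - \<Sigma>1. 1 \<le> (\<integral>\<^sup>+z\<in>\<sigma>. g z \<partial>hausdorff_measure CARD('m))"
      using S1(3) by (simp add: adm_def)
    ultimately have "1 \<le> (\<integral>\<^sup>+z\<in>surface f V x. g z \<partial>hausdorff_measure CARD('m))" by (rule bspec[rotated])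
    then show "1 \<le> surface_mass g x"
      unfolding surface_integral[OF g x(2)] .
  qed
  note pairing = p_energy_le_f_Sigma_pairing[OF g this]
  define a where "a z = (ennreal_powr (g z) p + ennreal (p - 1) * ennreal_powr (f\<Sigma> z) p) * indicator \<Omega> z" for z
  define b where "b z = ennreal p * (ennreal_powr (f\<Sigma> z) (p - 1) * g z * indicator \<Omega> z)" for z
  have restr: "(\<lambda>z. v z * indicator \<Omega> z) \<in> borel_measurable lborel"
    if "v \<in> borel_measurable (restrict_space borel \<Omega>)" for v :: "_ \<Rightarrow> ennreal"
    using that measurable_restrict_\<Omega> by simp
  note mp = restr[OF measurable_compose[OF g ennreal_powr_measurable[of p]]]
    restr[OF measurable_compose[OF f_Sigma_measurable ennreal_powr_measurable[of p]]]
    restr[OF borel_measurable_times_ennreal[OF measurable_compose[OF f_Sigma_measurable ennreal_powr_measurable[of "p - 1"]] g]]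
  have a_eq: "a z = ennreal_powr (g z) p * indicator \<Omega> z + ennreal (p - 1) * (ennreal_powr (f\<Sigma> z) p * indicator \<Omega> z)" for z
    unfolding a_def by (simp add: distrib_right mult.assoc)
  have a_meas: "a \<in> borel_measurable lborel"
    unfolding a_eq[abs_def]
    by (rule borel_measurable_add[OF mp(1) borel_measurable_times_ennreal[OF borel_measurable_const mp(2)]])
  have b_meas: "b \<in> borel_measurable lborel"
    unfolding b_def[abs_def] by (rule borel_measurable_times_ennreal[OF borel_measurable_const mp(3)])
  have a_int: "integral\<^sup>N lborel a = ennreal p * modulus_value"
  proof -
    have "integral\<^sup>N lborel a = p_energy p \<Omega> g + ennreal (p - 1) * p_energy p \<Omega> f\<Sigma>"
      unfolding a_eq p_energy_def nn_integral_cmult[OF mp(2), symmetric]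
      by (rule nn_integral_add[OF mp(1) borel_measurable_times_ennreal[OF borel_measurable_const mp(2)]])
    also have "\<dots> = (ennreal 1 + ennreal (p - 1)) * modulus_value"
      unfolding en f_Sigma_energy distrib_right by simp
    also have "ennreal 1 + ennreal (p - 1) = ennreal p"
      using p by (subst ennreal_plus[symmetric]) auto
    finally show ?thesis .
  qed
  have b_int: "ennreal p * modulus_value \<le> integral\<^sup>N lborel b"
    unfolding b_def nn_integral_cmult[OF mp(3)] using pairing by (rule mult_left_mono) simp
  have pt: "ennreal p * ennreal_powr (f\<Sigma> z) (p - 1) = ennreal (p * t powr (p - 1))"
      "ennreal (p - 1) * ennreal_powr (f\<Sigma> z) p = ennreal ((p - 1) * t powr p)"
    if "f\<Sigma> z = ennreal t" "0 \<le> t" for z t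
    using that p by (simp_all add: ennreal_powr_ennreal ennreal_mult)
  have ba: "b z \<le> a z" for z
  proof (cases "z \<in> \<Omega>")
    case True
    obtain t where t: "f\<Sigma> z = ennreal t" "0 \<le> t" using f_Sigma_lt_top[OF True] by (cases "f\<Sigma> z") auto
    show ?thesis
      using ennreal_power_tangent_le(1)[OF p t(2), of "g z"] True
      unfolding a_def b_def pt(2)[OF t] by (simp add: mult.assoc[symmetric] pt(1)[OF t])
  qed (simp add: a_def b_def)
  have a_fin: "integral\<^sup>N lborel a < top"
    unfolding a_int using fin by (simp add: ennreal_mult_less_top)
  have "AE z in lborel. b z = a z"
    using a_meas b_meas ba a_int b_int a_fin by (intro AE_eq_of_le_of_nn_integral_ge) auto
  moreover have "AE z in lborel. a z \<noteq> \<infinity>"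
    using a_meas a_fin by (intro nn_integral_PInf_AE) auto
  ultimately show ?thesis
  proof eventually_elim
    case (elim z)
    show ?case
    proof
      assume z: "z \<in> \<Omega>"
      obtain t where t: "f\<Sigma> z = ennreal t" "0 \<le> t" using f_Sigma_lt_top[OF z] by (cases "f\<Sigma> z") auto
      have "ennreal (p * t powr (p - 1)) * g z = ennreal_powr (g z) p + ennreal ((p - 1) * t powr p)"
        using elim(1) z unfolding a_def b_def pt(2)[OF t] by (simp add: mult.assoc[symmetric] pt(1)[OF t])
      moreover have "ennreal_powr (g z) p < top"
        using elim(2) z by (auto simp: a_def less_top)
      ultimately have "g z = ennreal t" by (rule ennreal_power_tangent_le(2)[OF p t(2)])
      then show "g z = f\<Sigma> z" using t(1) by simp
    qed
  qed
qed

end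

theorem theorem1p4:
  fixes U :: "(real^'k::finite) set"
    and V :: "(real^'m::finite) set"
    and \<Omega> :: "(real^('k + 'm)) set"
    and f :: "(real^'k) \<times> (real^'m) \<Rightarrow> real^('k + 'm)"
    and p q :: real
  assumes "p > 1" and "1 / p + 1 / q = 1"
    and "is_domain U" and "is_domain V" and "is_domain \<Omega>"
    and "C1_diffeomorphism (U \<times> V) \<Omega> f"
  shows "extremal CARD('m) p \<Omega> (surface_family f U V) (f_Sigma q f U V) \<and>
    (p_modulus CARD('m) p \<Omega> (surface_family f U V) < \<infinity> \<longrightarrow>
      (\<forall>g. extremal CARD('m) p \<Omega> (surface_family f U V) g \<longrightarrow>
        (AE z in lborel. z \<in> \<Omega> \<longrightarrow> g z = f_Sigma q f U V z))) \<and>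
    p_modulus CARD('m) p \<Omega> (surface_family f U V) =
      (\<integral>\<^sup>+x\<in>U. ennreal_powr (l_fun q f V x) (1 - p) \<partial>lborel)"
proof -
  interpret surface_foliation U V \<Omega> f p q
    using assms by unfold_locales (auto simp: is_domain_def)
  show ?thesis
    unfolding surface_family_def
  proof (intro conjI impI allI)
    show "extremal CARD('m) p \<Omega> (surface f V ` U) (f_Sigma q f U V)" by (rule extremal_f_Sigma)
    show "p_modulus CARD('m) p \<Omega> (surface f V ` U) = (\<integral>\<^sup>+x\<in>U. ennreal_powr (l_fun q f V x) (1 - p) \<partial>lborel)"
      by (rule p_modulus_eq)
    fix g
    assume "p_modulus CARD('m) p \<Omega> (surface f V ` U) < \<infinity>" and "extremal CARD('m) p \<Omega> (surface f V ` U) g"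
    then show "AE z in lborel. z \<in> \<Omega> \<longrightarrow> g z = f_Sigma q f U V z"
      by (intro extremal_unique) (simp_all add: p_modulus_eq)
  qed
qed

end
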